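(* Let $\epsilon\in(0,1/2)$. For each $n$ let $d=d(n)\ge 1$ be an integer, let $\mathbf X_n=(X_{i,j})_{1\le i<j\le n}$ be independent standard normal vectors in $\mathbb R^d$, and for $s\in S^{d-1}$ let $\chi(\Gamma(\mathbf X_n,s))$ be the chromatic number of the random graph $\Gamma(\mathbf X_n,s)$ on vertex set $[n]$ whose edges are the pairs $\{i,j\}$ with $\langle X_{i,j},s\rangle\ge 0$. Then with high probability the following hold. (i) If $d=o(n/(\log n)^3)$, then for all $s\in S^{d-1}$, $\chi(\Gamma(\mathbf X_n,s))\ge(1-\epsilon)n/(2\log_2 n)$. (ii) If $d\ge 2n\log_2 n/(1-2\epsilon)$, then there exists $s\in S^{d-1}$ such that $\chi(\Gamma(\mathbf X_n,s))\le(1-\epsilon)n/(2\log_2 n)$. (iii) If $d=o(n^2/(\log n)^6)$, then for all $s\in S^{d-1}$, $\chi(\Gamma(\mathbf X_n,s))\le(1+\epsilon)n/(2\log_2 n)$. (iv) If $d\ge\frac12\left[(1+\epsilon)n/(2\log_2 n)\right]^2$, then there exists $s\in S^{d-1}$ such that $\chi(\Gamma(\mathbf X_n,s))\ge(1+\epsilon)n/(2\log_2 n)$.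
   Context: $[n]=\{1,\dots,n\}$; $S^{d-1}$ is the Euclidean unit sphere in $\mathbb R^d$; $\langle\cdot,\cdot\rangle$ is the usual inner product. $\log$ is the natural logarithm and $\log_2$ is the logarithm to base 2. A sequence of events $A_n$ holds with high probability if $\lim_{n\to\infty}\mathbb P\{A_n\}=1$. The dimension $d=d(n)$ may depend on $n$, all asymptotics are as $n\to\infty$ with $\epsilon$ fixed, and each of (i)–(iv) is a separate statement asserting that, under its hypothesis on $d$, its conclusion holds with high probability. *)

theory Defs
  imports "HOL-Probability.Probability" "HOL-Library.Landau_Symbols"
begin

text \<open>
  The dimension depends on \<open>n\<close>, so \<open>\<real>\<^sup>d\<close> is rendered as the product space of functions
  \<open>nat \<Rightarrow> real\<close> that are extensional on \<open>{..<d}\<close>, that is, as the space of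
  \<open>PiM {..<d} (\<lambda>_. borel)\<close>.
\<close>

definition vec_space :: "nat \<Rightarrow> (nat \<Rightarrow> real) measure" where
  "vec_space d = PiM {..<d} (\<lambda>_. borel)"

definition vec_inner :: "nat \<Rightarrow> (nat \<Rightarrow> real) \<Rightarrow> (nat \<Rightarrow> real) \<Rightarrow> real" where
  "vec_inner d x y = (\<Sum>k<d. x k * y k)"

(* The sphere S^(d-1) in d-dimensional space: the argument is the dimension of the ambient space.
   L2_set s A is the square root of the sum of the squares of s over A. *)
definition unit_sphere :: "nat \<Rightarrow> (nat \<Rightarrow> real) set" where
  "unit_sphere d = {s \<in> space (vec_space d). L2_set s {..<d} = 1}"

definition std_normal_vec :: "nat \<Rightarrow> 'a measure \<Rightarrow> ('a \<Rightarrow> nat \<Rightarrow> real) \<Rightarrow> bool" where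
  "std_normal_vec d M Y \<longleftrightarrow>
     Y \<in> measurable M (vec_space d) \<and>
     distr M (vec_space d) Y = PiM {..<d} (\<lambda>_. std_normal_distribution)"

text \<open>
  A graph is given by a vertex set and a set of edges, the edges being two-element sets of vertices.
\<close>

definition proper_colouring :: "'v set \<Rightarrow> 'v set set \<Rightarrow> nat \<Rightarrow> ('v \<Rightarrow> nat) \<Rightarrow> bool" where
  "proper_colouring V E k c \<longleftrightarrow>
     c ` V \<subseteq> {..<k} \<and> (\<forall>u\<in>V. \<forall>v\<in>V. {u, v} \<in> E \<longrightarrow> c u \<noteq> c v)"

(* Meaningful for finite loopless graphs, where a proper colouring exists. *)
definition chromatic_number :: "'v set \<Rightarrow> 'v set set \<Rightarrow> nat" where
  "chromatic_number V E = (LEAST k. \<exists>c. proper_colouring V E k c)"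

definition index_pairs :: "nat \<Rightarrow> (nat \<times> nat) set" where
  "index_pairs n = {(i, j). 1 \<le> i \<and> i < j \<and> j \<le> n}"

definition \<Gamma>_edges :: "nat \<Rightarrow> nat \<Rightarrow> (nat \<times> nat \<Rightarrow> nat \<Rightarrow> real) \<Rightarrow> (nat \<Rightarrow> real) \<Rightarrow> nat set set" where
  "\<Gamma>_edges n d x s = {{i, j} | i j. (i, j) \<in> index_pairs n \<and> vec_inner d (x (i, j)) s \<ge> 0}"

definition \<chi>\<Gamma> :: "nat \<Rightarrow> nat \<Rightarrow> (nat \<times> nat \<Rightarrow> nat \<Rightarrow> real) \<Rightarrow> (nat \<Rightarrow> real) \<Rightarrow> nat" where
  "\<chi>\<Gamma> n d x s = chromatic_number {1..n} (\<Gamma>_edges n d x s)"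

(* A non-measurable set has measure 0 here, so the limit 1 also forces the sets to be events
   for all large n. *)
definition whp :: "(nat \<Rightarrow> 'a measure) \<Rightarrow> (nat \<Rightarrow> 'a \<Rightarrow> bool) \<Rightarrow> bool" where
  "whp M P \<longleftrightarrow> (\<lambda>n. \<P>(\<omega> in M n. P n \<omega>)) \<longlonglongrightarrow> 1"

end

theory Submission
  imports Defs "HOL-Real_Asymp.Real_Asymp"
begin

text \<open>
  Write \<open>N\<close> for the number of pairs. Each direction \<open>s\<close> yields a sign pattern, the set of pairs \<open>e\<close> with
  \<open>\<langle>X\<^sub>e, s\<rangle> \<ge> 0\<close>. Only linearly independent families are shattered by the realized patterns, and in general
  position every family of fewer than \<open>d\<close> vectors is strongly shattered; by the sandwich theorem the number of
  realized patterns lies between \<open>\<Sum>k<d. N choose k\<close> and \<open>(N + 1) ^ d\<close>. Since the Gaussian law is invariant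
  under sign changes, a fixed pattern is realized with probability \<open>2\<^sup>-\<^sup>N\<close> times the mean number of realized ones.

  The upper bound turns (i) and (iii) into estimates for the uniform random graph, with a loss of the factor
  \<open>(N + 1) ^ d\<close>. For (i) the first moment over colourings suffices. For (iii) Janson's inequality bounds the
  probability that some set of \<open>u\<close> vertices has no independent \<open>k\<close>-set by \<open>2 ^ n * exp (- u\<^sup>2 / (4 k\<^sup>4))\<close>; this is
  applied first with \<open>k\<close> close to \<open>2 log\<^sub>2 n\<close> and \<open>u = n / (log n) powr (1/3)\<close>, then, on the uncoloured remainder, with
  \<open>k = (log n) powr 0.7\<close> and \<open>u = n / (log n) powr 1.05\<close>. The exponents make the second phase cost
  \<open>o(n / log n)\<close> colours and both exponents \<open>u\<^sup>2 / k\<^sup>4\<close> exceed \<open>d log n = o(n\<^sup>2 / (log n) ^ 5)\<close>.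

  The lower bound gives (ii), where all pairs inside the classes of a balanced colouring are made non-edges, and
  (iv), where a clique is forced; in (iv) the clique may have slightly more than \<open>d\<close> pairs, and Chebyshev's
  inequality for the binomial sum absorbs the excess.
\<close>

subsection \<open>Shattering and set systems\<close>

text \<open>Ranging over all directions costs a factor \<open>n ^ (2 * d)\<close>, which in (iii)
  can be as large as the exponential of \<open>o(n^2 / (log n)^5)\<close>. This rules out a single
  greedy phase: if independent sets of size \<open>k\<close> about \<open>2 * log 2 n\<close> are
  removed until \<open>u\<close> vertices remain and each of these gets its own colour, then
  \<open>u = o(n / log n)\<close> is needed, and Janson's exponent \<open>u^2 / k^4\<close> is only
  \<open>o(n^2 / (log n)^6)\<close>. Smaller independent sets in a second phase give a larger
  exponent, and they are affordable because few vertices are left. Two further points shape the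
  proof. Edges are defined by the closed condition \<open>\<ge> 0\<close>, whereas the symmetry and
  perturbation arguments need strict signs; general position bridges the gap almost surely. And the
  events quantify over an uncountable sphere, so their measurability has to be derived from
  compactness, in a dimension that varies with \<open>n\<close>.\<close>

definition shatters :: "'e set set \<Rightarrow> 'e set \<Rightarrow> bool" where
  "shatters F A \<longleftrightarrow> (\<forall>B. B \<subseteq> A \<longrightarrow> (\<exists>S\<in>F. S \<inter> A = B))"

text \<open>The set \<open>T\<close> fixes everything outside \<open>A\<close>, so the family
  contains a whole subcube with free directions \<open>A\<close>; shattering lets the part outside
  \<open>A\<close> vary with \<open>B\<close>.\<close>

definition strongly_shatters :: "'e set set \<Rightarrow> 'e set \<Rightarrow> bool" where
  "strongly_shatters F A \<longleftrightarrow> (\<exists>T. T \<inter> A = {} \<and> (\<forall>B. B \<subseteq> A \<longrightarrow> B \<union> T \<in> F))"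

lemma card_split_member:
  assumes "finite I" "e \<notin> I" "F \<subseteq> Pow (insert e I)"
  shows "card F = card (F \<inter> Pow I) + card {S. S \<subseteq> I \<and> insert e S \<in> F}"
proof -
  have fin: "finite F" using assms by (meson finite_Pow_iff finite_insert finite_subset)
  have "F = (F \<inter> Pow I) \<union> insert e ` {S. S \<subseteq> I \<and> insert e S \<in> F}" (is "_ = ?A \<union> ?B")
  proof (intro equalityI subsetI)
    fix S assume S: "S \<in> F"
    show "S \<in> ?A \<union> ?B"
    proof (cases "e \<in> S")
      case True
      then have "S = insert e (S - {e})" "S - {e} \<subseteq> I" using S assms by auto
      then show ?thesis using S by (metis (mono_tags, lifting) UnI2 image_eqI mem_Collect_eq)
    next
      case False
      then show ?thesis using S assms by auto
    qed
  qed auto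
  moreover have "?A \<inter> ?B = {}" using assms(2) by auto
  moreover have "finite ?A" using fin by simp
  moreover have fB: "finite {S. S \<subseteq> I \<and> insert e S \<in> F}"
    using assms(1) by (rule_tac finite_subset[of _ "Pow I"]) auto
  moreover have "inj_on (insert e) {S. S \<subseteq> I \<and> insert e S \<in> F}"
    using assms(2) by (auto simp: inj_on_def)
  ultimately show ?thesis
    using card_Un_disjoint[of ?A ?B] by (simp add: card_image)
qed

text \<open>This is Pajor's inequality. Splitting \<open>F\<close> by membership of \<open>e\<close>
  gives two families on \<open>I\<close>; a set shattered by both is shattered by \<open>F\<close>
  together with its extension by \<open>e\<close>, which accounts for its being counted
  twice.\<close>

lemma card_le_card_shattered:
  assumes "finite I" "F \<subseteq> Pow I"
  shows "card F \<le> card {A. A \<subseteq> I \<and> shatters F A}"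
  using assms
proof (induction I arbitrary: F rule: finite_induct)
  case empty
  then have "F = {} \<or> F = {{}}" by auto
  then show ?case
  proof
    assume "F = {{}}"
    then have "{A. A \<subseteq> {} \<and> shatters F A} = {{}}" by (auto simp: shatters_def)
    then show ?thesis using \<open>F = {{}}\<close> by simp
  qed simp
next
  case (insert e I)
  define F0 where "F0 = F \<inter> Pow I"
  define F1 where "F1 = {S. S \<subseteq> I \<and> insert e S \<in> F}"
  define sh where "sh \<equiv> \<lambda>G. {A. A \<subseteq> I \<and> shatters G A}"
  have fin: "finite (sh G)" for G
    unfolding sh_def using insert(1) by (rule_tac finite_subset[of _ "Pow I"]) auto
  have "card F = card F0 + card F1"
    unfolding F0_def F1_def using card_split_member[OF insert(1,2,4)] .
  also have "\<dots> \<le> card (sh F0) + card (sh F1)"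
    unfolding sh_def using insert(3)[of F0] insert(3)[of F1] by (intro add_mono) (auto simp: F0_def F1_def)
  also have "\<dots> = card (sh F0 \<union> sh F1) + card (insert e ` (sh F0 \<inter> sh F1))"
  proof -
    have "inj_on (insert e) (sh F0 \<inter> sh F1)"
      using insert(2) by (auto simp: inj_on_def sh_def)
    then show ?thesis using card_Un_Int[OF fin fin, of F0 F1] by (simp add: card_image)
  qed
  also have "\<dots> = card ((sh F0 \<union> sh F1) \<union> insert e ` (sh F0 \<inter> sh F1))"
    using fin insert(2) by (subst card_Un_disjoint) (auto simp: sh_def)
  also have "\<dots> \<le> card {A. A \<subseteq> insert e I \<and> shatters F A}"
  proof (rule card_mono)
    show "finite {A. A \<subseteq> insert e I \<and> shatters F A}"
      using insert(1) by (rule_tac finite_subset[of _ "Pow (insert e I)"]) auto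
    have "shatters F A" if A: "A \<subseteq> I" "shatters F0 A" for A
      using A unfolding shatters_def F0_def by blast
    moreover have "shatters F A" if A: "A \<subseteq> I" "shatters F1 A" for A
      unfolding shatters_def
    proof (intro allI impI)
      fix B assume "B \<subseteq> A"
      then obtain S where "S \<in> F1" "S \<inter> A = B" using A unfolding shatters_def by blast
      then show "\<exists>S\<in>F. S \<inter> A = B" using A(1) insert(2)
        by (intro bexI[of _ "insert e S"]) (auto simp: F1_def)
    qed
    moreover have "shatters F (insert e A)" if A: "A \<subseteq> I" "shatters F0 A" "shatters F1 A" for A
      unfolding shatters_def
    proof (intro allI impI)
      fix B assume B: "B \<subseteq> insert e A"
      show "\<exists>S\<in>F. S \<inter> insert e A = B"
      proof (cases "e \<in> B")
        case True
        then have "B - {e} \<subseteq> A" using B by auto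
        then obtain S where "S \<in> F1" "S \<inter> A = B - {e}" using A unfolding shatters_def by blast
        then show ?thesis using True by (intro bexI[of _ "insert e S"]) (auto simp: F1_def)
      next
        case False
        then have "B \<subseteq> A" using B by auto
        then obtain S where "S \<in> F0" "S \<inter> A = B" using A unfolding shatters_def by blast
        then show ?thesis using insert(2) by (intro bexI[of _ S]) (auto simp: F0_def)
      qed
    qed
    ultimately show "(sh F0 \<union> sh F1) \<union> insert e ` (sh F0 \<inter> sh F1) \<subseteq> {A. A \<subseteq> insert e I \<and> shatters F A}"
      unfolding sh_def by auto
  qed
  finally show ?case .
qed

text \<open>\<open>A\<close> is strongly shattered by \<open>F\<close> iff \<open>I - A\<close> is not shattered by the complementary family.\<close>

lemma card_strongly_shattered_le:
  assumes "finite I" "F \<subseteq> Pow I"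
  shows "card {A. A \<subseteq> I \<and> strongly_shatters F A} \<le> card F"
proof -
  define st where "st = {A. A \<subseteq> I \<and> strongly_shatters F A}"
  define sh where "sh = {A. A \<subseteq> I \<and> shatters (Pow I - F) A}"
  have finP: "finite (Pow I)" using assms(1) by simp
  have sub: "st \<subseteq> Pow I" "sh \<subseteq> Pow I" by (auto simp: st_def sh_def)
  have disj: "(\<lambda>A. I - A) ` st \<inter> sh = {}"
  proof -
    have False if A: "A \<subseteq> I" "strongly_shatters F A" "shatters (Pow I - F) (I - A)" for A
    proof -
      obtain T where T: "T \<inter> A = {}" "\<And>B. B \<subseteq> A \<Longrightarrow> B \<union> T \<in> F"
        using A(2) unfolding strongly_shatters_def by blast
      have "T \<in> F" using T(2)[of "{}"] by simp
      then have "T \<subseteq> I - A" using T(1) assms(2) by auto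
      \<comment> \<open>A member of the complement with trace \<open>T\<close> on
        \<open>I - A\<close> differs from \<open>T\<close> only inside \<open>A\<close>, hence is
        one of the sets \<open>B \<union> T\<close>, all of which lie in \<open>F\<close>.\<close>
      then obtain S where S: "S \<in> Pow I - F" "S \<inter> (I - A) = T"
        using A(3) unfolding shatters_def by blast
      then have "S = (S \<inter> A) \<union> T" by auto
      then show False using T(2)[of "S \<inter> A"] S(1) by auto
    qed
    then show ?thesis unfolding st_def sh_def by blast
  qed
  have inj: "inj_on (\<lambda>A. I - A) st" using sub(1) by (auto simp: inj_on_def)
  have "card st + card sh = card ((\<lambda>A. I - A) ` st \<union> sh)"
    using disj inj sub finP by (subst card_Un_disjoint) (auto simp: card_image finite_subset)
  also have "\<dots> \<le> card (Pow I)" using sub finP by (intro card_mono) auto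
  also have "\<dots> = card (Pow I - F) + card F"
    using card_Un_disjoint[of "Pow I - F" F] assms finP finite_subset[OF assms(2) finP]
    by (simp add: Un_absorb2 Int_commute)
  also have "\<dots> \<le> card sh + card F"
    unfolding sh_def using card_le_card_shattered[OF assms(1), of "Pow I - F"] by simp
  finally show ?thesis unfolding st_def by simp
qed

text \<open>Gaussian elimination by induction on the equations, with unknowns in an arbitrary index
  set: later they are the coefficients of a linear dependence, the coordinates of an orthogonal
  direction, or the coefficients of a direction adjoined to a dual basis.\<close>

lemma homogeneous_system_nontrivial:
  fixes a :: "'e \<Rightarrow> 'u \<Rightarrow> real"
  assumes "finite E" "finite U" "card E < card U"
  shows "\<exists>c. (\<exists>u\<in>U. c u \<noteq> 0) \<and> (\<forall>e\<in>E. (\<Sum>u\<in>U. a e u * c u) = 0)"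
  using assms
proof (induction E arbitrary: U a rule: finite_induct)
  case empty
  then have "U \<noteq> {}" by auto
  then show ?case by (intro exI[of _ "\<lambda>_. 1"]) auto
next
  case (insert f E)
  show ?case
  proof (cases "\<forall>u\<in>U. a f u = 0")
    case True
    have "card E < card U" using insert by simp
    from insert(3)[OF insert(4) this, of a] obtain c where
      "\<exists>u\<in>U. c u \<noteq> 0" "\<forall>e\<in>E. (\<Sum>u\<in>U. a e u * c u) = 0" by blast
    with True show ?thesis by (intro exI[of _ c]) auto
  next
    case False
    then obtain v where v: "v \<in> U" "a f v \<noteq> 0" by auto
    define W where "W = U - {v}"
    have U: "U = insert v W" "v \<notin> W" "finite W" using v insert by (auto simp: W_def)
    have "card E < card W" using insert U by simp
    \<comment> \<open>Equation \<open>f\<close> is the pivot: it is solved for the unknown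
      \<open>v\<close> and substituted into the others, leaving one equation and one unknown
      fewer.\<close>
    from insert(3)[OF U(3) this, of "\<lambda>e u. a e u - a e v * a f u / a f v"] obtain c where
      c: "\<exists>u\<in>W. c u \<noteq> 0" "\<forall>e\<in>E. (\<Sum>u\<in>W. (a e u - a e v * a f u / a f v) * c u) = 0" by blast
    define c' where "c' = c(v := - (\<Sum>u\<in>W. a f u * c u) / a f v)"
    have sW: "(\<Sum>u\<in>W. a e u * c' u) = (\<Sum>u\<in>W. a e u * c u)" for e
      using U(2) by (intro sum.cong) (auto simp: c'_def)
    have sum: "(\<Sum>u\<in>U. a e u * c' u) = a e v * c' v + (\<Sum>u\<in>W. a e u * c u)" for e
      using U sW by simp
    have "(\<Sum>u\<in>U. a e u * c' u) = 0" if "e \<in> insert f E" for e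
    proof (cases "e = f")
      case True
      then show ?thesis using v unfolding sum by (simp add: c'_def)
    next
      case False
      then have "(\<Sum>u\<in>W. (a e u - a e v * a f u / a f v) * c u) = 0" using c that by auto
      then have "(\<Sum>u\<in>W. a e u * c u) = (a e v / a f v) * (\<Sum>u\<in>W. a f u * c u)"
        by (simp add: algebra_simps sum_subtractf sum_distrib_left)
      then show ?thesis unfolding sum by (simp add: c'_def)
    qed
    moreover have "\<exists>u\<in>U. c' u \<noteq> 0" using c(1) U by (auto simp: c'_def)
    ultimately show ?thesis by blast
  qed
qed

subsection \<open>Sign patterns of vector configurations\<close>

text \<open>Strict signs on both sides make the notion compatible with negating individual vectors
  and stable under small perturbations of \<open>s\<close>. No normalization of \<open>s\<close> is
  imposed, since only its ray and its first \<open>d\<close> coordinates matter.\<close>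

definition sign_patterns :: "'e set \<Rightarrow> nat \<Rightarrow> ('e \<Rightarrow> nat \<Rightarrow> real) \<Rightarrow> 'e set set" where
  "sign_patterns I d x = {\<sigma>. \<sigma> \<subseteq> I \<and> (\<exists>s. (\<forall>e\<in>\<sigma>. vec_inner d (x e) s > 0) \<and> (\<forall>e\<in>I - \<sigma>. vec_inner d (x e) s < 0))}"

text \<open>Directions orthogonal to exactly a prescribed small family are what the perturbation
  argument starts from. As an existential over the sphere, the condition is measurable by the same
  criterion as the main events. It implies that any \<open>d\<close> of the vectors are linearly
  independent.\<close>

definition general_position :: "'e set \<Rightarrow> nat \<Rightarrow> ('e \<Rightarrow> nat \<Rightarrow> real) \<Rightarrow> bool" where
  "general_position I d x \<longleftrightarrow> (\<forall>A\<subseteq>I. card A < d \<longrightarrow>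
     (\<exists>s\<in>unit_sphere d. (\<forall>e\<in>A. vec_inner d (x e) s = 0) \<and> (\<forall>e\<in>I - A. vec_inner d (x e) s \<noteq> 0)))"

lemma vec_inner_add: "vec_inner d x (\<lambda>k. s k + t k) = vec_inner d x s + vec_inner d x t"
  by (simp add: vec_inner_def algebra_simps sum.distrib)

lemma vec_inner_scale: "vec_inner d x (\<lambda>k. c * s k) = c * vec_inner d x s"
  by (simp add: vec_inner_def algebra_simps sum_distrib_left)

lemma vec_inner_sum:
  "vec_inner d x (\<lambda>k. \<Sum>f\<in>A. c f * t f k) = (\<Sum>f\<in>A. c f * vec_inner d x (t f))"
  unfolding vec_inner_def by (subst sum_distrib_left, subst sum.swap) (simp add: sum_distrib_left sum_distrib_right algebra_simps)

lemma vec_inner_restrict: "vec_inner d x (restrict s {..<d}) = vec_inner d x s"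
  by (simp add: vec_inner_def)

lemma vec_inner_uminus: "vec_inner d (\<lambda>k\<in>{..<d}. - x k) s = - vec_inner d x s"
  by (simp add: vec_inner_def sum_negf)

lemma normalized_in_unit_sphere:
  assumes "\<exists>k<d. s k \<noteq> 0"
  obtains c where "c > 0" "(\<lambda>k\<in>{..<d}. c * s k) \<in> unit_sphere d"
proof -
  define r where "r = L2_set s {..<d}"
  have "r \<noteq> 0" using assms by (auto simp: r_def L2_set_eq_0_iff)
  then have "r > 0" unfolding r_def using L2_set_nonneg order_less_le by metis
  have "L2_set (\<lambda>k\<in>{..<d}. (1 / r) * s k) {..<d} = L2_set (\<lambda>k. (1 / r) * s k) {..<d}"
    by (intro L2_set_cong) auto
  also have "\<dots> = (1 / r) * r"
    unfolding r_def using \<open>r > 0\<close> by (intro L2_set_right_distrib[symmetric]) (simp add: r_def)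
  finally show thesis using \<open>r > 0\<close> \<open>r \<noteq> 0\<close>
    by (intro that[of "1 / r"]) (auto simp: unit_sphere_def vec_space_def space_PiM)
qed

lemma unit_sphere_nonzero:
  assumes "s \<in> unit_sphere d"
  shows "\<exists>k<d. s k \<noteq> 0"
proof (rule ccontr)
  assume "\<not> (\<exists>k<d. s k \<noteq> 0)"
  then have "L2_set s {..<d} = 0" by (subst L2_set_eq_0_iff) auto
  then show False using assms by (simp add: unit_sphere_def)
qed

text \<open>Finitely many strict inequalities survive one small enough step in direction
  \<open>b\<close>. Entries with \<open>a e = 0\<close> are left out: there the sign will be
  dictated by \<open>b\<close>.\<close>

lemma perturb_signs:
  fixes a b :: "'e \<Rightarrow> real"
  assumes "finite I"
  obtains \<delta> where "\<delta> > 0" "\<And>e. e \<in> I \<Longrightarrow> a e \<noteq> 0 \<Longrightarrow> sgn (a e + \<delta> * b e) = sgn (a e)"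
proof -
  have "\<forall>\<^sub>F \<delta> in at_right 0. sgn (a e + \<delta> * b e) = sgn (a e)" if "a e \<noteq> 0" for e
  proof -
    have lim: "((\<lambda>\<delta>. a e + \<delta> * b e) \<longlongrightarrow> a e + 0 * b e) (at_right 0)"
      by (intro tendsto_intros)
    show ?thesis
    proof (cases "a e > 0")
      case True
      from order_tendstoD(1)[OF lim, of 0] True show ?thesis by (auto elim!: eventually_mono)
    next
      case False
      from order_tendstoD(2)[OF lim, of 0] False that show ?thesis by (auto elim!: eventually_mono)
    qed
  qed
  then have "\<forall>\<^sub>F \<delta> in at_right 0. \<forall>e\<in>{e\<in>I. a e \<noteq> 0}. sgn (a e + \<delta> * b e) = sgn (a e)"
    using assms by (subst eventually_ball_finite_distrib) auto
  then have "\<forall>\<^sub>F \<delta> in at_right (0::real). \<delta> > 0 \<and> (\<forall>e\<in>{e\<in>I. a e \<noteq> 0}. sgn (a e + \<delta> * b e) = sgn (a e))"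
    using eventually_at_right_less by (rule eventually_conj[rotated])
  then obtain \<delta> where "\<delta> > 0 \<and> (\<forall>e\<in>{e\<in>I. a e \<noteq> 0}. sgn (a e + \<delta> * b e) = sgn (a e))"
    using eventually_happens[of _ "at_right (0::real)"] by (auto simp: trivial_limit_at_right_real)
  then show thesis using that by auto
qed

text \<open>For \<open>f\<close> in \<open>A\<close> the set \<open>A - {f}\<close> has fewer than
  \<open>d\<close> elements, so some direction is orthogonal to it but not to \<open>x f\<close>;
  rescaling gives \<open>t f\<close>. Hence inner products with up to \<open>d\<close> of the
  vectors can be prescribed freely.\<close>

lemma general_position_dual_basis:
  assumes "general_position I d x" "finite I" "A \<subseteq> I" "card A \<le> d"
  obtains t where "\<And>e f. e \<in> A \<Longrightarrow> f \<in> A \<Longrightarrow> vec_inner d (x e) (t f) = (if e = f then 1 else 0)"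
proof -
  have "\<exists>t. \<forall>e\<in>A. vec_inner d (x e) t = (if e = f then 1 else 0)" if "f \<in> A" for f
  proof -
    have "finite A" using assms finite_subset by blast
    then have "card (A - {f}) < d" using that assms(4)
      by (metis card_Diff1_less less_le_trans)
    then obtain s where s: "\<forall>e\<in>A - {f}. vec_inner d (x e) s = 0" "\<forall>e\<in>I - (A - {f}). vec_inner d (x e) s \<noteq> 0"
      using assms(1,3) unfolding general_position_def by (meson Diff_subset order_trans)
    have "vec_inner d (x f) s \<noteq> 0" using s(2) that assms(3) by auto
    then have "\<forall>e\<in>A. vec_inner d (x e) (\<lambda>k. (1 / vec_inner d (x f) s) * s k) = (if e = f then 1 else 0)"
      using s(1) unfolding vec_inner_scale by auto
    then show ?thesis by blast
  qed
  then show thesis using that by metis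
qed

lemma dual_basis_coefficients:
  assumes "\<And>e f. e \<in> A \<Longrightarrow> f \<in> A \<Longrightarrow> vec_inner d (x e) (t f) = (if e = f then 1 else 0)"
    and "finite A" "e \<in> A"
  shows "vec_inner d (x e) (\<lambda>k. \<Sum>f\<in>A. c f * t f k) = c e"
proof -
  have "vec_inner d (x e) (\<lambda>k. \<Sum>f\<in>A. c f * t f k) = (\<Sum>f\<in>A. c f * (if e = f then 1 else 0))"
    unfolding vec_inner_sum using assms by (intro sum.cong) auto
  also have "\<dots> = c e" using assms by (simp add: if_distrib[of "(*) _"] sum.delta cong: if_cong)
  finally show ?thesis .
qed

text \<open>More than \<open>d\<close> vectors satisfy a nontrivial linear relation
  \<open>c\<close>. A direction whose signs agree with those of \<open>c\<close> wherever
  \<open>c\<close> is nonzero makes every term of the relation nonnegative and some term positive,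
  although the sum vanishes.\<close>

lemma shattered_sign_patterns_card_le:
  assumes "finite I" "A \<subseteq> I" "shatters (sign_patterns I d x) A"
  shows "card A \<le> d"
proof (rule ccontr)
  assume "\<not> card A \<le> d"
  have fin: "finite A" using assms finite_subset by blast
  have "card {..<d} < card A" using \<open>\<not> card A \<le> d\<close> by simp
  from homogeneous_system_nontrivial[OF _ fin this, of "\<lambda>k e. x e k"] obtain c where
    c: "\<exists>e\<in>A. c e \<noteq> 0" "\<And>k. k < d \<Longrightarrow> (\<Sum>e\<in>A. x e k * c e) = 0" by auto
  obtain \<sigma> where \<sigma>: "\<sigma> \<in> sign_patterns I d x" "\<sigma> \<inter> A = {e\<in>A. c e > 0}"
    using assms(3) unfolding shatters_def by (metis (no_types, lifting) mem_Collect_eq subsetI)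
  then obtain s where s: "\<And>e. e \<in> \<sigma> \<Longrightarrow> vec_inner d (x e) s > 0" "\<And>e. e \<in> I - \<sigma> \<Longrightarrow> vec_inner d (x e) s < 0"
    unfolding sign_patterns_def by blast
  have pos: "c e * vec_inner d (x e) s > 0" if "e \<in> A" "c e \<noteq> 0" for e
  proof (cases "c e > 0")
    case True
    then have "e \<in> \<sigma>" using \<sigma>(2) that by auto
    then show ?thesis using s(1) True by simp
  next
    case False
    then have "e \<in> I - \<sigma>" using \<sigma>(2) that assms(2) by auto
    then show ?thesis using s(2) False that by (simp add: mult_neg_neg)
  qed
  have "(\<Sum>e\<in>A. c e * vec_inner d (x e) s) = (\<Sum>k<d. s k * (\<Sum>e\<in>A. x e k * c e))"
    unfolding vec_inner_def sum_distrib_left by (subst sum.swap) (simp add: algebra_simps)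
  also have "\<dots> = 0" using c(2) by simp
  finally have "(\<Sum>e\<in>A. c e * vec_inner d (x e) s) = 0" .
  moreover have "(\<Sum>e\<in>A. c e * vec_inner d (x e) s) > 0"
  proof -
    obtain e where "e \<in> A" "c e \<noteq> 0" using c(1) by blast
    moreover have "c e' * vec_inner d (x e') s \<ge> 0" if "e' \<in> A" for e'
      using pos[OF that] by (cases "c e' = 0") auto
    ultimately show ?thesis using pos fin by (intro sum_pos2[of A e]) auto
  qed
  ultimately show False by simp
qed

lemma card_subsets_le:
  assumes "finite I"
  shows "card {A. A \<subseteq> I \<and> card A \<le> d} = (\<Sum>k\<le>d. card I choose k)"
proof -
  have "{A. A \<subseteq> I \<and> card A \<le> d} = (\<Union>k\<le>d. {A. A \<subseteq> I \<and> card A = k})" by auto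
  then show ?thesis
    using assms by (simp add: card_UN_disjoint n_subsets disjoint_iff)
qed

lemma sum_choose_le_power: "(\<Sum>k\<le>d. N choose k) \<le> (N + 1) ^ d"
proof -
  have "(N + 1) ^ d = (\<Sum>k\<le>d. (d choose k) * N ^ k)"
    by (subst binomial) simp
  moreover have "N choose k \<le> (d choose k) * N ^ k" if "k \<le> d" for k
  proof -
    have "N choose k \<le> N ^ k" by (cases "k \<le> N") (simp_all add: binomial_le_pow binomial_eq_0)
    also have "\<dots> \<le> (d choose k) * N ^ k" using zero_less_binomial[OF that] by (simp add: Suc_le_eq)
    finally show ?thesis .
  qed
  ultimately show ?thesis using sum_mono[of "{..d}" "\<lambda>k. N choose k"] by simp
qed

lemma card_sign_patterns_le:
  assumes "finite I"
  shows "card (sign_patterns I d x) \<le> (card I + 1) ^ d"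
proof -
  have "card (sign_patterns I d x) \<le> card {A. A \<subseteq> I \<and> shatters (sign_patterns I d x) A}"
    using assms by (intro card_le_card_shattered) (auto simp: sign_patterns_def)
  also have "\<dots> \<le> card {A. A \<subseteq> I \<and> card A \<le> d}"
    using assms shattered_sign_patterns_card_le[OF assms]
    by (intro card_mono) (auto intro: finite_subset[of _ "Pow I"])
  finally show ?thesis using card_subsets_le[OF assms] sum_choose_le_power le_trans by metis
qed

text \<open>For \<open>card A < d\<close>, a direction orthogonal to exactly \<open>A\<close> fixes
  the signs off \<open>A\<close>, and a small push along a dual basis realizes every sign vector on
  \<open>A\<close>. So all such \<open>A\<close> are strongly shattered, and counting them gives the
  sum.\<close>

lemma card_sign_patterns_ge:
  assumes "finite I" "general_position I d x"
  shows "(\<Sum>k<d. card I choose k) \<le> card (sign_patterns I d x)"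
proof (cases d)
  case (Suc d')
  have "strongly_shatters (sign_patterns I d x) A" if A: "A \<subseteq> I" "card A \<le> d'" for A
  proof -
    have fin: "finite A" using A assms finite_subset by blast
    obtain s where s: "\<And>e. e \<in> A \<Longrightarrow> vec_inner d (x e) s = 0" "\<And>e. e \<in> I - A \<Longrightarrow> vec_inner d (x e) s \<noteq> 0"
      using assms(2) A Suc unfolding general_position_def by (metis less_Suc_eq_le)
    obtain t where t: "\<And>e f. e \<in> A \<Longrightarrow> f \<in> A \<Longrightarrow> vec_inner d (x e) (t f) = (if e = f then 1 else 0)"
      using general_position_dual_basis[OF assms(2,1) A(1)] A Suc by (metis le_SucI)
    define T where "T = {e\<in>I - A. vec_inner d (x e) s > 0}"
    have "B \<union> T \<in> sign_patterns I d x" if B: "B \<subseteq> A" for B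
    proof -
      define v where "v = (\<lambda>k. \<Sum>f\<in>A. (if f \<in> B then 1 else - 1) * t f k)"
      have v: "vec_inner d (x e) v = (if e \<in> B then 1 else - 1)" if "e \<in> A" for e
        unfolding v_def using dual_basis_coefficients[OF t fin that, where c = "\<lambda>f. if f \<in> B then 1 else - 1"] .
      obtain \<delta> where \<delta>: "\<delta> > 0" "\<And>e. e \<in> I \<Longrightarrow> vec_inner d (x e) s \<noteq> 0 \<Longrightarrow>
          sgn (vec_inner d (x e) s + \<delta> * vec_inner d (x e) v) = sgn (vec_inner d (x e) s)"
        using perturb_signs[OF assms(1), of "\<lambda>e. vec_inner d (x e) s" "\<lambda>e. vec_inner d (x e) v"] by blast
      define w where "w = (\<lambda>k. s k + \<delta> * v k)"
      have w: "vec_inner d (x e) w = vec_inner d (x e) s + \<delta> * vec_inner d (x e) v" for e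
        unfolding w_def vec_inner_add vec_inner_scale ..
      have "vec_inner d (x e) w > 0" if "e \<in> B \<union> T" for e
      proof (cases "e \<in> A")
        case True
        then have "e \<in> B" using that by (auto simp: T_def)
        then show ?thesis using s(1)[OF True] v[OF True] \<delta>(1) w by simp
      next
        case False
        then have "e \<in> T" using that B by auto
        then have "sgn (vec_inner d (x e) w) = 1" unfolding w using \<delta>(2)[of e] by (auto simp: T_def)
        then show ?thesis by (simp add: sgn_1_pos)
      qed
      moreover have "vec_inner d (x e) w < 0" if "e \<in> I - (B \<union> T)" for e
      proof (cases "e \<in> A")
        case True
        then have "e \<notin> B" using that by (auto simp: T_def)
        then show ?thesis using s(1)[OF True] v[OF True] \<delta>(1) w by simp
      next
        case False
        then have "vec_inner d (x e) s < 0" using that s(2)[of e] by (auto simp: T_def not_less order_less_le)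
        then have "sgn (vec_inner d (x e) w) = - 1" unfolding w using \<delta>(2)[of e] that by auto
        then show ?thesis by (simp add: sgn_1_neg)
      qed
      moreover have "B \<union> T \<subseteq> I" using A B by (auto simp: T_def)
      ultimately show ?thesis unfolding sign_patterns_def by blast
    qed
    then show ?thesis unfolding strongly_shatters_def by (intro exI[of _ T]) (auto simp: T_def)
  qed
  then have "card {A. A \<subseteq> I \<and> card A \<le> d'} \<le> card {A. A \<subseteq> I \<and> strongly_shatters (sign_patterns I d x) A}"
    using assms(1) by (intro card_mono) (auto intro: finite_subset[of _ "Pow I"])
  also have "\<dots> \<le> card (sign_patterns I d x)"
    using assms(1) by (intro card_strongly_shattered_le) (auto simp: sign_patterns_def)
  finally show ?thesis using card_subsets_le[OF assms(1), of d'] Suc by (simp add: lessThan_Suc_atMost)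
qed simp

text \<open>A unit vector \<open>s\<close> orthogonal to \<open>d\<close> of the vectors, together
  with their dual basis, would be \<open>d + 1\<close> vectors in dimension \<open>d\<close>, hence
  dependent. Pairing the relation with each \<open>x e\<close> kills the dual basis coefficients,
  and then \<open>s \<noteq> 0\<close> kills the last one.\<close>

lemma general_position_card_zeros:
  assumes "general_position I d x" "finite I" "s \<in> unit_sphere d"
  shows "card {e\<in>I. vec_inner d (x e) s = 0} < d"
proof (rule ccontr)
  assume "\<not> ?thesis"
  then obtain A where A: "A \<subseteq> {e\<in>I. vec_inner d (x e) s = 0}" "card A = d" "finite A"
    using obtain_subset_with_card_n[of d "{e\<in>I. vec_inner d (x e) s = 0}"] assms(2)
    by (metis (no_types, lifting) finite_subset mem_Collect_eq not_less subsetI)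
  have "A \<subseteq> I" using A by auto
  obtain t where t: "\<And>e f. e \<in> A \<Longrightarrow> f \<in> A \<Longrightarrow> vec_inner d (x e) (t f) = (if e = f then 1 else 0)"
    using general_position_dual_basis[OF assms(1,2) \<open>A \<subseteq> I\<close>] A(2) by (metis order_refl)
  \<comment> \<open>The index \<open>None\<close> stands for \<open>s\<close> and
    \<open>Some f\<close> for \<open>t f\<close>, giving \<open>d + 1\<close> unknowns against
    \<open>d\<close> coordinate equations.\<close>
  have "\<exists>c. (\<exists>u\<in>insert None (Some ` A). c u \<noteq> 0) \<and>
      (\<forall>k\<in>{..<d}. (\<Sum>u\<in>insert None (Some ` A). (case u of None \<Rightarrow> s k | Some f \<Rightarrow> t f k) * c u) = 0)"
    using A by (intro homogeneous_system_nontrivial) (auto simp: card_image)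
  then obtain c where c: "\<exists>u\<in>insert None (Some ` A). c u \<noteq> 0"
    and "\<forall>k\<in>{..<d}. (\<Sum>u\<in>insert None (Some ` A). (case u of None \<Rightarrow> s k | Some f \<Rightarrow> t f k) * c u) = 0" by blast
  then have eq: "s k * c None + (\<Sum>f\<in>A. c (Some f) * t f k) = 0" if "k < d" for k
    using that A(3) by (simp add: sum.reindex algebra_simps)
  have "c (Some e) = 0" if "e \<in> A" for e
  proof -
    have "0 = vec_inner d (x e) (\<lambda>k. c None * s k + (\<Sum>f\<in>A. c (Some f) * t f k))"
      using eq by (simp add: vec_inner_def algebra_simps)
    also have "\<dots> = c None * vec_inner d (x e) s + c (Some e)"
      unfolding vec_inner_add vec_inner_scale using dual_basis_coefficients[OF t A(3) that] by simp
    also have "\<dots> = c (Some e)" using A that by auto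
    finally show ?thesis by simp
  qed
  moreover from this have "c None = 0"
    using eq unit_sphere_nonzero[OF assms(3)] by auto
  ultimately show False using c by auto
qed

text \<open>In general position fewer than \<open>d\<close> inner products with \<open>s\<close>
  vanish, so a small move towards a vector with inner product 1 on the zero set makes these strictly
  positive, as the convention \<open>\<ge> 0\<close> demands, and changes no other sign.\<close>

lemma pattern_in_sign_patterns:
  assumes "general_position I d x" "finite I" "s \<in> unit_sphere d"
  shows "{e\<in>I. vec_inner d (x e) s \<ge> 0} \<in> sign_patterns I d x"
proof -
  define A where "A = {e\<in>I. vec_inner d (x e) s = 0}"
  have A: "A \<subseteq> I" "finite A" "card A \<le> d"
    using general_position_card_zeros[OF assms] assms(2) by (auto simp: A_def)
  obtain t where t: "\<And>e f. e \<in> A \<Longrightarrow> f \<in> A \<Longrightarrow> vec_inner d (x e) (t f) = (if e = f then 1 else 0)"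
    using general_position_dual_basis[OF assms(1,2) A(1,3)] by metis
  define v where "v = (\<lambda>k. \<Sum>f\<in>A. 1 * t f k)"
  have v: "vec_inner d (x e) v = 1" if "e \<in> A" for e
    unfolding v_def using dual_basis_coefficients[OF t A(2) that, where c = "\<lambda>_. 1"] .
  obtain \<delta> where \<delta>: "\<delta> > 0" "\<And>e. e \<in> I \<Longrightarrow> vec_inner d (x e) s \<noteq> 0 \<Longrightarrow>
      sgn (vec_inner d (x e) s + \<delta> * vec_inner d (x e) v) = sgn (vec_inner d (x e) s)"
    using perturb_signs[OF assms(2), of "\<lambda>e. vec_inner d (x e) s" "\<lambda>e. vec_inner d (x e) v"] by blast
  define w where "w = (\<lambda>k. s k + \<delta> * v k)"
  have w: "vec_inner d (x e) w = vec_inner d (x e) s + \<delta> * vec_inner d (x e) v" for e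
    unfolding w_def vec_inner_add vec_inner_scale ..
  have "vec_inner d (x e) w > 0" if "e \<in> I" "vec_inner d (x e) s \<ge> 0" for e
  proof (cases "e \<in> A")
    case True
    then show ?thesis using v[OF True] \<delta>(1) that w by (auto simp: A_def)
  next
    case False
    then have "sgn (vec_inner d (x e) w) = 1" unfolding w using \<delta>(2)[of e] that by (auto simp: A_def)
    then show ?thesis by (simp add: sgn_1_pos)
  qed
  moreover have "vec_inner d (x e) w < 0" if "e \<in> I" "vec_inner d (x e) s < 0" for e
  proof -
    have "sgn (vec_inner d (x e) w) = - 1" unfolding w using \<delta>(2)[of e] that by auto
    then show ?thesis by (simp add: sgn_1_neg)
  qed
  ultimately show ?thesis unfolding sign_patterns_def by (auto intro!: exI[of _ w]) (meson not_le)
qed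

subsection \<open>Measurability over the sphere\<close>

text \<open>Bolzano-Weierstrass, extracting subsequences one coordinate at a time: the dimension is
  a variable and vectors are functions, so compactness of the sphere is obtained
  coordinatewise.\<close>

lemma bounded_coordinates_subsequence:
  fixes f :: "nat \<Rightarrow> nat \<Rightarrow> real"
  assumes "\<And>n k. k < d \<Longrightarrow> \<bar>f n k\<bar> \<le> B"
  shows "\<exists>r l. strict_mono r \<and> (\<forall>k<d. (\<lambda>n. f (r n) k) \<longlonglongrightarrow> l k)"
  using assms
proof (induction d)
  case 0
  show ?case by (intro exI[of _ id]) (simp add: strict_mono_id)
next
  case (Suc d)
  then obtain r l where r: "strict_mono r" "\<forall>k<d. (\<lambda>n. f (r n) k) \<longlonglongrightarrow> l k" by (metis less_SucI)
  have "bounded (range (\<lambda>n. f (r n) d))"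
    using Suc(2)[of d] by (auto simp: bounded_iff)
  then obtain q y where q: "strict_mono q" "((\<lambda>n. f (r n) d) \<circ> q) \<longlonglongrightarrow> y"
    using bounded_imp_convergent_subsequence by blast
  show ?case
  proof (intro exI conjI allI impI)
    show "strict_mono (r \<circ> q)" using r(1) q(1) by (rule strict_mono_o)
    fix k assume "k < Suc d"
    show "(\<lambda>n. f ((r \<circ> q) n) k) \<longlonglongrightarrow> (l(d := y)) k"
    proof (cases "k = d")
      case False
      then have "(\<lambda>n. f (r n) k) \<longlonglongrightarrow> l k" using r(2) \<open>k < Suc d\<close> by auto
      from LIMSEQ_subseq_LIMSEQ[OF this q(1)] show ?thesis using False by (simp add: comp_def)
    qed (use q(2) in \<open>simp add: comp_def\<close>)
  qed
qed

lemma mem_unit_sphere_iff: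
  "s \<in> unit_sphere d \<longleftrightarrow> s \<in> extensional {..<d} \<and> (\<Sum>k<d. (s k)\<^sup>2) = 1"
  by (auto simp: unit_sphere_def vec_space_def space_PiM PiE_def L2_set_def)

text \<open>By compactness of the sphere, an exact solution exists iff there are approximate rational ones.\<close>

lemma exists_sphere_iff_rational_approximation:
  assumes "finite I" "\<And>e. e \<in> I \<Longrightarrow> closed (C e)" "\<And>e. e \<in> I \<Longrightarrow> C e \<noteq> {}"
  shows "(\<exists>s\<in>unit_sphere d. \<forall>e\<in>I. vec_inner d (x e) s \<in> C e) \<longleftrightarrow>
    (\<forall>j. \<exists>q\<in>PiE {..<d} (\<lambda>_. \<rat>). \<bar>(\<Sum>k<d. (q k)\<^sup>2) - 1\<bar> < 1 / real (Suc j) \<and>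
      (\<forall>e\<in>I. infdist (vec_inner d (x e) q) (C e) < 1 / real (Suc j)))"
    (is "?L \<longleftrightarrow> ?R")
proof
  assume ?L
  then obtain s where s: "s \<in> unit_sphere d" "\<And>e. e \<in> I \<Longrightarrow> vec_inner d (x e) s \<in> C e" by blast
  \<comment> \<open>Rational approximations need neither lie on the sphere nor satisfy the
    conditions \<open>C e\<close>, which is why the right-hand side relaxes both by
    \<open>1 / Suc j\<close>.\<close>
  have "\<exists>q::nat \<Rightarrow> real. (\<forall>n. q n \<in> \<rat>) \<and> q \<longlonglongrightarrow> s k" for k
  proof -
    have "s k \<in> closure \<rat>" by (simp add: Rats_closure_real)
    then show ?thesis by (simp add: closure_sequential)
  qed
  then obtain q where q: "\<And>k n. q k n \<in> \<rat>" "\<And>k. q k \<longlonglongrightarrow> s k" by metis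
  show ?R
  proof
    fix j
    define \<delta> where "\<delta> = 1 / real (Suc j)"
    have "\<delta> > 0" by (simp add: \<delta>_def)
    have "(\<lambda>n. \<bar>(\<Sum>k<d. (q k n)\<^sup>2) - 1\<bar>) \<longlonglongrightarrow> \<bar>(\<Sum>k<d. (s k)\<^sup>2) - 1\<bar>"
      by (intro tendsto_intros q)
    then have ev1: "\<forall>\<^sub>F n in sequentially. \<bar>(\<Sum>k<d. (q k n)\<^sup>2) - 1\<bar> < \<delta>"
      using s(1) \<open>\<delta> > 0\<close> by (intro order_tendstoD(2)) (auto simp: mem_unit_sphere_iff)
    have ev2: "\<forall>\<^sub>F n in sequentially. infdist (vec_inner d (x e) (\<lambda>k. q k n)) (C e) < \<delta>" if "e \<in> I" for e
    proof -
      have "(\<lambda>n. infdist (vec_inner d (x e) (\<lambda>k. q k n)) (C e)) \<longlonglongrightarrow> infdist (vec_inner d (x e) s) (C e)"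
        unfolding vec_inner_def by (intro tendsto_intros q)
      then show ?thesis using s(2)[OF that] \<open>\<delta> > 0\<close> by (intro order_tendstoD(2)) auto
    qed
    have "\<forall>\<^sub>F n in sequentially. \<bar>(\<Sum>k<d. (q k n)\<^sup>2) - 1\<bar> < \<delta> \<and>
        (\<forall>e\<in>I. infdist (vec_inner d (x e) (\<lambda>k. q k n)) (C e) < \<delta>)"
      using ev1 ev2 assms(1) by (intro eventually_conj) (auto simp: eventually_ball_finite_distrib)
    then obtain n where "\<bar>(\<Sum>k<d. (q k n)\<^sup>2) - 1\<bar> < \<delta>"
        "\<forall>e\<in>I. infdist (vec_inner d (x e) (\<lambda>k. q k n)) (C e) < \<delta>"
      using eventually_happens[of _ sequentially] by auto
    then show "\<exists>q\<in>PiE {..<d} (\<lambda>_. \<rat>). \<bar>(\<Sum>k<d. (q k)\<^sup>2) - 1\<bar> < 1 / real (Suc j) \<and>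
      (\<forall>e\<in>I. infdist (vec_inner d (x e) q) (C e) < 1 / real (Suc j))"
      unfolding \<delta>_def[symmetric]
      by (intro bexI[of _ "\<lambda>k\<in>{..<d}. q k n"]) (auto simp: vec_inner_restrict q)
  qed
next
  assume ?R
  then obtain q where q: "\<And>j. \<bar>(\<Sum>k<d. (q j k)\<^sup>2) - 1\<bar> < 1 / real (Suc j)"
    "\<And>j e. e \<in> I \<Longrightarrow> infdist (vec_inner d (x e) (q j)) (C e) < 1 / real (Suc j)" by metis
  \<comment> \<open>The squares sum to at most 2, so every coordinate is bounded by 2, uniformly in
    \<open>j\<close> as the extraction of a subsequence requires.\<close>
  have "\<bar>q j k\<bar> \<le> 2" if "k < d" for j k
  proof -
    have "(q j k)\<^sup>2 \<le> (\<Sum>k<d. (q j k)\<^sup>2)" using that by (intro member_le_sum) auto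
    moreover have "1 / real (Suc j) \<le> 1" by simp
    then have "(\<Sum>k<d. (q j k)\<^sup>2) \<le> 2" using q(1)[of j] by linarith
    ultimately have "\<bar>q j k\<bar>\<^sup>2 \<le> 2\<^sup>2" by simp
    then show ?thesis by (rule power2_le_imp_le) simp
  qed
  from bounded_coordinates_subsequence[of d q 2, OF this] obtain r l where
    r: "strict_mono r" "\<And>k. k < d \<Longrightarrow> (\<lambda>n. q (r n) k) \<longlonglongrightarrow> l k" by blast
  have lim0: "(\<lambda>n. 1 / real (Suc (r n))) \<longlonglongrightarrow> 0"
    using LIMSEQ_subseq_LIMSEQ[OF LIMSEQ_inverse_real_of_nat r(1)] by (simp add: comp_def inverse_eq_divide)
  have "(\<lambda>n. \<bar>(\<Sum>k<d. (q (r n) k)\<^sup>2) - 1\<bar>) \<longlonglongrightarrow> \<bar>(\<Sum>k<d. (l k)\<^sup>2) - 1\<bar>"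
    by (intro tendsto_intros r) auto
  then have "\<bar>(\<Sum>k<d. (l k)\<^sup>2) - 1\<bar> \<le> 0"
    by (rule LIMSEQ_le[OF _ lim0]) (use q(1) in \<open>auto intro!: less_imp_le\<close>)
  then have "restrict l {..<d} \<in> unit_sphere d" by (simp add: mem_unit_sphere_iff)
  moreover have "vec_inner d (x e) l \<in> C e" if "e \<in> I" for e
  proof -
    have "(\<lambda>n. infdist (vec_inner d (x e) (q (r n))) (C e)) \<longlonglongrightarrow> infdist (vec_inner d (x e) l) (C e)"
      unfolding vec_inner_def by (intro tendsto_intros r) auto
    then have "infdist (vec_inner d (x e) l) (C e) \<le> 0"
      by (rule LIMSEQ_le[OF _ lim0]) (use q(2)[OF that] in \<open>auto intro!: less_imp_le\<close>)
    then show ?thesis using assms that in_closed_iff_infdist_zero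
      by (metis infdist_nonneg order_antisym)
  qed
  ultimately show ?L by (intro bexI[of _ "restrict l {..<d}"]) (auto simp: vec_inner_restrict)
qed

lemma measurable_vec_inner:
  assumes "e \<in> I"
  shows "(\<lambda>x. vec_inner d (x e) q) \<in> borel_measurable (PiM I (\<lambda>_. vec_space d))"
proof -
  have [measurable]: "(\<lambda>x. x e k) \<in> borel_measurable (PiM I (\<lambda>_. vec_space d))" if "k < d" for k
    unfolding vec_space_def using assms that
    by (intro measurable_compose[OF measurable_component_singleton[OF assms]] measurable_component_singleton) auto
  show ?thesis unfolding vec_inner_def by measurable
qed

text \<open>The existential over the sphere is uncountable; rational points with relaxed conditions
  leave only countable quantifiers over measurable functions of \<open>x\<close>.\<close>

lemma sets_exists_sphere_closed:
  assumes "finite I" "\<And>e. e \<in> I \<Longrightarrow> closed (C e)"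
  shows "{x \<in> space (PiM I (\<lambda>_. vec_space d)). \<exists>s\<in>unit_sphere d. \<forall>e\<in>I. vec_inner d (x e) s \<in> C e}
    \<in> sets (PiM I (\<lambda>_. vec_space d))"
proof (cases "\<forall>e\<in>I. C e \<noteq> {}")
  case True
  have m: "{x \<in> space (PiM I (\<lambda>_. vec_space d)). infdist (vec_inner d (x e) q) (C e) < c}
      \<in> sets (PiM I (\<lambda>_. vec_space d))" if "e \<in> I" for e q and c :: real
  proof -
    have "(\<lambda>x. infdist (vec_inner d (x e) q) (C e)) \<in> borel_measurable (PiM I (\<lambda>_. vec_space d))"
      using measurable_vec_inner[OF that]
      by (rule measurable_compose) (intro borel_measurable_continuous_onI continuous_intros)
    then show ?thesis by measurable
  qed
  have "countable (PiE {..<d} (\<lambda>_. \<rat>) :: (nat \<Rightarrow> real) set)"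
    by (intro countable_PiE) (auto simp: countable_rat)
  then have "{x \<in> space (PiM I (\<lambda>_. vec_space d)). \<forall>j. \<exists>q\<in>PiE {..<d} (\<lambda>_. \<rat>).
      \<bar>(\<Sum>k<d. (q k)\<^sup>2) - 1\<bar> < 1 / real (Suc j) \<and>
      (\<forall>e\<in>I. infdist (vec_inner d (x e) q) (C e) < 1 / real (Suc j))} \<in> sets (PiM I (\<lambda>_. vec_space d))"
    using assms(1)
    by (intro sets.sets_Collect_countable_All sets.sets_Collect_countable_Ex' sets.sets_Collect_conj
        sets.sets_Collect_finite_All sets.sets_Collect_const m)
  then show ?thesis
    using True by (simp add: exists_sphere_iff_rational_approximation[OF assms])
next
  \<comment> \<open>An empty \<open>C e\<close> is treated apart because \<open>infdist\<close> to
    the empty set is 0, so the relaxed condition would hold vacuously.\<close>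
  case False
  then have "{x \<in> space (PiM I (\<lambda>_. vec_space d)). \<exists>s\<in>unit_sphere d. \<forall>e\<in>I. vec_inner d (x e) s \<in> C e} = {}"
    by auto
  then show ?thesis by (simp only: sets.empty_sets)
qed

text \<open>Strict signs are not closed conditions, but each is an increasing union of closed ones.
  As \<open>I\<close> is finite, a single index \<open>m\<close> serves all \<open>e\<close>, and
  the event becomes a countable union of events of the closed kind.\<close>

lemma sets_exists_sphere:
  fixes C :: "nat \<Rightarrow> 'e \<Rightarrow> real set"
  assumes "finite I" "\<And>m e. closed (C m e)" "\<And>e. mono (\<lambda>m. C m e)"
    and P: "\<And>e y. e \<in> I \<Longrightarrow> P e y \<longleftrightarrow> (\<exists>m. y \<in> C m e)"
  shows "{x \<in> space (PiM I (\<lambda>_. vec_space d)). \<exists>s\<in>unit_sphere d. \<forall>e\<in>I. P e (vec_inner d (x e) s)}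
    \<in> sets (PiM I (\<lambda>_. vec_space d))"
proof -
  have "(\<forall>e\<in>I. P e (y e)) \<longleftrightarrow> (\<exists>m. \<forall>e\<in>I. y e \<in> C m e)" for y
  proof
    assume "\<forall>e\<in>I. P e (y e)"
    then have "\<forall>e\<in>I. \<exists>m. y e \<in> C m e" using P by blast
    then obtain m where m: "\<And>e. e \<in> I \<Longrightarrow> y e \<in> C (m e) e" by metis
    obtain b where "\<forall>e\<in>I. m e \<le> b" using assms(1) by (meson finite_nat_set_iff_bounded_le finite_imageI imageI)
    then have "y e \<in> C b e" if "e \<in> I" for e using m[OF that] monoD[OF assms(3)] that by blast
    then show "\<exists>m. \<forall>e\<in>I. y e \<in> C m e" by blast
  qed (use P in blast)
  then have "{x \<in> space (PiM I (\<lambda>_. vec_space d)). \<exists>s\<in>unit_sphere d. \<forall>e\<in>I. P e (vec_inner d (x e) s)} =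
    (\<Union>m. {x \<in> space (PiM I (\<lambda>_. vec_space d)). \<exists>s\<in>unit_sphere d. \<forall>e\<in>I. vec_inner d (x e) s \<in> C m e})"
    by auto
  then show ?thesis using sets_exists_sphere_closed[OF assms(1,2)] by auto
qed

subsection \<open>Gaussian configurations\<close>

definition gauss_vec :: "nat \<Rightarrow> (nat \<Rightarrow> real) measure" where
  "gauss_vec d = PiM {..<d} (\<lambda>_. std_normal_distribution)"

abbreviation gauss_config :: "'e set \<Rightarrow> nat \<Rightarrow> ('e \<Rightarrow> nat \<Rightarrow> real) measure" where
  "gauss_config I d \<equiv> PiM I (\<lambda>_. gauss_vec d)"

lemma sets_gauss_vec [measurable_cong]: "sets (gauss_vec d) = sets (vec_space d)"
  unfolding gauss_vec_def vec_space_def by (intro sets_PiM_cong) auto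

lemma sets_gauss_config: "sets (gauss_config I d) = sets (PiM I (\<lambda>_. vec_space d))"
  by (intro sets_PiM_cong) (auto simp: sets_gauss_vec)

lemma space_gauss_config: "space (gauss_config I d) = space (PiM I (\<lambda>_. vec_space d))"
  using sets_gauss_config by (rule sets_eq_imp_space_eq)

lemma prob_space_std_normal: "prob_space std_normal_distribution"
  by (rule prob_space_normal_density) simp

lemma prob_space_gauss_vec: "prob_space (gauss_vec d)"
  unfolding gauss_vec_def by (intro prob_space_PiM prob_space_std_normal)

lemma prob_space_gauss_config: "prob_space (gauss_config I d)"
  by (intro prob_space_PiM prob_space_gauss_vec)

text \<open>Fubini in the form used for genericity: with the \<open>I\<close> part frozen, a
  statement about almost every \<open>J\<close> part suffices.\<close>

lemma AE_PiM_union: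
  assumes "\<And>i. prob_space (M i)" "finite I" "finite J" "I \<inter> J = {}"
    and meas: "{z \<in> space (PiM (I \<union> J) M). P z} \<in> sets (PiM (I \<union> J) M)"
    and AE: "\<And>x. x \<in> space (PiM I M) \<Longrightarrow> AE y in PiM J M. P (merge I J (x, y))"
  shows "AE z in PiM (I \<union> J) M. P z"
proof -
  interpret product_prob_space M by (intro product_prob_spaceI assms)
  interpret I: finite_product_prob_space M I by standard fact
  interpret J: finite_product_prob_space M J by standard fact
  interpret P: pair_sigma_finite "PiM I M" "PiM J M" by standard
  have "AE w in PiM I M \<Otimes>\<^sub>M PiM J M. P (merge I J w)"
  proof (rule P.AE_pair_measure)
    have "merge I J -` {z \<in> space (PiM (I \<union> J) M). P z} \<inter> space (PiM I M \<Otimes>\<^sub>M PiM J M)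
        \<in> sets (PiM I M \<Otimes>\<^sub>M PiM J M)"
      using measurable_sets[OF measurable_merge meas] .
    also have "merge I J -` {z \<in> space (PiM (I \<union> J) M). P z} \<inter> space (PiM I M \<Otimes>\<^sub>M PiM J M) =
        {w \<in> space (PiM I M \<Otimes>\<^sub>M PiM J M). P (merge I J w)}"
      using measurable_space[OF measurable_merge[of I J M]] by auto
    finally show "{w \<in> space (PiM I M \<Otimes>\<^sub>M PiM J M). P (merge I J w)} \<in> sets (PiM I M \<Otimes>\<^sub>M PiM J M)" .
    show "AE x in PiM I M. AE y in PiM J M. P (merge I J (x, y))" using AE by (rule AE_I2)
  qed
  then have "AE z in distr (PiM I M \<Otimes>\<^sub>M PiM J M) (PiM (I \<union> J) M) (merge I J). P z"
    using meas by (subst AE_distr_iff) auto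
  then show ?thesis unfolding distr_merge[OF assms(4,2,3)] .
qed

text \<open>Choose a coordinate \<open>k\<close> with \<open>s k \<noteq> 0\<close>. Once the other
  coordinates are fixed, orthogonality determines coordinate \<open>k\<close>, a single point of a
  law with a density.\<close>

lemma AE_gauss_vec_hyperplane:
  assumes "s \<in> unit_sphere d"
  shows "AE v in gauss_vec d. vec_inner d v s \<noteq> 0"
proof -
  obtain k where k: "k < d" "s k \<noteq> 0" using unit_sphere_nonzero[OF assms] by blast
  define J where "J = {..<d} - {k}"
  have U: "J \<union> {k} = {..<d}" using k by (auto simp: J_def)
  have "AE v in PiM (J \<union> {k}) (\<lambda>_. std_normal_distribution). vec_inner d v s \<noteq> 0"
  proof (rule AE_PiM_union)
    have eq: "sets (PiM (J \<union> {k}) (\<lambda>_. std_normal_distribution)) = sets (PiM {..<d} (\<lambda>_. borel))"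
      unfolding U by (intro sets_PiM_cong) auto
    have "(\<lambda>v. vec_inner d v s) \<in> borel_measurable (PiM {..<d} (\<lambda>_. borel))"
      unfolding vec_inner_def by (intro borel_measurable_sum borel_measurable_times borel_measurable_const
        measurable_component_singleton) auto
    then have "{v \<in> space (PiM {..<d} (\<lambda>_. borel)). vec_inner d v s \<noteq> 0} \<in> sets (PiM {..<d} (\<lambda>_. borel))"
      by measurable
    then show "{v \<in> space (PiM (J \<union> {k}) (\<lambda>_. std_normal_distribution)). vec_inner d v s \<noteq> 0}
        \<in> sets (PiM (J \<union> {k}) (\<lambda>_. std_normal_distribution))"
      unfolding eq sets_eq_imp_space_eq[OF eq] .
    fix x
    define c where "c = - (\<Sum>j\<in>J. x j * s j) / s k"
    have "AE y in std_normal_distribution. y \<noteq> c"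
      by (subst AE_density) (auto intro: eventually_mono[OF AE_lborel_singleton])
    then have "AE y in PiM {k} (\<lambda>_. std_normal_distribution). y k \<noteq> c"
      by (rule AE_PiM_component[rotated 2]) (auto intro: prob_space_std_normal)
    then show "AE y in PiM {k} (\<lambda>_. std_normal_distribution). vec_inner d (merge J {k} (x, y)) s \<noteq> 0"
    proof eventually_elim
      fix y :: "nat \<Rightarrow> real" assume y: "y k \<noteq> c"
      have kJ: "k \<notin> J" "finite J" by (auto simp: J_def)
      have "vec_inner d (merge J {k} (x, y)) s = (\<Sum>j\<in>insert k J. merge J {k} (x, y) j * s j)"
        unfolding vec_inner_def using U by simp
      also have "\<dots> = y k * s k + (\<Sum>j\<in>J. x j * s j)"
        using kJ by (simp add: merge_def)
      finally show "vec_inner d (merge J {k} (x, y)) s \<noteq> 0"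
        using y k(2) by (auto simp: c_def field_simps)
    qed
  qed (auto simp: J_def intro: prob_space_std_normal)
  then show ?thesis unfolding U gauss_vec_def .
qed

lemma sets_exists_orthogonal:
  assumes "finite I" "A \<subseteq> I"
  shows "{x \<in> space (gauss_config I d). \<exists>s\<in>unit_sphere d.
    (\<forall>e\<in>A. vec_inner d (x e) s = 0) \<and> (\<forall>e\<in>I - A. vec_inner d (x e) s \<noteq> 0)} \<in> sets (gauss_config I d)"
proof -
  define P where "P = (\<lambda>e y. if e \<in> A then y = 0 else y \<noteq> (0::real))"
  define C where "C = (\<lambda>m e. if e \<in> A then {0::real} else {..- (1 / real (Suc m))} \<union> {1 / real (Suc m)..})"
  have "{x \<in> space (PiM I (\<lambda>_. vec_space d)). \<exists>s\<in>unit_sphere d. \<forall>e\<in>I. P e (vec_inner d (x e) s)}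
    \<in> sets (PiM I (\<lambda>_. vec_space d))"
  proof (rule sets_exists_sphere[OF assms(1)])
    show "closed (C m e)" for m e by (auto simp: C_def)
    show "mono (\<lambda>m. C m e)" for e
    proof (rule monoI)
      fix m n :: nat assume "m \<le> n"
      then have "1 / real (Suc n) \<le> 1 / real (Suc m)" by (simp add: frac_le)
      then show "C m e \<subseteq> C n e" by (auto simp: C_def)
    qed
    show "P e y \<longleftrightarrow> (\<exists>m. y \<in> C m e)" for e y
    proof (cases "e \<in> A \<or> y = 0")
      case False
      then obtain m where "1 / real (Suc m) < \<bar>y\<bar>" using nat_approx_posE[of "\<bar>y\<bar>"] by auto
      then show ?thesis using False by (auto simp: P_def C_def intro!: exI[of _ m])
    qed (auto simp: P_def C_def)
  qed
  moreover have "(\<forall>e\<in>I. P e (vec_inner d (x e) s)) \<longleftrightarrow>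
    (\<forall>e\<in>A. vec_inner d (x e) s = 0) \<and> (\<forall>e\<in>I - A. vec_inner d (x e) s \<noteq> 0)" for x s
    using assms(2) by (auto simp: P_def)
  ultimately show ?thesis by (simp add: sets_gauss_config space_gauss_config)
qed

lemma exists_orthogonal:
  assumes "finite A" "card A < d"
  obtains s where "s \<in> unit_sphere d" "\<And>e. e \<in> A \<Longrightarrow> vec_inner d (x e) s = 0"
proof -
  from homogeneous_system_nontrivial[of A "{..<d}" x] assms obtain c where
    c: "\<exists>k<d. c k \<noteq> 0" "\<And>e. e \<in> A \<Longrightarrow> vec_inner d (x e) c = 0"
    by (auto simp: vec_inner_def)
  obtain r where "r > 0" "(\<lambda>k\<in>{..<d}. r * c k) \<in> unit_sphere d"
    using normalized_in_unit_sphere[OF c(1)] by blast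
  then show thesis using that[of "\<lambda>k\<in>{..<d}. r * c k"] c(2) by (simp add: vec_inner_restrict vec_inner_scale)
qed

text \<open>For each small \<open>A\<close>, condition on the vectors in \<open>A\<close> and choose
  \<open>s\<close> orthogonal to them. The remaining vectors are independent of this choice, so
  almost surely none of them lies in the hyperplane of \<open>s\<close>; there are only finitely
  many \<open>A\<close>.\<close>

lemma AE_general_position:
  assumes "finite I"
  shows "AE x in gauss_config I d. general_position I d x"
proof -
  have "AE x in gauss_config I d. \<exists>s\<in>unit_sphere d.
    (\<forall>e\<in>A. vec_inner d (x e) s = 0) \<and> (\<forall>e\<in>I - A. vec_inner d (x e) s \<noteq> 0)"
    if A: "A \<in> {A. A \<subseteq> I \<and> card A < d}" for A
  proof -
    have U: "A \<union> (I - A) = I" using A by auto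
    have fin: "finite A" "finite (I - A)" using A assms finite_subset by auto
    have "AE x in gauss_config (A \<union> (I - A)) d. \<exists>s\<in>unit_sphere d.
      (\<forall>e\<in>A. vec_inner d (x e) s = 0) \<and> (\<forall>e\<in>I - A. vec_inner d (x e) s \<noteq> 0)"
    proof (rule AE_PiM_union)
      show "{x \<in> space (gauss_config (A \<union> (I - A)) d). \<exists>s\<in>unit_sphere d.
        (\<forall>e\<in>A. vec_inner d (x e) s = 0) \<and> (\<forall>e\<in>I - A. vec_inner d (x e) s \<noteq> 0)}
        \<in> sets (gauss_config (A \<union> (I - A)) d)"
        unfolding U using sets_exists_orthogonal[OF assms] A by auto
      fix x
      obtain s where s: "s \<in> unit_sphere d" "\<And>e. e \<in> A \<Longrightarrow> vec_inner d (x e) s = 0"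
        using exists_orthogonal[OF fin(1), of d x] A by auto
      have "AE y in gauss_config (I - A) d. \<forall>e\<in>I - A. vec_inner d (y e) s \<noteq> 0"
        using fin(2) AE_gauss_vec_hyperplane[OF s(1)]
        by (intro AE_finite_allI AE_PiM_component[where P = "\<lambda>v. vec_inner d v s \<noteq> 0"]) (auto intro: prob_space_gauss_vec)
      then show "AE y in gauss_config (I - A) d. \<exists>s\<in>unit_sphere d.
        (\<forall>e\<in>A. vec_inner d (merge A (I - A) (x, y) e) s = 0) \<and>
        (\<forall>e\<in>I - A. vec_inner d (merge A (I - A) (x, y) e) s \<noteq> 0)"
      proof eventually_elim
        case (elim y)
        then show ?case using s by (intro bexI[of _ s]) (auto simp: merge_def)
      qed
    qed (use fin prob_space_gauss_vec in auto)
    then show ?thesis unfolding U .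
  qed
  then have "AE x in gauss_config I d. \<forall>A\<in>{A. A \<subseteq> I \<and> card A < d}. \<exists>s\<in>unit_sphere d.
    (\<forall>e\<in>A. vec_inner d (x e) s = 0) \<and> (\<forall>e\<in>I - A. vec_inner d (x e) s \<noteq> 0)"
    using assms by (intro AE_finite_allI) auto
  then show ?thesis by eventually_elim (auto simp: general_position_def)
qed

section \<open>Sign symmetry and the probability of a fixed pattern\<close>

lemma distr_PiM_componentwise_invariant:
  assumes "\<And>i. prob_space (M i)" "finite I"
    and f: "\<And>i. i \<in> I \<Longrightarrow> f i \<in> measurable (M i) (M i)" "\<And>i. i \<in> I \<Longrightarrow> distr (M i) (M i) (f i) = M i"
  shows "(\<lambda>x. \<lambda>i\<in>I. f i (x i)) \<in> measurable (PiM I M) (PiM I M)"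
    and "distr (PiM I M) (PiM I M) (\<lambda>x. \<lambda>i\<in>I. f i (x i)) = PiM I M"
proof -
  interpret product_prob_space M by (intro product_prob_spaceI assms)
  show meas: "(\<lambda>x. \<lambda>i\<in>I. f i (x i)) \<in> measurable (PiM I M) (PiM I M)"
    using f(1) by (intro measurable_restrict measurable_compose[OF measurable_component_singleton])
  show "distr (PiM I M) (PiM I M) (\<lambda>x. \<lambda>i\<in>I. f i (x i)) = PiM I M"
  proof (rule PiM_eqI)
    fix A assume A: "\<And>i. i \<in> I \<Longrightarrow> A i \<in> sets (M i)"
    have "emeasure (distr (PiM I M) (PiM I M) (\<lambda>x. \<lambda>i\<in>I. f i (x i))) (Pi\<^sub>E I A) =
      emeasure (PiM I M) ((\<lambda>x. \<lambda>i\<in>I. f i (x i)) -` Pi\<^sub>E I A \<inter> space (PiM I M))"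
      using A assms(2) by (intro emeasure_distr meas sets_PiM_I_finite)
    also have "(\<lambda>x. \<lambda>i\<in>I. f i (x i)) -` Pi\<^sub>E I A \<inter> space (PiM I M) = Pi\<^sub>E I (\<lambda>i. f i -` A i \<inter> space (M i))"
      by (auto simp: space_PiM PiE_iff)
    also have "emeasure (PiM I M) \<dots> = (\<Prod>i\<in>I. emeasure (M i) (f i -` A i \<inter> space (M i)))"
      using A f(1) assms(2) by (intro emeasure_PiM measurable_sets)
    also have "\<dots> = (\<Prod>i\<in>I. emeasure (distr (M i) (M i) (f i)) (A i))"
      using A f(1) by (intro prod.cong) (auto simp: emeasure_distr)
    also have "\<dots> = (\<Prod>i\<in>I. emeasure (M i) (A i))" using f(2) by simp
    finally show "emeasure (distr (PiM I M) (PiM I M) (\<lambda>x. \<lambda>i\<in>I. f i (x i))) (Pi\<^sub>E I A) = \<dots>" .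
  qed (use assms(2) in simp_all)
qed

lemma distr_std_normal_uminus: "distr std_normal_distribution std_normal_distribution uminus = std_normal_distribution"
proof -
  have "distr std_normal_distribution std_normal_distribution uminus = distr std_normal_distribution lborel uminus"
    by (intro distr_cong) auto
  also have "\<dots> = distr (density lborel ((\<lambda>x. ennreal (std_normal_density x)) \<circ> uminus)) lborel uminus"
    by (simp add: comp_def normal_density_def)
  also have "\<dots> = density (distr lborel lborel uminus) (\<lambda>x. ennreal (std_normal_density x))"
    by (subst density_distr) (auto simp: comp_def)
  also have "distr lborel lborel uminus = (lborel :: real measure)"
  proof -
    have "distr lborel lborel uminus = (distr lborel borel uminus :: real measure)" by (intro distr_cong) auto
    then show ?thesis using lborel_distr_uminus by simp
  qed
  finally show ?thesis .
qed

lemma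
  shows measurable_gauss_vec_uminus: "(\<lambda>v. \<lambda>k\<in>{..<d}. - v k) \<in> measurable (gauss_vec d) (gauss_vec d)"
    and distr_gauss_vec_uminus: "distr (gauss_vec d) (gauss_vec d) (\<lambda>v. \<lambda>k\<in>{..<d}. - v k) = gauss_vec d"
  unfolding gauss_vec_def
  using distr_PiM_componentwise_invariant[of "\<lambda>_. std_normal_distribution" "{..<d}" "\<lambda>_. uminus"]
  by (simp_all add: prob_space_std_normal distr_std_normal_uminus)

text \<open>The measurability criterion speaks of unit vectors. With \<open>I\<close> nonempty some
  inner product is nonzero, hence so is \<open>s\<close>, and rescaling by a positive factor keeps
  all signs.\<close>

lemma sign_patterns_iff_unit_sphere:
  assumes "I \<noteq> {}" "\<sigma> \<subseteq> I"
  shows "\<sigma> \<in> sign_patterns I d x \<longleftrightarrow>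
    (\<exists>s\<in>unit_sphere d. \<forall>e\<in>I. if e \<in> \<sigma> then vec_inner d (x e) s > 0 else vec_inner d (x e) s < 0)"
proof
  assume "\<sigma> \<in> sign_patterns I d x"
  then obtain s where s: "\<And>e. e \<in> \<sigma> \<Longrightarrow> vec_inner d (x e) s > 0" "\<And>e. e \<in> I - \<sigma> \<Longrightarrow> vec_inner d (x e) s < 0"
    unfolding sign_patterns_def by blast
  obtain e where "e \<in> I" using assms by blast
  then have "vec_inner d (x e) s \<noteq> 0" using s(1)[of e] s(2)[of e] by (cases "e \<in> \<sigma>") auto
  then have "\<exists>k<d. s k \<noteq> 0" unfolding vec_inner_def by (metis (no_types, lifting) lessThan_iff mult_zero_right sum.neutral)
  then obtain c where c: "c > 0" "(\<lambda>k\<in>{..<d}. c * s k) \<in> unit_sphere d"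
    by (rule normalized_in_unit_sphere)
  then show "\<exists>s\<in>unit_sphere d. \<forall>e\<in>I. if e \<in> \<sigma> then vec_inner d (x e) s > 0 else vec_inner d (x e) s < 0"
    using s by (intro bexI[OF _ c(2)]) (auto simp: vec_inner_restrict vec_inner_scale mult_pos_neg)
next
  assume "\<exists>s\<in>unit_sphere d. \<forall>e\<in>I. if e \<in> \<sigma> then vec_inner d (x e) s > 0 else vec_inner d (x e) s < 0"
  then obtain s where s: "\<And>e. e \<in> I \<Longrightarrow> if e \<in> \<sigma> then vec_inner d (x e) s > 0 else vec_inner d (x e) s < 0" by blast
  then have "(\<forall>e\<in>\<sigma>. vec_inner d (x e) s > 0) \<and> (\<forall>e\<in>I - \<sigma>. vec_inner d (x e) s < 0)"
    using assms(2) by (metis Diff_iff subsetD)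
  then show "\<sigma> \<in> sign_patterns I d x" using assms(2) unfolding sign_patterns_def by blast
qed

lemma inverse_Suc_antimono: "m \<le> n \<Longrightarrow> 1 / real (Suc n) \<le> 1 / real (Suc m)"
  by (simp add: frac_le)

lemma sets_sign_pattern:
  assumes "finite I"
  shows "{x \<in> space (gauss_config I d). \<sigma> \<in> sign_patterns I d x} \<in> sets (gauss_config I d)"
proof (cases "I \<noteq> {} \<and> \<sigma> \<subseteq> I")
  case True
  define C where "C = (\<lambda>m e. if e \<in> \<sigma> then {1 / real (Suc m)..} else {..- (1 / real (Suc m))})"
  have "{x \<in> space (PiM I (\<lambda>_. vec_space d)). \<exists>s\<in>unit_sphere d. \<forall>e\<in>I.
      (if e \<in> \<sigma> then vec_inner d (x e) s > 0 else vec_inner d (x e) s < 0)} \<in> sets (PiM I (\<lambda>_. vec_space d))"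
  proof (rule sets_exists_sphere[OF assms, where C = C])
    show "closed (C m e)" for m e by (auto simp: C_def)
    show "mono (\<lambda>m. C m e)" for e
    proof (rule monoI)
      fix m n :: nat assume "m \<le> n"
      from inverse_Suc_antimono[OF this] show "C m e \<subseteq> C n e" by (auto simp: C_def)
    qed
    show "(if e \<in> \<sigma> then y > 0 else y < 0) \<longleftrightarrow> (\<exists>m. y \<in> C m e)" for e and y :: real
    proof
      assume y: "if e \<in> \<sigma> then y > 0 else y < 0"
      then have "\<bar>y\<bar> > 0" by (auto split: if_splits)
      then obtain m where "1 / real (Suc m) < \<bar>y\<bar>" using nat_approx_posE by blast
      then show "\<exists>m. y \<in> C m e" using y by (auto simp: C_def intro!: exI[of _ m] split: if_splits)
    next
      assume "\<exists>m. y \<in> C m e"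
      then obtain m where "y \<in> C m e" by blast
      then obtain h :: real where "h > 0" "y \<in> (if e \<in> \<sigma> then {h..} else {..- h})"
        unfolding C_def using that[of "1 / real (Suc m)"] by simp
      then show "if e \<in> \<sigma> then y > 0 else y < 0" by (auto split: if_splits)
    qed
  qed
  then show ?thesis using True by (simp add: sign_patterns_iff_unit_sphere sets_gauss_config space_gauss_config)
next
  case False
  then consider "\<not> \<sigma> \<subseteq> I" | "I = {}" "\<sigma> = {}" by auto
  then show ?thesis
  proof cases
    case 1
    then have "{x \<in> space (gauss_config I d). \<sigma> \<in> sign_patterns I d x} = {}" by (auto simp: sign_patterns_def)
    then show ?thesis by (simp only: sets.empty_sets)
  next
    case 2
    then have "{x \<in> space (gauss_config I d). \<sigma> \<in> sign_patterns I d x} = space (gauss_config I d)"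
      by (auto simp: sign_patterns_def)
    then show ?thesis by (simp only: sets.top)
  qed
qed

lemma measure_sign_pattern_eq:
  assumes "finite I" "\<sigma> \<subseteq> I"
  shows "measure (gauss_config I d) {x \<in> space (gauss_config I d). \<sigma> \<in> sign_patterns I d x} =
    measure (gauss_config I d) {x \<in> space (gauss_config I d). I \<in> sign_patterns I d x}"
proof -
  define f where "f = (\<lambda>e. if e \<in> \<sigma> then (\<lambda>v. v) else (\<lambda>v. \<lambda>k\<in>{..<d}. - v k :: real))"
  define flip where "flip = (\<lambda>x. \<lambda>e\<in>I. f e (x e))"
  have f: "f e \<in> measurable (gauss_vec d) (gauss_vec d)" "distr (gauss_vec d) (gauss_vec d) (f e) = gauss_vec d" for e
    using measurable_gauss_vec_uminus distr_gauss_vec_uminus by (auto simp: f_def)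
  note flip = distr_PiM_componentwise_invariant[of "\<lambda>_. gauss_vec d" I f, OF prob_space_gauss_vec assms(1) f, folded flip_def]
  have inner: "vec_inner d (flip x e) s = (if e \<in> \<sigma> then vec_inner d (x e) s else - vec_inner d (x e) s)"
    if "e \<in> I" for x e s
    using that by (simp add: flip_def f_def vec_inner_uminus)
  have "I \<in> sign_patterns I d (flip x) \<longleftrightarrow> \<sigma> \<in> sign_patterns I d x" for x
  proof -
    have "(\<forall>e\<in>I. vec_inner d (flip x e) s > 0) \<longleftrightarrow>
      (\<forall>e\<in>\<sigma>. vec_inner d (x e) s > 0) \<and> (\<forall>e\<in>I - \<sigma>. vec_inner d (x e) s < 0)" for s
      using assms(2) inner by (auto split: if_splits)
    then show ?thesis using assms(2) unfolding sign_patterns_def by simp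
  qed
  then have eq: "flip -` {x \<in> space (gauss_config I d). I \<in> sign_patterns I d x} \<inter> space (gauss_config I d) =
    {x \<in> space (gauss_config I d). \<sigma> \<in> sign_patterns I d x}"
    using measurable_space[OF flip(1)] by auto
  have "measure (gauss_config I d) {x \<in> space (gauss_config I d). I \<in> sign_patterns I d x} =
    measure (distr (gauss_config I d) (gauss_config I d) flip) {x \<in> space (gauss_config I d). I \<in> sign_patterns I d x}"
    unfolding flip(2) ..
  also have "\<dots> = measure (gauss_config I d) {x \<in> space (gauss_config I d). \<sigma> \<in> sign_patterns I d x}"
    unfolding eq[symmetric] by (rule measure_distr[OF flip(1) sets_sign_pattern[OF assms(1)]])
  finally show ?thesis ..
qed

lemma measure_sign_pattern_integral:
  assumes "finite I" "\<sigma> \<subseteq> I"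
  shows "measure (gauss_config I d) {x \<in> space (gauss_config I d). \<sigma> \<in> sign_patterns I d x} * 2 ^ card I =
      (\<integral>x. real (card (sign_patterns I d x)) \<partial>gauss_config I d)"
    and "integrable (gauss_config I d) (\<lambda>x. real (card (sign_patterns I d x)))"
proof -
  interpret prob_space "gauss_config I d" by (rule prob_space_gauss_config)
  define E where "E = (\<lambda>\<tau>. {x \<in> space (gauss_config I d). \<tau> \<in> sign_patterns I d x})"
  have E: "E \<tau> \<in> sets (gauss_config I d)" for \<tau> unfolding E_def by (rule sets_sign_pattern[OF assms(1)])
  have card: "real (card (sign_patterns I d x)) = (\<Sum>\<tau>\<in>Pow I. indicator (E \<tau>) x)" if "x \<in> space (gauss_config I d)" for x
  proof -
    have "(\<Sum>\<tau>\<in>Pow I. indicator (E \<tau>) x :: real) = (\<Sum>\<tau>\<in>Pow I. if \<tau> \<in> sign_patterns I d x then 1 else 0)"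
      using that by (intro sum.cong) (auto simp: E_def indicator_def)
    also have "\<dots> = real (card (Pow I \<inter> sign_patterns I d x))"
      using assms(1) by (simp add: sum.inter_restrict[symmetric])
    also have "Pow I \<inter> sign_patterns I d x = sign_patterns I d x" by (auto simp: sign_patterns_def)
    finally show ?thesis ..
  qed
  have int: "integrable (gauss_config I d) (\<lambda>x. \<Sum>\<tau>\<in>Pow I. indicator (E \<tau>) x :: real)"
    using E by (intro Bochner_Integration.integrable_sum integrable_real_indicator) (auto simp: emeasure_eq_measure)
  then show "integrable (gauss_config I d) (\<lambda>x. real (card (sign_patterns I d x)))"
    using card by (subst Bochner_Integration.integrable_cong[OF refl]) auto
  have "(\<integral>x. real (card (sign_patterns I d x)) \<partial>gauss_config I d) =
    (\<integral>x. (\<Sum>\<tau>\<in>Pow I. indicator (E \<tau>) x) \<partial>gauss_config I d)"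
    using card by (intro Bochner_Integration.integral_cong) auto
  also have "\<dots> = (\<Sum>\<tau>\<in>Pow I. measure (gauss_config I d) (E \<tau>))"
    using E by (subst Bochner_Integration.integral_sum)
      (auto simp: emeasure_eq_measure intro!: sum.cong integrable_real_indicator)
  also have "\<dots> = (\<Sum>\<tau>\<in>Pow I. measure (gauss_config I d) (E \<sigma>))"
    unfolding E_def
    by (intro sum.cong refl trans[OF measure_sign_pattern_eq[OF assms(1)] measure_sign_pattern_eq[OF assms, symmetric]])
      (rule PowD)
  also have "\<dots> = measure (gauss_config I d) (E \<sigma>) * 2 ^ card I"
    using assms(1) by (simp add: card_Pow)
  finally show "measure (gauss_config I d) {x \<in> space (gauss_config I d). \<sigma> \<in> sign_patterns I d x} * 2 ^ card I =
      (\<integral>x. real (card (sign_patterns I d x)) \<partial>gauss_config I d)" by (simp add: E_def)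
qed

lemma measure_sign_pattern_le:
  assumes "finite I" "\<sigma> \<subseteq> I"
  shows "measure (gauss_config I d) {x \<in> space (gauss_config I d). \<sigma> \<in> sign_patterns I d x} \<le>
    real (card I + 1) ^ d / 2 ^ card I"
proof -
  interpret prob_space "gauss_config I d" by (rule prob_space_gauss_config)
  have "(\<integral>x. real (card (sign_patterns I d x)) \<partial>gauss_config I d) \<le> real (card I + 1) ^ d"
    using card_sign_patterns_le[OF assms(1)]
    by (intro integral_le_const measure_sign_pattern_integral(2)[OF assms] AE_I2)
      (metis of_nat_le_iff of_nat_power)
  then show ?thesis using measure_sign_pattern_integral(1)[OF assms, of d] by (simp add: field_simps)
qed

lemma measure_sign_pattern_ge:
  assumes "finite I" "\<sigma> \<subseteq> I"
  shows "real (\<Sum>k<d. card I choose k) / 2 ^ card I \<le>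
    measure (gauss_config I d) {x \<in> space (gauss_config I d). \<sigma> \<in> sign_patterns I d x}"
proof -
  interpret prob_space "gauss_config I d" by (rule prob_space_gauss_config)
  have "AE x in gauss_config I d. real (\<Sum>k<d. card I choose k) \<le> real (card (sign_patterns I d x))"
    using AE_general_position[OF assms(1)] 
    by eventually_elim (use card_sign_patterns_ge[OF assms(1)] in \<open>simp only: of_nat_le_iff\<close>)
  then have "real (\<Sum>k<d. card I choose k) \<le> (\<integral>x. real (card (sign_patterns I d x)) \<partial>gauss_config I d)"
    by (intro integral_ge_const measure_sign_pattern_integral(2)[OF assms])
  then show ?thesis using measure_sign_pattern_integral(1)[OF assms, of d] by (simp add: field_simps)
qed

section \<open>Probability that some direction yields a pattern in a given family\<close>

lemma sets_exists_direction:
  assumes "finite I"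
  shows "{x \<in> space (gauss_config I d). \<exists>s\<in>unit_sphere d. {e\<in>I. vec_inner d (x e) s \<ge> 0} \<in> B} \<in> sets (gauss_config I d)"
proof -
  have *: "{x \<in> space (gauss_config I d). \<exists>s\<in>unit_sphere d. \<forall>e\<in>I. e \<in> \<sigma> \<longleftrightarrow> vec_inner d (x e) s \<ge> 0}
      \<in> sets (gauss_config I d)" for \<sigma>
  proof -
    \<comment> \<open>Nonnegativity is already closed, so only the strict inequalities outside
      \<open>\<sigma>\<close> need an exhaustion.\<close>
    define C where "C = (\<lambda>m e. if e \<in> \<sigma> then {0..} else {..- (1 / real (Suc m))})"
    have "{x \<in> space (PiM I (\<lambda>_. vec_space d)). \<exists>s\<in>unit_sphere d. \<forall>e\<in>I. e \<in> \<sigma> \<longleftrightarrow> vec_inner d (x e) s \<ge> 0}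
      \<in> sets (PiM I (\<lambda>_. vec_space d))"
    proof (rule sets_exists_sphere[OF assms, where C = C])
      show "closed (C m e)" for m e by (auto simp: C_def)
      show "mono (\<lambda>m. C m e)" for e
      proof (rule monoI)
        fix m n :: nat assume "m \<le> n"
        from inverse_Suc_antimono[OF this] show "C m e \<subseteq> C n e" by (auto simp: C_def)
      qed
      show "(e \<in> \<sigma> \<longleftrightarrow> y \<ge> 0) \<longleftrightarrow> (\<exists>m. y \<in> C m e)" for e and y :: real
      proof
        assume y: "e \<in> \<sigma> \<longleftrightarrow> y \<ge> 0"
        show "\<exists>m. y \<in> C m e"
        proof (cases "e \<in> \<sigma>")
          case False
          then have "\<bar>y\<bar> > 0" using y by auto
          then obtain m where "1 / real (Suc m) < \<bar>y\<bar>" using nat_approx_posE by blast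
          then show "\<exists>m. y \<in> C m e" using y False by (auto simp: C_def intro!: exI[of _ m])
        qed (use y in \<open>auto simp: C_def\<close>)
      next
        assume "\<exists>m. y \<in> C m e"
        then obtain m where "y \<in> C m e" by blast
        then obtain h :: real where "h > 0" "y \<in> (if e \<in> \<sigma> then {0..} else {..- h})"
          unfolding C_def using that[of "1 / real (Suc m)"] by simp
        then show "e \<in> \<sigma> \<longleftrightarrow> y \<ge> 0" by (auto split: if_splits)
      qed
    qed
    then show ?thesis by (simp add: sets_gauss_config space_gauss_config)
  qed
  have "{x \<in> space (gauss_config I d). \<exists>s\<in>unit_sphere d. {e\<in>I. vec_inner d (x e) s \<ge> 0} \<in> B} =
    (\<Union>\<sigma>\<in>B \<inter> Pow I. {x \<in> space (gauss_config I d). \<exists>s\<in>unit_sphere d. \<forall>e\<in>I. e \<in> \<sigma> \<longleftrightarrow> vec_inner d (x e) s \<ge> 0})"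
    (is "?L = ?R")
  proof (intro equalityI subsetI)
    fix x assume "x \<in> ?L"
    then obtain s where "x \<in> space (gauss_config I d)" "s \<in> unit_sphere d" "{e\<in>I. vec_inner d (x e) s \<ge> 0} \<in> B" by blast
    then show "x \<in> ?R" by (intro UN_I[of "{e\<in>I. vec_inner d (x e) s \<ge> 0}"]) auto
  next
    fix x assume "x \<in> ?R"
    then obtain \<sigma> s where *: "\<sigma> \<in> B" "\<sigma> \<subseteq> I" "x \<in> space (gauss_config I d)" "s \<in> unit_sphere d"
      "\<forall>e\<in>I. e \<in> \<sigma> \<longleftrightarrow> vec_inner d (x e) s \<ge> 0" by blast
    then have "{e\<in>I. vec_inner d (x e) s \<ge> 0} = \<sigma>" by auto
    then show "x \<in> ?L" using * by auto
  qed
  also have "\<dots> \<in> sets (gauss_config I d)" using assms * by (intro sets.finite_UN) auto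
  finally show ?thesis .
qed

text \<open>Almost surely the pattern of every direction is also realized strictly, so a union bound
  over \<open>B\<close> applies; the bound for a fixed pattern already contains the cost
  \<open>(card I + 1) ^ d\<close> of ranging over all directions.\<close>

lemma measure_exists_direction_le:
  assumes "finite I" "B \<subseteq> Pow I"
  shows "measure (gauss_config I d) {x \<in> space (gauss_config I d). \<exists>s\<in>unit_sphere d. {e\<in>I. vec_inner d (x e) s \<ge> 0} \<in> B}
    \<le> real (card B) * real (card I + 1) ^ d / 2 ^ card I"
proof -
  interpret prob_space "gauss_config I d" by (rule prob_space_gauss_config)
  have fin: "finite B" using assms by (meson finite_Pow_iff finite_subset)
  define E where "E = (\<lambda>\<tau>. {x \<in> space (gauss_config I d). \<tau> \<in> sign_patterns I d x})"
  have E: "E \<tau> \<in> sets (gauss_config I d)" for \<tau> unfolding E_def by (rule sets_sign_pattern[OF assms(1)])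
  have "measure (gauss_config I d) {x \<in> space (gauss_config I d). \<exists>s\<in>unit_sphere d. {e\<in>I. vec_inner d (x e) s \<ge> 0} \<in> B}
    \<le> measure (gauss_config I d) (\<Union>\<tau>\<in>B. E \<tau>)"
  proof (rule finite_measure_mono_AE)
    show "AE x in gauss_config I d. x \<in> {x \<in> space (gauss_config I d). \<exists>s\<in>unit_sphere d. {e\<in>I. vec_inner d (x e) s \<ge> 0} \<in> B}
      \<longrightarrow> x \<in> (\<Union>\<tau>\<in>B. E \<tau>)"
      using AE_general_position[OF assms(1)]
      by eventually_elim (auto simp: E_def dest: pattern_in_sign_patterns[OF _ assms(1)])
  qed (use E fin in auto)
  also have "\<dots> \<le> (\<Sum>\<tau>\<in>B. measure (gauss_config I d) (E \<tau>))"
    using E fin by (intro measure_UNION_le) auto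
  also have "\<dots> \<le> (\<Sum>\<tau>\<in>B. real (card I + 1) ^ d / 2 ^ card I)"
    unfolding E_def using assms by (intro sum_mono measure_sign_pattern_le) auto
  finally show ?thesis by simp
qed

text \<open>Only the vectors indexed by \<open>J\<close> are inspected. Their marginal law is again
  Gaussian, so the bound involves \<open>card J\<close> and not \<open>card I\<close>: a trace on
  few pairs can be forced however large \<open>I\<close> is.\<close>

lemma measure_exists_direction_ge:
  assumes "finite I" "J \<subseteq> I" "J \<noteq> {}" "\<tau> \<subseteq> J"
    and B: "\<And>\<sigma>. \<sigma> \<subseteq> I \<Longrightarrow> \<sigma> \<inter> J = \<tau> \<Longrightarrow> \<sigma> \<in> B"
  shows "real (\<Sum>k<d. card J choose k) / 2 ^ card J \<le>
    measure (gauss_config I d) {x \<in> space (gauss_config I d). \<exists>s\<in>unit_sphere d. {e\<in>I. vec_inner d (x e) s \<ge> 0} \<in> B}"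
proof -
  interpret prob_space "gauss_config I d" by (rule prob_space_gauss_config)
  interpret P: product_prob_space "\<lambda>_. gauss_vec d" by (intro product_prob_spaceI prob_space_gauss_vec)
  have finJ: "finite J" using assms finite_subset by blast
  have r: "(\<lambda>x. restrict x J) \<in> measurable (gauss_config I d) (gauss_config J d)"
    using assms(2) by (rule measurable_restrict_subset)
  have distr: "distr (gauss_config I d) (gauss_config J d) (\<lambda>x. restrict x J) = gauss_config J d"
    using distr_PiM_reindex[of I "\<lambda>_. gauss_vec d" "\<lambda>e. e" J] assms(2) prob_space_gauss_vec by auto
  have "real (\<Sum>k<d. card J choose k) / 2 ^ card J \<le>
      measure (distr (gauss_config I d) (gauss_config J d) (\<lambda>x. restrict x J))
        {x \<in> space (gauss_config J d). \<tau> \<in> sign_patterns J d x}"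
    unfolding distr by (rule measure_sign_pattern_ge[OF finJ assms(4)])
  also have "\<dots> = measure (gauss_config I d)
      ((\<lambda>x. restrict x J) -` {x \<in> space (gauss_config J d). \<tau> \<in> sign_patterns J d x} \<inter> space (gauss_config I d))"
    by (rule measure_distr[OF r sets_sign_pattern[OF finJ]])
  also have "\<dots> \<le> measure (gauss_config I d)
      {x \<in> space (gauss_config I d). \<exists>s\<in>unit_sphere d. {e\<in>I. vec_inner d (x e) s \<ge> 0} \<in> B}"
  proof (rule finite_measure_mono[OF _ sets_exists_direction[OF assms(1)]], safe)
    fix x assume "\<tau> \<in> sign_patterns J d (restrict x J)"
    then obtain s where s: "s \<in> unit_sphere d"
      "\<And>e. e \<in> J \<Longrightarrow> if e \<in> \<tau> then vec_inner d (restrict x J e) s > 0 else vec_inner d (restrict x J e) s < 0"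
      unfolding sign_patterns_iff_unit_sphere[OF assms(3,4)] by blast
    have "{e\<in>I. vec_inner d (x e) s \<ge> 0} \<inter> J = \<tau>"
    proof (intro equalityI subsetI)
      fix e assume "e \<in> {e\<in>I. vec_inner d (x e) s \<ge> 0} \<inter> J"
      then show "e \<in> \<tau>" using s(2)[of e] by (auto split: if_splits)
    next
      fix e assume "e \<in> \<tau>"
      then show "e \<in> {e\<in>I. vec_inner d (x e) s \<ge> 0} \<inter> J"
        using s(2)[of e] assms(2,4) by (auto simp: subset_iff)
    qed
    then have "{e\<in>I. vec_inner d (x e) s \<ge> 0} \<in> B" by (intro B) auto
    then show "\<exists>s\<in>unit_sphere d. {e\<in>I. vec_inner d (x e) s \<ge> 0} \<in> B" using s(1) by blast
  qed
  finally show ?thesis .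
qed

text \<open>Independence identifies the joint law of the family with the product of its marginals,
  so events can be evaluated in \<open>gauss_config I d\<close>.\<close>

lemma measure_gauss_config_transfer:
  fixes X :: "'e \<Rightarrow> 'a \<Rightarrow> nat \<Rightarrow> real"
  assumes "prob_space M" "I \<noteq> {}"
    and X: "\<And>e. e \<in> I \<Longrightarrow> std_normal_vec d M (X e)"
    and indep: "prob_space.indep_vars M (\<lambda>_. vec_space d) X I"
    and A: "A \<in> sets (gauss_config I d)"
  shows "{\<omega> \<in> space M. (\<lambda>e\<in>I. X e \<omega>) \<in> A} \<in> sets M"
    and "measure M {\<omega> \<in> space M. (\<lambda>e\<in>I. X e \<omega>) \<in> A} = measure (gauss_config I d) A"
proof -
  interpret prob_space M by fact
  have rv: "X e \<in> measurable M (vec_space d)" if "e \<in> I" for e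
    using X[OF that] by (simp add: std_normal_vec_def)
  have m: "(\<lambda>\<omega>. \<lambda>e\<in>I. X e \<omega>) \<in> measurable M (PiM I (\<lambda>_. vec_space d))"
    using rv by (intro measurable_restrict)
  have "distr M (PiM I (\<lambda>_. vec_space d)) (\<lambda>\<omega>. \<lambda>e\<in>I. X e \<omega>) = PiM I (\<lambda>e. distr M (vec_space d) (X e))"
    using indep_vars_iff_distr_eq_PiM'[of I X "\<lambda>_. vec_space d"] rv indep assms(2) by simp
  also have "\<dots> = gauss_config I d"
    using X by (intro PiM_cong) (auto simp: std_normal_vec_def gauss_vec_def)
  finally have distr: "distr M (PiM I (\<lambda>_. vec_space d)) (\<lambda>\<omega>. \<lambda>e\<in>I. X e \<omega>) = gauss_config I d" .
  have eq: "{\<omega> \<in> space M. (\<lambda>e\<in>I. X e \<omega>) \<in> A} = (\<lambda>\<omega>. \<lambda>e\<in>I. X e \<omega>) -` A \<inter> space M" by auto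
  show "{\<omega> \<in> space M. (\<lambda>e\<in>I. X e \<omega>) \<in> A} \<in> sets M"
    unfolding eq using measurable_sets[OF m] A by (simp add: sets_gauss_config)
  show "measure M {\<omega> \<in> space M. (\<lambda>e\<in>I. X e \<omega>) \<in> A} = measure (gauss_config I d) A"
    unfolding eq distr[symmetric] using A by (subst measure_distr[OF m]) (auto simp: sets_gauss_config)
qed

subsection \<open>Harris and Janson inequalities\<close>

lemma sum_Pow_insert:
  fixes f :: "'e set \<Rightarrow> real"
  assumes "finite E" "e \<notin> E"
  shows "(\<Sum>A\<in>Pow (insert e E). f A) = (\<Sum>A\<in>Pow E. f A) + (\<Sum>A\<in>Pow E. f (insert e A))"
proof -
  have "inj_on (insert e) (Pow E)" using assms(2) by (auto simp: inj_on_def)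
  then have "(\<Sum>A\<in>insert e ` Pow E. f A) = (\<Sum>A\<in>Pow E. f (insert e A))"
    by (simp add: sum.reindex)
  moreover have "Pow E \<inter> insert e ` Pow E = {}" using assms(2) by auto
  ultimately show ?thesis using assms(1) by (simp add: Pow_insert sum.union_disjoint)
qed

text \<open>Induction on the ground set. With \<open>a\<close> and \<open>a'\<close> the sums of
  \<open>f\<close> without and with \<open>e\<close>, and \<open>b\<close>, \<open>b'\<close>
  likewise for \<open>g\<close>, monotonicity gives \<open>(a' - a) * (b' - b) \<ge> 0\<close>,
  which is Chebyshev's sum inequality for the last coordinate. The factor \<open>2 ^ card E\<close>
  replaces normalization to probabilities.\<close>

lemma Harris_inequality:
  fixes f g :: "'e set \<Rightarrow> real"
  assumes "finite E"
    and "\<And>A B. A \<subseteq> B \<Longrightarrow> B \<subseteq> E \<Longrightarrow> f A \<le> f B" "\<And>A B. A \<subseteq> B \<Longrightarrow> B \<subseteq> E \<Longrightarrow> g A \<le> g B"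
  shows "(\<Sum>A\<in>Pow E. f A) * (\<Sum>A\<in>Pow E. g A) \<le> 2 ^ card E * (\<Sum>A\<in>Pow E. f A * g A)"
  using assms
proof (induction E arbitrary: f g rule: finite_induct)
  case empty
  then show ?case by simp
next
  case (insert e E)
  define f' where "f' = (\<lambda>A. f (insert e A))"
  define g' where "g' = (\<lambda>A. g (insert e A))"
  define a where "a = (\<Sum>A\<in>Pow E. f A)" define a' where "a' = (\<Sum>A\<in>Pow E. f' A)"
  define b where "b = (\<Sum>A\<in>Pow E. g A)" define b' where "b' = (\<Sum>A\<in>Pow E. g' A)"
  have "a * b \<le> 2 ^ card E * (\<Sum>A\<in>Pow E. f A * g A)"
    unfolding a_def b_def by (intro insert.IH insert.prems) auto
  moreover have "a' * b' \<le> 2 ^ card E * (\<Sum>A\<in>Pow E. f' A * g' A)"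
    unfolding a'_def b'_def f'_def g'_def by (intro insert.IH insert.prems) auto
  moreover have "a \<le> a'" "b \<le> b'"
    unfolding a_def a'_def b_def b'_def f'_def g'_def by (intro sum_mono insert.prems; auto)+
  then have "0 \<le> (a' - a) * (b' - b)" by simp
  ultimately have "(a + a') * (b + b') \<le> 2 * (2 ^ card E * (\<Sum>A\<in>Pow E. f A * g A) + 2 ^ card E * (\<Sum>A\<in>Pow E. f' A * g' A))"
    by (simp add: algebra_simps)
  then show ?case
    using insert(1,2) by (simp add: sum_Pow_insert a_def a'_def b_def b'_def f'_def g'_def algebra_simps)
qed

lemma card_subsets_avoiding:
  assumes "finite E"
  shows "card {A\<in>Pow E. A \<inter> T = {}} = 2 ^ card (E - T)"
proof -
  have "{A\<in>Pow E. A \<inter> T = {}} = Pow (E - T)" by auto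
  then show ?thesis using assms by (simp add: card_Pow)
qed

lemma sum_Pow_ignoring:
  fixes f :: "'e set \<Rightarrow> real"
  assumes "finite E" "T \<subseteq> E" "\<And>A. f A = f (A - T)"
  shows "(\<Sum>A\<in>Pow E. f A) = 2 ^ card T * (\<Sum>A\<in>Pow (E - T). f A)"
proof -
  have finT: "finite T" using assms finite_subset by blast
  have "bij_betw (\<lambda>(B, A). B \<union> A) (Pow T \<times> Pow (E - T)) (Pow E)"
    by (rule bij_betwI[where g = "\<lambda>A. (A \<inter> T, A - T)"]) (use assms(2) in auto)
  then have "(\<Sum>A\<in>Pow E. f A) = (\<Sum>(B, A)\<in>Pow T \<times> Pow (E - T). f (B \<union> A))"
    by (subst sum.reindex_bij_betw[symmetric]) (auto simp: case_prod_unfold)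
  also have "\<dots> = (\<Sum>B\<in>Pow T. \<Sum>A\<in>Pow (E - T). f (B \<union> A))"
    by (simp add: sum.cartesian_product)
  also have "\<dots> = (\<Sum>B\<in>Pow T. \<Sum>A\<in>Pow (E - T). f A)"
  proof (intro sum.cong refl)
    fix B A assume "B \<in> Pow T" "A \<in> Pow (E - T)"
    then have "(B \<union> A) - T = A - T" by auto
    then show "f (B \<union> A) = f A" using assms(3) by metis
  qed
  also have "\<dots> = 2 ^ card T * (\<Sum>A\<in>Pow (E - T). f A)"
    using finT by (simp add: card_Pow)
  finally show ?thesis .
qed

text \<open>Let \<open>X\<close> be the number of \<open>i\<close> such that the uniform random set \<open>A\<close> avoids \<open>T i\<close>. The Harris inequality
  bounds the logarithmic derivative of the Laplace transform of \<open>X\<close>.\<close>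

lemma Janson_inequality_count:
  fixes T :: "'i \<Rightarrow> 'e set" and D :: real
  assumes E: "finite E" and I: "finite I" and T: "\<And>i. i \<in> I \<Longrightarrow> T i \<subseteq> E" "\<And>i. i \<in> I \<Longrightarrow> card (T i) = K"
    and D: "D > 0" "\<And>i. i \<in> I \<Longrightarrow> (\<Sum>j | j \<in> I \<and> T j \<inter> T i \<noteq> {}. 1 / 2 ^ card (T j - T i)) \<le> D"
  shows "real (card {A\<in>Pow E. \<forall>i\<in>I. A \<inter> T i \<noteq> {}}) \<le> 2 ^ card E * exp (- (real (card I) / 2 ^ K / (2 * D)))"
proof -
  define X where "X = (\<lambda>A. real (card {i\<in>I. A \<inter> T i = {}}))"
  define \<psi> where "\<psi> = (\<lambda>t. \<Sum>A\<in>Pow E. exp (- t * X A))"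
  define \<psi>' where "\<psi>' = (\<lambda>t. \<Sum>A\<in>Pow E. - X A * exp (- t * X A))"
  \<comment> \<open>\<open>\<mu>\<close> is the mean of \<open>X\<close>, while \<open>D\<close>
    bounds the expected number of avoided \<open>T j\<close> that meet \<open>T i\<close>, given
    that \<open>A\<close> avoids \<open>T i\<close>.\<close>
  define \<mu> where "\<mu> = real (card I) / 2 ^ K"
  \<comment> \<open>Integrating factor: the inequality
    \<open>\<psi>' t \<le> - \<mu> * exp (- t * D) * \<psi> t\<close> says precisely that the
    derivative of \<open>G\<close> is nonpositive.\<close>
  define G where "G = (\<lambda>t. \<psi> t * exp (\<mu> / D * (1 - exp (- t * D))))"
  have deriv\<psi>: "(\<psi> has_real_derivative \<psi>' t) (at t)" for t
    unfolding \<psi>_def \<psi>'_def by (auto intro!: derivative_eq_intros sum.cong)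
  \<comment> \<open>The contribution of \<open>i\<close> to \<open>- \<psi>' t\<close> is the sum
    over all \<open>A\<close> avoiding \<open>T i\<close>. There Harris decouples the
    \<open>T j\<close> that meet \<open>T i\<close>, counted by \<open>Y\<close>, from the rest,
    counted by \<open>Z\<close>: both exponentials increase with \<open>A\<close>.\<close>
  have bound: "(\<Sum>A\<in>Pow (E - T i). exp (- t * X A)) \<ge> exp (- t * D) * \<psi> t / 2 ^ K" if i: "i \<in> I" and t: "t \<ge> 0" for i t
  proof -
    define Y where "Y = (\<lambda>A. real (card {j\<in>I. T j \<inter> T i \<noteq> {} \<and> A \<inter> T j = {}}))"
    define Z where "Z = (\<lambda>A. real (card {j\<in>I. T j \<inter> T i = {} \<and> A \<inter> T j = {}}))"
    define F where "F = E - T i"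
    have finF: "finite F" using E by (simp add: F_def)
    have YZ: "X A = Y A + Z A" for A
    proof -
      have eq: "{j\<in>I. A \<inter> T j = {}} = {j\<in>I. T j \<inter> T i \<noteq> {} \<and> A \<inter> T j = {}} \<union> {j\<in>I. T j \<inter> T i = {} \<and> A \<inter> T j = {}}"
        by auto
      show ?thesis unfolding X_def Y_def Z_def eq using I
        by (subst card_Un_disjoint) auto
    qed
    have "Y B \<le> Y A" "Z B \<le> Z A" if "A \<subseteq> B" for A B
      unfolding Y_def Z_def using I that by (auto intro!: card_mono)
    then have Harris: "(\<Sum>A\<in>Pow F. exp (- t * Y A)) * (\<Sum>A\<in>Pow F. exp (- t * Z A)) \<le>
        2 ^ card F * (\<Sum>A\<in>Pow F. exp (- t * Y A) * exp (- t * Z A))"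
      using t by (intro Harris_inequality finF) (auto intro: mult_left_mono)
    have "(\<Sum>A\<in>Pow F. Y A) = (\<Sum>A\<in>Pow F. \<Sum>j | j \<in> I \<and> T j \<inter> T i \<noteq> {}. if A \<inter> T j = {} then 1 else 0)"
      unfolding Y_def using I by (intro sum.cong refl) (simp add: sum.inter_filter[symmetric] conj_assoc)
    also have "\<dots> = (\<Sum>j | j \<in> I \<and> T j \<inter> T i \<noteq> {}. real (card {A\<in>Pow F. A \<inter> T j = {}}))"
      using finF by (subst sum.swap) (simp add: sum.inter_filter[symmetric])
    also have "\<dots> = (\<Sum>j | j \<in> I \<and> T j \<inter> T i \<noteq> {}. 2 ^ card F * (1 / 2 ^ card (T j - T i)))"
    proof (intro sum.cong refl)
      fix j assume "j \<in> {j \<in> I. T j \<inter> T i \<noteq> {}}"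
      then have sub: "T j - T i \<subseteq> F" using T by (auto simp: F_def)
      have "card F = card (F - T j) + card (T j - T i)"
      proof -
        have "F = (F - T j) \<union> (T j - T i)" using sub by (auto simp: F_def)
        moreover have "(F - T j) \<inter> (T j - T i) = {}" by auto
        ultimately show ?thesis using card_Un_disjoint finF finite_subset[OF sub finF] by (metis finite_Diff)
      qed
      then show "real (card {A\<in>Pow F. A \<inter> T j = {}}) = 2 ^ card F * (1 / 2 ^ card (T j - T i))"
        unfolding card_subsets_avoiding[OF finF] by (simp add: power_add)
    qed
    also have "\<dots> \<le> 2 ^ card F * D"
      unfolding sum_distrib_left[symmetric] using D(2)[OF i] by simp
    finally have meanY: "(\<Sum>A\<in>Pow F. Y A) \<le> 2 ^ card F * D" .
    \<comment> \<open>Jensen's inequality for \<open>exp\<close>, carried out with the tangent at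
      \<open>D\<close>, the bound for the mean of \<open>Y\<close>.\<close>
    have "2 ^ card F \<le> 2 ^ card F * (1 + t * D) - t * (\<Sum>A\<in>Pow F. Y A)"
      using mult_left_mono[OF meanY t] by (simp add: algebra_simps)
    from mult_left_mono[OF this, of "exp (- t * D)"]
    have "2 ^ card F * exp (- t * D) \<le> exp (- t * D) * (2 ^ card F * (1 + t * D) - t * (\<Sum>A\<in>Pow F. Y A))"
      by (simp add: mult.commute)
    also have "\<dots> = (\<Sum>A\<in>Pow F. exp (- t * D) * (1 + t * D - t * Y A))"
      using finF by (simp add: sum_subtractf sum_distrib_left[symmetric] card_Pow)
    also have "\<dots> \<le> (\<Sum>A\<in>Pow F. exp (- t * Y A))"
    proof (rule sum_mono)
      fix A
      have "exp (- t * D) * (1 + (t * D - t * Y A)) \<le> exp (- t * D) * exp (t * D - t * Y A)"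
        by (intro mult_left_mono exp_ge_add_one_self) auto
      then show "exp (- t * D) * (1 + t * D - t * Y A) \<le> exp (- t * Y A)"
        by (simp add: mult_exp_exp algebra_simps)
    qed
    finally have Ysum: "2 ^ card F * exp (- t * D) \<le> (\<Sum>A\<in>Pow F. exp (- t * Y A))" .
    have "\<psi> t \<le> (\<Sum>A\<in>Pow E. exp (- t * Z A))"
      unfolding \<psi>_def using t YZ by (intro sum_mono) (simp add: Y_def mult_left_mono)
    also have "\<dots> = 2 ^ card (T i) * (\<Sum>A\<in>Pow F. exp (- t * Z A))"
      unfolding F_def
    proof (rule sum_Pow_ignoring[OF E T(1)[OF i]])
      fix A
      have "{j\<in>I. T j \<inter> T i = {} \<and> A \<inter> T j = {}} = {j\<in>I. T j \<inter> T i = {} \<and> (A - T i) \<inter> T j = {}}" by blast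
      then show "exp (- t * Z A) = exp (- t * Z (A - T i))" by (simp add: Z_def)
    qed
    finally have Zsum: "\<psi> t / 2 ^ K \<le> (\<Sum>A\<in>Pow F. exp (- t * Z A))"
      using T(2)[OF i] by (simp add: field_simps)
    have "\<psi> t \<ge> 0" unfolding \<psi>_def by (intro sum_nonneg) auto
    have "2 ^ card F * (exp (- t * D) * \<psi> t / 2 ^ K) = (2 ^ card F * exp (- t * D)) * (\<psi> t / 2 ^ K)" by simp
    also have "\<dots> \<le> (\<Sum>A\<in>Pow F. exp (- t * Y A)) * (\<Sum>A\<in>Pow F. exp (- t * Z A))"
      using Ysum Zsum \<open>\<psi> t \<ge> 0\<close> by (intro mult_mono) (auto intro: sum_nonneg)
    also have "\<dots> \<le> 2 ^ card F * (\<Sum>A\<in>Pow F. exp (- t * X A))"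
      using Harris by (simp add: YZ mult_exp_exp algebra_simps)
    finally show ?thesis unfolding F_def by (rule mult_left_le_imp_le) simp
  qed
  have \<psi>'_le: "\<psi>' t \<le> - \<mu> * exp (- t * D) * \<psi> t" if "t \<ge> 0" for t
  proof -
    have "\<mu> * exp (- t * D) * \<psi> t = (\<Sum>i\<in>I. exp (- t * D) * \<psi> t / 2 ^ K)"
      by (simp add: \<mu>_def)
    also have "\<dots> \<le> (\<Sum>i\<in>I. \<Sum>A\<in>Pow (E - T i). exp (- t * X A))"
      using bound that by (intro sum_mono) auto
    also have "\<dots> = (\<Sum>i\<in>I. \<Sum>A\<in>Pow E. if A \<inter> T i = {} then exp (- t * X A) else 0)"
    proof (rule sum.cong[OF refl])
      fix i
      have eq: "Pow (E - T i) = {A\<in>Pow E. A \<inter> T i = {}}" by auto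
      show "(\<Sum>A\<in>Pow (E - T i). exp (- t * X A)) = (\<Sum>A\<in>Pow E. if A \<inter> T i = {} then exp (- t * X A) else 0)"
        unfolding eq by (rule sum.inter_filter) (use E in simp)
    qed
    also have "\<dots> = (\<Sum>A\<in>Pow E. X A * exp (- t * X A))"
      using I by (subst sum.swap) (simp add: sum.inter_filter[symmetric] X_def)
    also have "\<dots> = - \<psi>' t" by (simp add: \<psi>'_def sum_negf)
    finally show ?thesis by simp
  qed
  have derivG: "(G has_real_derivative exp (\<mu> / D * (1 - exp (- t * D))) * (\<psi>' t + \<mu> * exp (- t * D) * \<psi> t)) (at t)" for t
    unfolding G_def using D(1) by (auto intro!: derivative_eq_intros deriv\<psi> simp: field_simps)
  \<comment> \<open>This value makes \<open>exp (- t * D)\<close> equal to \<open>1 / 2\<close> and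
    yields the exponent \<open>\<mu> / (2 * D)\<close>; letting \<open>t\<close> tend to infinity
    would improve it only by a factor 2.\<close>
  define t where "t = ln 2 / D"
  have "t > 0" using D(1) by (simp add: t_def)
  have "G t \<le> G 0"
  proof (rule DERIV_nonpos_imp_nonincreasing[of 0 t G])
    fix s assume "0 \<le> s" "s \<le> t"
    then have "\<psi>' s + \<mu> * exp (- s * D) * \<psi> s \<le> 0" using \<psi>'_le[of s] by simp
    then have "exp (\<mu> / D * (1 - exp (- s * D))) * (\<psi>' s + \<mu> * exp (- s * D) * \<psi> s) \<le> 0"
      by (simp add: mult_le_0_iff)
    then show "\<exists>y. (G has_real_derivative y) (at s) \<and> y \<le> 0" using derivG by blast
  qed (use \<open>t > 0\<close> in simp)
  moreover have "G 0 = 2 ^ card E" using E by (simp add: G_def \<psi>_def card_Pow)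
  moreover have "exp (- t * D) = 1 / 2" using D(1) by (simp add: t_def exp_minus)
  then have "G t = \<psi> t * exp (\<mu> / (2 * D))" unfolding G_def by (simp only:) simp
  ultimately have "\<psi> t * exp (\<mu> / (2 * D)) \<le> 2 ^ card E" by simp
  moreover have "real (card {A\<in>Pow E. \<forall>i\<in>I. A \<inter> T i \<noteq> {}}) \<le> \<psi> t"
  proof -
    have "real (card {A\<in>Pow E. \<forall>i\<in>I. A \<inter> T i \<noteq> {}}) = (\<Sum>A | A \<in> Pow E \<and> (\<forall>i\<in>I. A \<inter> T i \<noteq> {}). exp (- t * X A))"
    proof -
      have "exp (- t * X A) = 1" if "\<forall>i\<in>I. A \<inter> T i \<noteq> {}" for A
      proof -
        have "{i\<in>I. A \<inter> T i = {}} = {}" using that by auto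
        then show ?thesis unfolding X_def by (simp only: card.empty) simp
      qed
      then have "(\<Sum>A | A \<in> Pow E \<and> (\<forall>i\<in>I. A \<inter> T i \<noteq> {}). exp (- t * X A)) =
          (\<Sum>A | A \<in> Pow E \<and> (\<forall>i\<in>I. A \<inter> T i \<noteq> {}). 1)"
        by (intro sum.cong refl) blast
      then show ?thesis by simp
    qed
    also have "\<dots> \<le> \<psi> t" unfolding \<psi>_def using E by (intro sum_mono2) auto
    finally show ?thesis .
  qed
  ultimately have "real (card {A\<in>Pow E. \<forall>i\<in>I. A \<inter> T i \<noteq> {}}) * exp (\<mu> / (2 * D)) \<le> 2 ^ card E"
    by (meson exp_ge_zero mult_right_mono order_trans)
  then show ?thesis by (simp add: \<mu>_def exp_minus field_simps)
qed

subsection \<open>Independent sets\<close>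

definition pairs_in :: "nat \<Rightarrow> nat set \<Rightarrow> (nat \<times> nat) set" where
  "pairs_in n S = {(i, j) \<in> index_pairs n. i \<in> S \<and> j \<in> S}"

lemma finite_index_pairs [simp]: "finite (index_pairs n)"
  by (rule finite_subset[of _ "{1..n} \<times> {1..n}"]) (auto simp: index_pairs_def)

lemma finite_pairs_in [simp]: "finite (pairs_in n S)"
  by (rule finite_subset[of _ "index_pairs n"]) (auto simp: pairs_in_def)

lemma pairs_in_Int: "pairs_in n S \<inter> pairs_in n S' = pairs_in n (S \<inter> S')"
  by (auto simp: pairs_in_def)

lemma card_pairs_in:
  assumes "S \<subseteq> {1..n}"
  shows "card (pairs_in n S) = card S choose 2"
proof -
  have fin: "finite S" using assms finite_subset by blast
  have "bij_betw (\<lambda>(i, j). {i, j}) (pairs_in n S) {A. A \<subseteq> S \<and> card A = 2}"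
  proof (rule bij_betw_imageI)
    show "inj_on (\<lambda>(i, j). {i, j}) (pairs_in n S)"
      by (auto simp: inj_on_def pairs_in_def index_pairs_def doubleton_eq_iff)
    show "(\<lambda>(i, j). {i, j}) ` pairs_in n S = {A. A \<subseteq> S \<and> card A = 2}"
    proof (intro equalityI subsetI)
      fix A assume A: "A \<in> {A. A \<subseteq> S \<and> card A = 2}"
      then obtain i j where ij: "A = {i, j}" "i \<noteq> j" by (auto simp: card_2_iff)
      then have "A = {min i j, max i j}" "min i j < max i j" by (auto simp: min_def max_def)
      moreover have "(min i j, max i j) \<in> pairs_in n S"
      proof -
        have "i \<in> S" "j \<in> S" using A ij(1) by auto
        moreover from this have "1 \<le> i" "i \<le> n" "1 \<le> j" "j \<le> n" using assms by fastforce+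
        ultimately show ?thesis using ij(2) by (simp add: pairs_in_def index_pairs_def min_def max_def)
      qed
      ultimately show "A \<in> (\<lambda>(i, j). {i, j}) ` pairs_in n S" by (intro image_eqI[of _ _ "(min i j, max i j)"]) simp_all
    qed (auto simp: pairs_in_def index_pairs_def)
  qed
  then show ?thesis using n_subsets[OF fin, of 2] by (simp add: bij_betw_same_card)
qed

lemma card_index_pairs: "card (index_pairs n) = n choose 2"
proof -
  have "pairs_in n {1..n} = index_pairs n" by (auto simp: pairs_in_def index_pairs_def)
  then show ?thesis using card_pairs_in[of "{1..n}" n] by simp
qed

section \<open>Overlap counts for vertex sets of size k\<close>

lemma card_subsets_meeting_le:
  assumes "finite U" "S \<subseteq> U"
  shows "card {S'. S' \<subseteq> U \<and> card S' = k \<and> card (S \<inter> S') = j} \<le> (card S choose j) * ((card U - j) choose (k - j))"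
proof -
  have finS: "finite S" using assms finite_subset by blast
  define Js where "Js = {J. J \<subseteq> S \<and> card J = j}"
  \<comment> \<open>Only \<open>J\<close> is excluded, although the remaining vertices must avoid
    all of \<open>S\<close>. The overcount produces the binomial that \<open>choose_mult\<close>
    later relates to \<open>m choose k\<close>.\<close>
  define Rs where "Rs = (\<lambda>J. {R. R \<subseteq> U - J \<and> card R = k - j})"
  have "{S'. S' \<subseteq> U \<and> card S' = k \<and> card (S \<inter> S') = j} \<subseteq> (\<Union>J\<in>Js. (\<lambda>R. J \<union> R) ` Rs J)"
  proof
    fix S' assume "S' \<in> {S'. S' \<subseteq> U \<and> card S' = k \<and> card (S \<inter> S') = j}"
    then have S': "S' \<subseteq> U" "card S' = k" "card (S \<inter> S') = j" by auto
    have "card (S' - S \<inter> S') = k - j"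
      using S' finS by (subst card_Diff_subset) auto
    then have "S' - S \<inter> S' \<in> Rs (S \<inter> S')" using S' by (auto simp: Rs_def)
    moreover have "S \<inter> S' \<in> Js" using S' by (auto simp: Js_def)
    moreover have "S' = S \<inter> S' \<union> (S' - S \<inter> S')" by auto
    ultimately show "S' \<in> (\<Union>J\<in>Js. (\<lambda>R. J \<union> R) ` Rs J)" by blast
  qed
  moreover have finR: "finite (Rs J)" for J
    unfolding Rs_def using assms(1) by (rule_tac finite_subset[of _ "Pow U"]) auto
  moreover have finJ: "finite Js"
    unfolding Js_def using finS by (rule_tac finite_subset[of _ "Pow S"]) auto
  ultimately have "card {S'. S' \<subseteq> U \<and> card S' = k \<and> card (S \<inter> S') = j} \<le> card (\<Union>J\<in>Js. (\<lambda>R. J \<union> R) ` Rs J)"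
    by (intro card_mono) auto
  also have "\<dots> \<le> (\<Sum>J\<in>Js. card ((\<lambda>R. J \<union> R) ` Rs J))" by (rule card_UN_le[OF finJ])
  also have "\<dots> \<le> (\<Sum>J\<in>Js. (card U - j) choose (k - j))"
  proof (rule sum_mono)
    fix J assume "J \<in> Js"
    then have J: "J \<subseteq> U" "card J = j" using assms by (auto simp: Js_def)
    have "card ((\<lambda>R. J \<union> R) ` Rs J) \<le> card (Rs J)" by (rule card_image_le[OF finR])
    also have "\<dots> = card (U - J) choose (k - j)" unfolding Rs_def using assms(1) by (simp add: n_subsets)
    also have "card (U - J) = card U - j" using J assms(1) by (simp add: card_Diff_subset finite_subset)
    finally show "card ((\<lambda>R. J \<union> R) ` Rs J) \<le> (card U - j) choose (k - j)" .
  qed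
  also have "\<dots> = (card S choose j) * ((card U - j) choose (k - j))"
    unfolding Js_def using finS by (simp add: n_subsets)
  finally show ?thesis .
qed

text \<open>Only the bound 1 is wanted; the subtracted term closes the induction, because
  \<open>2 / fact (Suc k) \<le> 1 / fact k\<close>.\<close>

lemma sum_inverse_fact_le: "k \<ge> 2 \<Longrightarrow> (\<Sum>j=2..k. 1 / fact j :: real) \<le> 1 - 1 / fact k"
proof (induction k rule: nat_induct_at_least)
  case base
  then show ?case by (simp add: fact_numeral)
next
  case (Suc k)
  have "2 * (1 / fact (Suc k)) \<le> (1 / fact k :: real)"
  proof -
    have "2 * fact k \<le> real (Suc k) * fact k" using Suc(1) by (intro mult_right_mono) auto
    then have "2 * fact k \<le> (fact (Suc k) :: real)" by simp
    then show ?thesis by (simp add: field_simps del: fact_Suc)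
  qed
  then show ?case using Suc by simp
qed

text \<open>The ratio of the binomials is a product of factors
  \<open>(k - i) / (m - i) \<le> k / m\<close>, written without division.\<close>

lemma binomial_ratio_le:
  assumes "j \<le> k" "k \<le> m"
  shows "real (k choose j) * real m ^ j \<le> real (m choose j) * real k ^ j"
  using assms(1)
proof (induction j)
  case (Suc j)
  have step: "real (Suc j) * real (l choose Suc j) = real (l - j) * real (l choose j)" if "j \<le> l" for l
  proof -
    have "Suc j * (l choose Suc j) = (l - j) * (l choose j)"
      using binomial_absorption[of j l] binomial_absorb_comp[of l j] that
      by (cases l) (auto simp: algebra_simps)
    then show ?thesis by (metis of_nat_mult)
  qed
  have "real (k - j) * real m \<le> real (m - j) * real k"
  proof -
    have "real (k - j) * real m = real k * real m - real j * real m" using Suc by (simp add: of_nat_diff algebra_simps)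
    also have "\<dots> \<le> real k * real m - real j * real k" using assms(2) by (simp add: mult_left_mono)
    also have "\<dots> = real (m - j) * real k" using Suc assms by (simp add: of_nat_diff algebra_simps)
    finally show ?thesis .
  qed
  then have le: "(real (k - j) * real m) * (real (k choose j) * real m ^ j) \<le> (real (m - j) * real k) * (real (m choose j) * real k ^ j)"
    by (rule mult_mono) (use Suc in auto)
  then have "real (Suc j) * real (k choose Suc j) * real m ^ Suc j \<le> real (Suc j) * real (m choose Suc j) * real k ^ Suc j"
  proof -
    have eq: "real (Suc j) * real (l choose Suc j) * z ^ Suc j = (real (l - j) * z) * (real (l choose j) * z ^ j)"
      if "j \<le> l" for l and z :: real
      unfolding step[OF that] power_Suc by (simp only: mult_ac)
    have "j \<le> k" "j \<le> m" using Suc(2) assms(2) by auto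
    then show ?thesis unfolding eq[OF \<open>j \<le> k\<close>] eq[OF \<open>j \<le> m\<close>] by (intro le)
  qed
  then show ?case by (simp add: mult.assoc del: of_nat_Suc binomial_Suc_Suc power_Suc)
qed simp

text \<open>With \<open>r = k^2 / m\<close>, the term \<open>j\<close> divided by
  \<open>m choose k\<close> is at most \<open>r ^ j * 2 ^ (j choose 2) / fact j\<close>. The second
  hypothesis says \<open>r\<^sup>2 * 2 ^ (k + 1) \<le> 1\<close>; it bounds the factor before
  \<open>1 / fact j\<close> by \<open>2 * r\<^sup>2\<close>, its value at \<open>j = 2\<close>, and
  the inverse factorials sum to at most 1. So overlaps in a single pair dominate.\<close>

lemma overlap_sum_le:
  assumes k: "k \<ge> 2" and m: "real k ^ 4 * 2 ^ (k + 1) \<le> real m ^ 2"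
  shows "(\<Sum>j=2..k. real (k choose j) * real ((m - j) choose (k - j)) * 2 ^ (j choose 2)) \<le>
    real (m choose k) * (2 * real k ^ 4 / real m ^ 2)"
proof -
  have "real k ^ 4 * 2 ^ (k + 1) \<ge> real k ^ 4 * 1"
    using one_le_power[of "2::real" "k + 1"] by (intro mult_left_mono) auto
  moreover have "real k ^ 4 \<ge> real k ^ 2" using k by (intro power_increasing) auto
  ultimately have "real k ^ 2 \<le> real m ^ 2" using m by linarith
  then have "k \<le> m" by simp
  then have "m > 0" using k by simp
  define r where "r = real k ^ 2 / real m"
  have "r > 0" using k \<open>m > 0\<close> by (simp add: r_def)
  have r2: "r\<^sup>2 * 2 ^ (k + 1) \<le> 1"
    using m \<open>m > 0\<close> by (simp add: r_def power_divide field_simps)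
  have h: "r ^ j * 2 ^ (j choose 2) \<le> 2 * r\<^sup>2" if j: "2 \<le> j" "j \<le> k" for j
  proof -
    obtain i where i: "j = i + 2" using j(1) by (metis add.commute le_iff_add)
    have "2 * (j choose 2) = j * (j - 1)"
    proof -
      have "even (j * (j - 1))" by (cases j) auto
      then show ?thesis by (simp add: choose_two)
    qed
    \<comment> \<open>Squaring removes the half in \<open>j choose 2\<close>; since
      \<open>j * (j - 1) = 2 + (j + 1) * (j - 2)\<close>, a power of
      \<open>r\<^sup>2 * 2 ^ (j + 1) \<le> 1\<close> splits off.\<close>
    then have "(r ^ j * 2 ^ (j choose 2))\<^sup>2 = r ^ (2 * j) * 2 ^ (j * (j - 1))"
      by (simp add: power_mult_distrib power_mult[symmetric] mult.commute)
    also have "r ^ (2 * j) = r ^ 4 * (r\<^sup>2) ^ i"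
    proof -
      have "2 * j = 4 + 2 * i" by (simp add: i)
      then show ?thesis by (simp only: power_add power_mult)
    qed
    also have "(2::real) ^ (j * (j - 1)) = 4 * (2 ^ (j + 1)) ^ i"
    proof -
      have "j * (j - 1) = 2 + (j + 1) * i" by (simp add: i algebra_simps)
      then show ?thesis by (simp only: power_add power_mult) simp
    qed
    also have "r ^ 4 * (r\<^sup>2) ^ i * (4 * (2 ^ (j + 1)) ^ i) = 4 * r ^ 4 * (r\<^sup>2 * 2 ^ (j + 1)) ^ i"
      by (simp only: power_mult_distrib mult_ac)
    also have "\<dots> \<le> 4 * r ^ 4 * 1"
    proof (intro mult_left_mono power_le_one)
      have "r\<^sup>2 * 2 ^ (j + 1) \<le> r\<^sup>2 * 2 ^ (k + 1)" using j by (intro mult_left_mono power_increasing) auto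
      then show "r\<^sup>2 * 2 ^ (j + 1) \<le> 1" using r2 by linarith
    qed auto
    also have "\<dots> = (2 * r\<^sup>2)\<^sup>2" by (simp add: power_mult_distrib power_mult[symmetric])
    finally show ?thesis by (rule power2_le_imp_le) simp
  qed
  have "(\<Sum>j=2..k. real (k choose j) * real ((m - j) choose (k - j)) * 2 ^ (j choose 2)) \<le>
    (\<Sum>j=2..k. real (m choose k) * (2 * r\<^sup>2) * (1 / fact j))"
  proof (rule sum_mono)
    fix j assume "j \<in> {2..k}"
    then have j: "2 \<le> j" "j \<le> k" by auto
    have mj: "real (m choose j) > 0" using j \<open>k \<le> m\<close> by simp
    have "real (m choose k) * real (k choose j) = real (m choose j) * real ((m - j) choose (k - j))"
      using choose_mult[OF j(2) \<open>k \<le> m\<close>] by (metis of_nat_mult)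
    then have "real ((m - j) choose (k - j)) = real (m choose k) * (real (k choose j) / real (m choose j))"
      using mj by (simp add: field_simps)
    also have "\<dots> \<le> real (m choose k) * (real k ^ j / real m ^ j)"
      using binomial_ratio_le[OF j(2) \<open>k \<le> m\<close>] mj \<open>m > 0\<close> by (intro mult_left_mono) (simp_all add: field_simps)
    finally have 1: "real ((m - j) choose (k - j)) \<le> real (m choose k) * (real k ^ j / real m ^ j)" .
    have "(k choose j) * fact j \<le> k ^ j" by (rule binomial_fact_pow)
    then have "real (k choose j) * fact j \<le> real k ^ j" by (metis of_nat_fact of_nat_le_iff of_nat_mult of_nat_power)
    then have 2: "real (k choose j) \<le> real k ^ j * (1 / fact j)" by (simp add: field_simps)
    have "real (k choose j) * real ((m - j) choose (k - j)) * 2 ^ (j choose 2) \<le>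
      (real k ^ j * (1 / fact j)) * (real (m choose k) * (real k ^ j / real m ^ j)) * 2 ^ (j choose 2)"
      using 1 2 by (intro mult_right_mono mult_mono) auto
    also have "\<dots> = real (m choose k) * (1 / fact j) * (r ^ j * 2 ^ (j choose 2))"
      by (simp add: r_def power_divide power_mult[symmetric] power_mult_distrib[symmetric] power2_eq_square)
    also have "\<dots> \<le> real (m choose k) * (1 / fact j) * (2 * r\<^sup>2)"
      using h[OF j] by (intro mult_left_mono) auto
    finally show "real (k choose j) * real ((m - j) choose (k - j)) * 2 ^ (j choose 2) \<le>
      real (m choose k) * (2 * r\<^sup>2) * (1 / fact j)" by (simp add: mult_ac)
  qed
  also have "\<dots> = real (m choose k) * (2 * r\<^sup>2) * (\<Sum>j=2..k. 1 / fact j)" by (simp only: sum_distrib_left)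
  also have "\<dots> \<le> real (m choose k) * (2 * r\<^sup>2) * 1"
  proof (intro mult_left_mono)
    have "(0::real) \<le> 1 / fact k" by simp
    then show "(\<Sum>j=2..k. 1 / fact j :: real) \<le> 1" using sum_inverse_fact_le[OF k] by linarith
  qed simp
  finally show ?thesis by (simp add: r_def power_divide power_mult[symmetric])
qed

definition independent_in :: "(nat \<times> nat) set \<Rightarrow> nat set \<Rightarrow> bool" where
  "independent_in \<sigma> S \<longleftrightarrow> (\<forall>(i, j)\<in>\<sigma>. \<not> (i \<in> S \<and> j \<in> S))"

text \<open>Janson's inequality indexed by the \<open>k\<close>-subsets of \<open>U\<close>, each
  with the set of its pairs. The mean is \<open>(m choose k) / 2 ^ (k choose 2)\<close> and
  \<open>D\<close> is \<open>2 * k^4 / m^2\<close> times the mean, so the exponent is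
  \<open>m^2 / (4 * k^4)\<close>.\<close>

lemma card_no_independent_set_le:
  assumes U: "U \<subseteq> {1..n}" "card U = m" and k: "k \<ge> 2" and m: "real k ^ 4 * 2 ^ (k + 1) \<le> real m ^ 2"
  shows "real (card {\<sigma>\<in>Pow (index_pairs n). \<forall>S. S \<subseteq> U \<and> card S = k \<longrightarrow> \<not> independent_in \<sigma> S}) \<le>
    2 ^ card (index_pairs n) * exp (- (real m ^ 2 / (4 * real k ^ 4)))"
proof -
  have finU: "finite U" using U finite_subset by blast
  have "real k ^ 4 * 2 ^ (k + 1) \<ge> real k ^ 4 * 1"
    using one_le_power[of "2::real" "k + 1"] by (intro mult_left_mono) auto
  moreover have "real k ^ 4 \<ge> real k ^ 2" using k by (intro power_increasing) auto
  ultimately have "real k ^ 2 \<le> real m ^ 2" using m by linarith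
  then have "k \<le> m" by simp
  then have "m > 0" using k by simp
  define K where "K = k choose 2"
  define Is where "Is = {S. S \<subseteq> U \<and> card S = k}"
  define D where "D = real (m choose k) * (2 * real k ^ 4 / real m ^ 2) / 2 ^ K"
  have "D > 0" using \<open>k \<le> m\<close> \<open>m > 0\<close> k by (simp add: D_def)
  have finI: "finite Is" unfolding Is_def using finU by (rule_tac finite_subset[of _ "Pow U"]) auto
  have T: "pairs_in n S \<subseteq> index_pairs n" for S by (auto simp: pairs_in_def)
  have cardT: "card (pairs_in n S) = K" if "S \<in> Is" for S
    using that U by (subst card_pairs_in) (auto simp: Is_def K_def)
  have Dle: "(\<Sum>S' | S' \<in> Is \<and> pairs_in n S' \<inter> pairs_in n S \<noteq> {}. 1 / 2 ^ card (pairs_in n S' - pairs_in n S)) \<le> D"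
    if S: "S \<in> Is" for S
  proof -
    have SU: "S \<subseteq> U" "card S = k" "finite S" using S finU finite_subset by (auto simp: Is_def)
    have cardint: "card (pairs_in n S' \<inter> pairs_in n S) = card (S \<inter> S') choose 2" if "S' \<in> Is" for S'
      unfolding pairs_in_Int using U SU by (subst card_pairs_in) (auto simp: Int_commute)
    have eq: "1 / 2 ^ card (pairs_in n S' - pairs_in n S) = 2 ^ (card (S \<inter> S') choose 2) / (2 ^ K :: real)" if "S' \<in> Is" for S'
    proof -
      have "card (pairs_in n S') = card (pairs_in n S' - pairs_in n S) + card (pairs_in n S' \<inter> pairs_in n S)"
        by (metis Int_Diff_Un Int_Diff_disjoint add.commute card_Un_disjoint finite_Diff finite_Int finite_pairs_in)
      then have "K = card (pairs_in n S' - pairs_in n S) + (card (S \<inter> S') choose 2)"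
        using cardT[OF that] cardint[OF that] by simp
      then show ?thesis by (simp add: power_add)
    qed
    have "(\<Sum>S' | S' \<in> Is \<and> pairs_in n S' \<inter> pairs_in n S \<noteq> {}. 1 / 2 ^ card (pairs_in n S' - pairs_in n S)) =
      (\<Sum>S' | S' \<in> Is \<and> pairs_in n S' \<inter> pairs_in n S \<noteq> {}. 2 ^ (card (S \<inter> S') choose 2) / (2 ^ K :: real))"
      using eq by (intro sum.cong) auto
    \<comment> \<open>Sharing a pair means sharing at least two vertices, so the sum is organized by
      the overlap \<open>j\<close> from 2 to \<open>k\<close>; the value \<open>j = k\<close> is
      \<open>S\<close> itself.\<close>
    also have "\<dots> \<le> (\<Sum>S'\<in>(\<Union>j\<in>{2..k}. {S'. S' \<subseteq> U \<and> card S' = k \<and> card (S \<inter> S') = j}). 2 ^ (card (S \<inter> S') choose 2) / (2 ^ K :: real))"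
    proof (rule sum_mono2)
      show "finite (\<Union>j\<in>{2..k}. {S'. S' \<subseteq> U \<and> card S' = k \<and> card (S \<inter> S') = j})"
        using finU by (rule_tac finite_subset[of _ "Pow U"]) auto
      show "{S' \<in> Is. pairs_in n S' \<inter> pairs_in n S \<noteq> {}} \<subseteq> (\<Union>j\<in>{2..k}. {S'. S' \<subseteq> U \<and> card S' = k \<and> card (S \<inter> S') = j})"
      proof
        fix S' assume "S' \<in> {S' \<in> Is. pairs_in n S' \<inter> pairs_in n S \<noteq> {}}"
        then have S': "S' \<in> Is" "pairs_in n S' \<inter> pairs_in n S \<noteq> {}" by auto
        then have "card (pairs_in n S' \<inter> pairs_in n S) \<noteq> 0" by auto
        then have "card (S \<inter> S') \<ge> 2" using cardint[OF S'(1)] by (metis binomial_eq_0 not_le)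
        moreover have "card (S \<inter> S') \<le> k" using SU by (metis card_mono inf_le1)
        ultimately show "S' \<in> (\<Union>j\<in>{2..k}. {S'. S' \<subseteq> U \<and> card S' = k \<and> card (S \<inter> S') = j})"
          using S'(1) by (auto simp: Is_def)
      qed
    qed auto
    also have "\<dots> = (\<Sum>j=2..k. \<Sum>S' | S' \<subseteq> U \<and> card S' = k \<and> card (S \<inter> S') = j. 2 ^ (card (S \<inter> S') choose 2) / (2 ^ K :: real))"
      using finU by (subst sum.UNION_disjoint) (auto intro: finite_subset[of _ "Pow U"])
    also have "\<dots> = (\<Sum>j=2..k. real (card {S'. S' \<subseteq> U \<and> card S' = k \<and> card (S \<inter> S') = j}) * (2 ^ (j choose 2) / 2 ^ K))"
      by (intro sum.cong) auto
    also have "\<dots> \<le> (\<Sum>j=2..k. (real (k choose j) * real ((m - j) choose (k - j))) * (2 ^ (j choose 2) / 2 ^ K))"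
    proof (intro sum_mono mult_right_mono)
      fix j
      show "real (card {S'. S' \<subseteq> U \<and> card S' = k \<and> card (S \<inter> S') = j}) \<le> real (k choose j) * real ((m - j) choose (k - j))"
        using card_subsets_meeting_le[OF finU SU(1), of k j] unfolding SU(2) U(2) of_nat_mult[symmetric] of_nat_le_iff .
    qed auto
    also have "\<dots> = (\<Sum>j=2..k. real (k choose j) * real ((m - j) choose (k - j)) * 2 ^ (j choose 2)) / 2 ^ K"
      by (simp add: sum_divide_distrib)
    also have "\<dots> \<le> D" unfolding D_def by (intro divide_right_mono overlap_sum_le k m) auto
    finally show ?thesis .
  qed
  have "{\<sigma>\<in>Pow (index_pairs n). \<forall>S. S \<subseteq> U \<and> card S = k \<longrightarrow> \<not> independent_in \<sigma> S} =
    {\<sigma>\<in>Pow (index_pairs n). \<forall>S\<in>Is. \<sigma> \<inter> pairs_in n S \<noteq> {}}"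
    by (auto simp: Is_def independent_in_def pairs_in_def) blast+
  also have "real (card \<dots>) \<le> 2 ^ card (index_pairs n) * exp (- (real (card Is) / 2 ^ K / (2 * D)))"
    by (rule Janson_inequality_count) (use finI T cardT \<open>D > 0\<close> Dle in auto)
  also have "real (card Is) / 2 ^ K / (2 * D) = real m ^ 2 / (4 * real k ^ 4)"
  proof -
    have "card Is = m choose k" using n_subsets[OF finU, of k] U(2) by (simp add: Is_def)
    moreover have "real (m choose k) > 0" using \<open>k \<le> m\<close> by simp
    ultimately show ?thesis using \<open>m > 0\<close> k by (simp add: D_def field_simps)
  qed
  finally show ?thesis .
qed

subsection \<open>Chromatic numbers of patterns\<close>

definition pattern_edges :: "(nat \<times> nat) set \<Rightarrow> nat set set" where
  "pattern_edges \<sigma> = {{i, j} | i j. (i, j) \<in> \<sigma>}"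

definition pattern_chromatic_number :: "nat \<Rightarrow> (nat \<times> nat) set \<Rightarrow> nat" where
  "pattern_chromatic_number n \<sigma> = chromatic_number {1..n} (pattern_edges \<sigma>)"

lemma \<chi>\<Gamma>_pattern:
  "\<chi>\<Gamma> n d x s = pattern_chromatic_number n {e \<in> index_pairs n. vec_inner d (x e) s \<ge> 0}"
  unfolding \<chi>\<Gamma>_def pattern_chromatic_number_def \<Gamma>_edges_def pattern_edges_def by simp

lemma proper_colouring_pattern_iff:
  assumes "\<sigma> \<subseteq> index_pairs n"
  shows "proper_colouring {1..n} (pattern_edges \<sigma>) k c \<longleftrightarrow> c ` {1..n} \<subseteq> {..<k} \<and> (\<forall>(i, j)\<in>\<sigma>. c i \<noteq> c j)"
proof
  assume *: "proper_colouring {1..n} (pattern_edges \<sigma>) k c"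
  have "c i \<noteq> c j" if "(i, j) \<in> \<sigma>" for i j
  proof -
    have "i \<in> {1..n}" "j \<in> {1..n}" using that assms by (auto simp: index_pairs_def)
    moreover have "{i, j} \<in> pattern_edges \<sigma>" using that by (auto simp: pattern_edges_def)
    ultimately show ?thesis using * unfolding proper_colouring_def by blast
  qed
  then show "c ` {1..n} \<subseteq> {..<k} \<and> (\<forall>(i, j)\<in>\<sigma>. c i \<noteq> c j)"
    using * by (auto simp: proper_colouring_def)
next
  assume *: "c ` {1..n} \<subseteq> {..<k} \<and> (\<forall>(i, j)\<in>\<sigma>. c i \<noteq> c j)"
  have "c u \<noteq> c v" if "{u, v} \<in> pattern_edges \<sigma>" for u v
  proof -
    obtain i j where "(i, j) \<in> \<sigma>" "{u, v} = {i, j}" using \<open>{u, v} \<in> pattern_edges \<sigma>\<close> by (auto simp: pattern_edges_def)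
    then show ?thesis using * by (auto simp: doubleton_eq_iff)
  qed
  then show "proper_colouring {1..n} (pattern_edges \<sigma>) k c"
    using * by (auto simp: proper_colouring_def)
qed

lemma pattern_chromatic_number_le:
  assumes "\<sigma> \<subseteq> index_pairs n" "c ` {1..n} \<subseteq> {..<k}" "\<And>i j. (i, j) \<in> \<sigma> \<Longrightarrow> c i \<noteq> c j"
  shows "pattern_chromatic_number n \<sigma> \<le> k"
proof -
  have "proper_colouring {1..n} (pattern_edges \<sigma>) k c"
    unfolding proper_colouring_pattern_iff[OF assms(1)] using assms(2,3) by blast
  then show ?thesis
    unfolding pattern_chromatic_number_def chromatic_number_def by (intro Least_le exI)
qed

lemma pattern_colouring_exists:
  assumes "\<sigma> \<subseteq> index_pairs n" "pattern_chromatic_number n \<sigma> \<le> k"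
  obtains c where "c ` {1..n} \<subseteq> {..<k}" "\<And>i j. (i, j) \<in> \<sigma> \<Longrightarrow> c i \<noteq> c j"
proof -
  have "proper_colouring {1..n} (pattern_edges \<sigma>) n (\<lambda>i. i - 1)"
    unfolding proper_colouring_pattern_iff[OF assms(1)] using assms(1) by (auto simp: index_pairs_def)
  then have "\<exists>c. proper_colouring {1..n} (pattern_edges \<sigma>) (pattern_chromatic_number n \<sigma>) c"
    unfolding pattern_chromatic_number_def chromatic_number_def
    using LeastI[of "\<lambda>k. \<exists>c. proper_colouring {1..n} (pattern_edges \<sigma>) k c" n] by blast
  then obtain c where c: "c ` {1..n} \<subseteq> {..<pattern_chromatic_number n \<sigma>}" "\<forall>(i, j)\<in>\<sigma>. c i \<noteq> c j"
    unfolding proper_colouring_pattern_iff[OF assms(1)] by blast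
  show thesis by (rule that[of c]) (use c assms(2) in auto)
qed

text \<open>Cauchy-Schwarz on the class sizes: balanced classes minimize the number of pairs inside
  classes.\<close>

lemma card_monochromatic_pairs_ge:
  assumes c: "c ` {1..n} \<subseteq> {..<k}" and k: "k \<ge> 1"
  shows "real n * (real n / real k - 1) / 2 \<le> real (card {(i, j)\<in>index_pairs n. c i = c j})"
proof -
  define V where "V = (\<lambda>a. {i\<in>{1..n}. c i = a})"
  have eq: "{(i, j)\<in>index_pairs n. c i = c j} = (\<Union>a<k. pairs_in n (V a))"
    using c by (auto simp: pairs_in_def V_def index_pairs_def image_subset_iff)
  have "card {(i, j)\<in>index_pairs n. c i = c j} = (\<Sum>a<k. card (pairs_in n (V a)))"
    unfolding eq by (rule card_UN_disjoint) (simp, simp, auto simp: pairs_in_def V_def)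
  also have "\<dots> = (\<Sum>a<k. card (V a) choose 2)"
    by (intro sum.cong card_pairs_in) (auto simp: V_def)
  finally have "real (card {(i, j)\<in>index_pairs n. c i = c j}) = (\<Sum>a<k. real (card (V a) choose 2))" by simp
  also have "\<dots> = (\<Sum>a<k. ((real (card (V a)))\<^sup>2 - real (card (V a))) / 2)"
  proof (intro sum.cong refl)
    fix a
    have "even (card (V a) * (card (V a) - 1))" by (cases "card (V a)") auto
    then have "2 * (card (V a) choose 2) = card (V a) * (card (V a) - 1)" by (simp add: choose_two)
    then have "2 * real (card (V a) choose 2) = real (card (V a) * (card (V a) - 1))" by (metis of_nat_mult of_nat_numeral)
    also have "\<dots> = (real (card (V a)))\<^sup>2 - real (card (V a))"
      by (cases "card (V a)") (auto simp: power2_eq_square algebra_simps)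
    finally show "real (card (V a) choose 2) = ((real (card (V a)))\<^sup>2 - real (card (V a))) / 2" by simp
  qed
  also have "\<dots> = ((\<Sum>a<k. (real (card (V a)))\<^sup>2) - (\<Sum>a<k. real (card (V a)))) / 2"
    by (simp add: sum_divide_distrib[symmetric] sum_subtractf)
  also have "(\<Sum>a<k. real (card (V a))) = real n"
  proof -
    have "{1..n} = (\<Union>a<k. V a)" using c by (auto simp: V_def)
    then have "card {1..n} = card (\<Union>a<k. V a)" by simp
    also have "\<dots> = (\<Sum>a<k. card (V a))" by (rule card_UN_disjoint) (auto simp: V_def)
    finally show ?thesis by simp
  qed
  finally have eq2: "real (card {(i, j)\<in>index_pairs n. c i = c j}) = ((\<Sum>a<k. (real (card (V a)))\<^sup>2) - real n) / 2"
    and sumV: "(\<Sum>a<k. real (card (V a))) = real n" using \<open>(\<Sum>a<k. real (card (V a))) = real n\<close> by auto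
  have "(\<Sum>a<k. real (card (V a)))\<^sup>2 \<le> (\<Sum>a<k. (real (card (V a)))\<^sup>2) * real (card {..<k})"
    by (rule sum_squared_le_sum_of_squares)
  then have "(real n)\<^sup>2 / real k \<le> (\<Sum>a<k. (real (card (V a)))\<^sup>2)"
    using k by (simp add: sumV field_simps)
  then have "((real n)\<^sup>2 / real k - real n) / 2 \<le> ((\<Sum>a<k. (real (card (V a)))\<^sup>2) - real n) / 2"
    by (intro divide_right_mono diff_right_mono) auto
  moreover have "real n * (real n / real k - 1) / 2 = ((real n)\<^sup>2 / real k - real n) / 2"
    by (simp add: power2_eq_square right_diff_distrib)
  ultimately show ?thesis unfolding eq2 by (simp only:)
qed

text \<open>First moment over the \<open>k ^ n\<close> colourings: a pattern properly coloured by
  \<open>c\<close> omits all monochromatic pairs of \<open>c\<close>, and there are many of them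
  whatever \<open>c\<close> is.\<close>

lemma card_small_chromatic_number_le:
  assumes k: "k \<ge> 1"
  shows "real (card {\<sigma>\<in>Pow (index_pairs n). pattern_chromatic_number n \<sigma> \<le> k}) \<le>
    real k ^ n * 2 ^ card (index_pairs n) * 2 powr (- (real n * (real n / real k - 1) / 2))"
proof -
  define E where "E = index_pairs n"
  define C where "C = PiE {1..n} (\<lambda>_. {..<k})"
  define mono where "mono = (\<lambda>c :: nat \<Rightarrow> nat. {(i, j)\<in>E. c i = c j})"
  have finE: "finite E" by (simp add: E_def)
  have "finite C" unfolding C_def by (intro finite_PiE) auto
  have "{\<sigma>\<in>Pow E. pattern_chromatic_number n \<sigma> \<le> k} \<subseteq> (\<Union>c\<in>C. Pow (E - mono c))"
  proof
    fix \<sigma> assume "\<sigma> \<in> {\<sigma>\<in>Pow E. pattern_chromatic_number n \<sigma> \<le> k}"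
    then have \<sigma>: "\<sigma> \<subseteq> index_pairs n" "pattern_chromatic_number n \<sigma> \<le> k" by (auto simp: E_def)
    obtain c where c: "c ` {1..n} \<subseteq> {..<k}" "\<And>i j. (i, j) \<in> \<sigma> \<Longrightarrow> c i \<noteq> c j"
      using pattern_colouring_exists[OF \<sigma>] by blast
    have "restrict c {1..n} \<in> C" using c(1) by (auto simp: C_def)
    moreover have "\<sigma> \<subseteq> E - mono (restrict c {1..n})"
    proof
      fix e assume e: "e \<in> \<sigma>"
      obtain i j where ij: "e = (i, j)" by (cases e)
      then have "i \<in> {1..n}" "j \<in> {1..n}" "e \<in> E" using e \<sigma>(1) by (auto simp: index_pairs_def E_def)
      then show "e \<in> E - mono (restrict c {1..n})" using c(2)[of i j] e ij by (auto simp: mono_def)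
    qed
    ultimately show "\<sigma> \<in> (\<Union>c\<in>C. Pow (E - mono c))" by blast
  qed
  then have "card {\<sigma>\<in>Pow E. pattern_chromatic_number n \<sigma> \<le> k} \<le> card (\<Union>c\<in>C. Pow (E - mono c))"
    using \<open>finite C\<close> finE by (intro card_mono) auto
  also have "\<dots> \<le> (\<Sum>c\<in>C. card (Pow (E - mono c)))" by (rule card_UN_le[OF \<open>finite C\<close>])
  also have "\<dots> = (\<Sum>c\<in>C. 2 ^ card (E - mono c))" using finE by (simp add: card_Pow)
  finally have "real (card {\<sigma>\<in>Pow E. pattern_chromatic_number n \<sigma> \<le> k}) \<le> real (\<Sum>c\<in>C. 2 ^ card (E - mono c))"
    by (simp only: of_nat_le_iff)
  also have "\<dots> = (\<Sum>c\<in>C. 2 ^ card (E - mono c))" by simp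
  also have "\<dots> \<le> (\<Sum>c\<in>C. 2 ^ card E * 2 powr (- (real n * (real n / real k - 1) / 2)))"
  proof (rule sum_mono)
    fix c assume "c \<in> C"
    then have "c ` {1..n} \<subseteq> {..<k}" by (auto simp: C_def)
    from card_monochromatic_pairs_ge[OF this k]
    have ge: "real n * (real n / real k - 1) / 2 \<le> real (card (mono c))" by (simp add: mono_def E_def)
    have sub: "mono c \<subseteq> E" by (auto simp: mono_def)
    have "card (E - mono c) = card E - card (mono c)"
      using sub finE finite_subset by (intro card_Diff_subset) auto
    then have "real (card (E - mono c)) = real (card E) - real (card (mono c))"
      using card_mono[OF finE sub] by simp
    then have "(2::real) ^ card (E - mono c) = 2 powr (real (card E) - real (card (mono c)))"
      by (simp add: powr_realpow[symmetric])
    also have "\<dots> \<le> 2 powr (real (card E) + (- (real n * (real n / real k - 1) / 2)))"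
      using ge by simp
    also have "\<dots> = 2 ^ card E * 2 powr (- (real n * (real n / real k - 1) / 2))"
      unfolding powr_add by (simp add: powr_realpow)
    finally show "(2::real) ^ card (E - mono c) \<le> 2 ^ card E * 2 powr (- (real n * (real n / real k - 1) / 2))" .
  qed
  also have "\<dots> = real k ^ n * 2 ^ card E * 2 powr (- (real n * (real n / real k - 1) / 2))"
    by (simp add: C_def card_PiE)
  finally show ?thesis by (simp add: E_def)
qed

section \<open>Greedy colouring by independent sets\<close>

lemma greedy_partial_colouring:
  assumes "finite W" "k \<ge> 1"
    and "\<forall>U. U \<subseteq> W \<and> card U = u \<longrightarrow> (\<exists>S. S \<subseteq> U \<and> card S = k \<and> independent_in \<sigma> S)"
    and "u \<ge> 1"
  shows "\<exists>L q c. L \<subseteq> W \<and> card L < u \<and> q * k \<le> card W \<and> c ` (W - L) \<subseteq> {..<q} \<and>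
    (\<forall>(i, j)\<in>\<sigma>. i \<in> W - L \<longrightarrow> j \<in> W - L \<longrightarrow> c i \<noteq> (c j :: nat))"
  using assms(1,3)
proof (induction W rule: finite_psubset_induct)
  case (psubset W)
  show ?case
  \<comment> \<open>Below \<open>u\<close> vertices nothing is guaranteed, so everything left goes
    into \<open>L\<close>; otherwise an independent \<open>k\<close>-set is split off and receives
    the new colour \<open>q\<close>.\<close>
  proof (cases "card W < u")
    case True
    then show ?thesis by (intro exI[of _ W] exI[of _ 0]) auto
  next
    case False
    then obtain U where U: "U \<subseteq> W" "card U = u" using obtain_subset_with_card_n[of u W] by (metis not_less)
    obtain S where S: "S \<subseteq> U" "card S = k" "independent_in \<sigma> S" using psubset.prems U by blast
    have "S \<noteq> {}" "S \<subseteq> W" using S U assms(2) by auto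
    then have "W - S \<subset> W" by blast
    have prem: "\<forall>U. U \<subseteq> W - S \<and> card U = u \<longrightarrow> (\<exists>S. S \<subseteq> U \<and> card S = k \<and> independent_in \<sigma> S)"
      using psubset.prems by blast
    obtain L q c where L: "L \<subseteq> W - S" "card L < u" "q * k \<le> card (W - S)" "c ` (W - S - L) \<subseteq> {..<q}"
      "\<forall>(i, j)\<in>\<sigma>. i \<in> W - S - L \<longrightarrow> j \<in> W - S - L \<longrightarrow> c i \<noteq> (c j :: nat)"
      using psubset.IH[OF \<open>W - S \<subset> W\<close> prem] by blast
    have "card (W - S) = card W - k" "k \<le> card W"
      using S \<open>S \<subseteq> W\<close> psubset.hyps card_mono[OF _ \<open>S \<subseteq> W\<close>] by (auto simp: card_Diff_subset finite_subset)
    then have "Suc q * k \<le> card W" using L(3) by simp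
    define c' where "c' = (\<lambda>i. if i \<in> S then q else c i)"
    have "c' ` (W - L) \<subseteq> {..<Suc q}"
    proof
      fix y assume "y \<in> c' ` (W - L)"
      then obtain i where i: "i \<in> W - L" "y = c' i" by blast
      show "y \<in> {..<Suc q}"
      proof (cases "i \<in> S")
        case False
        then have "c i \<in> {..<q}" using i L(4) by blast
        then show ?thesis using i False by (simp add: c'_def)
      qed (use i in \<open>simp add: c'_def\<close>)
    qed
    moreover have "\<forall>(i, j)\<in>\<sigma>. i \<in> W - L \<longrightarrow> j \<in> W - L \<longrightarrow> c' i \<noteq> c' j"
    proof (intro ballI, clarify)
      fix i j assume ij: "(i, j) \<in> \<sigma>" "i \<in> W" "i \<notin> L" "j \<in> W" "j \<notin> L" and eq: "c' i = c' j"
      have less: "c l < q" if "l \<in> W" "l \<notin> L" "l \<notin> S" for l using L(4) that by blast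
      have "\<not> (i \<in> S \<and> j \<in> S)" using S(3) ij(1) by (auto simp: independent_in_def)
      moreover have "i \<in> S \<longleftrightarrow> j \<in> S" using eq less[of i] less[of j] ij by (auto simp: c'_def split: if_splits)
      ultimately have "i \<notin> S" "j \<notin> S" by auto
      then show False using L(5) ij eq by (auto simp: c'_def)
    qed
    ultimately show ?thesis using L(1,2) \<open>Suc q * k \<le> card W\<close>
      by (intro exI[of _ L] exI[of _ "Suc q"] exI[of _ c']) auto
  qed
qed

lemma chromatic_number_two_phase:
  assumes \<sigma>: "\<sigma> \<subseteq> index_pairs n" and k: "k1 \<ge> 1" "k2 \<ge> 1" and u: "u1 \<ge> 1" "u2 \<ge> 1"
    and 1: "\<And>U. U \<subseteq> {1..n} \<Longrightarrow> card U = u1 \<Longrightarrow> \<exists>S. S \<subseteq> U \<and> card S = k1 \<and> independent_in \<sigma> S"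
    and 2: "\<And>U. U \<subseteq> {1..n} \<Longrightarrow> card U = u2 \<Longrightarrow> \<exists>S. S \<subseteq> U \<and> card S = k2 \<and> independent_in \<sigma> S"
  shows "real (pattern_chromatic_number n \<sigma>) \<le> real n / real k1 + real u1 / real k2 + real u2"
proof -
  have prem1: "\<forall>U. U \<subseteq> {1..n} \<and> card U = u1 \<longrightarrow> (\<exists>S. S \<subseteq> U \<and> card S = k1 \<and> independent_in \<sigma> S)"
    using 1 by blast
  obtain L1 q1 c1 where L1: "L1 \<subseteq> {1..n}" "card L1 < u1" "q1 * k1 \<le> card {1..n}" "c1 ` ({1..n} - L1) \<subseteq> {..<q1}"
    "\<forall>(i, j)\<in>\<sigma>. i \<in> {1..n} - L1 \<longrightarrow> j \<in> {1..n} - L1 \<longrightarrow> c1 i \<noteq> (c1 j :: nat)"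
    using greedy_partial_colouring[OF finite_atLeastAtMost k(1) prem1 u(1)]
    by (elim exE conjE) (rule that; assumption)
  have fin: "finite L1" using L1(1) finite_subset by blast
  have prem2: "\<forall>U. U \<subseteq> L1 \<and> card U = u2 \<longrightarrow> (\<exists>S. S \<subseteq> U \<and> card S = k2 \<and> independent_in \<sigma> S)"
  proof (intro allI impI)
    fix U assume "U \<subseteq> L1 \<and> card U = u2"
    then have "U \<subseteq> {1..n}" "card U = u2" using L1(1) by blast+
    then show "\<exists>S. S \<subseteq> U \<and> card S = k2 \<and> independent_in \<sigma> S" by (rule 2)
  qed
  obtain L2 q2 c2 where L2: "L2 \<subseteq> L1" "card L2 < u2" "q2 * k2 \<le> card L1" "c2 ` (L1 - L2) \<subseteq> {..<q2}"
    "\<forall>(i, j)\<in>\<sigma>. i \<in> L1 - L2 \<longrightarrow> j \<in> L1 - L2 \<longrightarrow> c2 i \<noteq> (c2 j :: nat)"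
    using greedy_partial_colouring[OF fin k(2) prem2 u(2)] by (elim exE conjE) (rule that; assumption)
  have "finite L2" using L2(1) fin finite_subset by blast
  then obtain b where b: "bij_betw b L2 {..<card L2}" using ex_bij_betw_finite_nat by (metis atLeast0LessThan)
  \<comment> \<open>Three disjoint palettes: \<open>q1\<close> colours for the first phase, the next
    \<open>q2\<close> for the second, and a private colour for each of the fewer than
    \<open>u2\<close> vertices that remain.\<close>
  define c where "c = (\<lambda>i. if i \<in> L2 then q1 + q2 + b i else if i \<in> L1 then q1 + c2 i else c1 i)"
  have less1: "c1 i < q1" if "i \<in> {1..n}" "i \<notin> L1" for i using L1(4) that by blast
  have less2: "c2 i < q2" if "i \<in> L1" "i \<notin> L2" for i using L2(4) that by blast
  have lessb: "b i < card L2" if "i \<in> L2" for i using b that by (auto simp: bij_betw_def)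
  have "pattern_chromatic_number n \<sigma> \<le> q1 + q2 + card L2"
  proof (rule pattern_chromatic_number_le[OF \<sigma>])
    show "c ` {1..n} \<subseteq> {..<q1 + q2 + card L2}"
      using less1 less2 lessb by (fastforce simp: c_def)
    fix i j assume ij: "(i, j) \<in> \<sigma>"
    then have n: "i \<in> {1..n}" "j \<in> {1..n}" "i \<noteq> j" using \<sigma> by (auto simp: index_pairs_def)
    show "c i \<noteq> c j"
    proof
      assume eq: "c i = c j"
      have iff2: "i \<in> L2 \<longleftrightarrow> j \<in> L2"
        using eq less1[OF n(1)] less1[OF n(2)] less2[of i] less2[of j] by (auto simp: c_def split: if_splits)
      have iff1: "i \<in> L1 \<longleftrightarrow> j \<in> L1"
        using eq less1[OF n(1)] less1[OF n(2)] L2(1) by (auto simp: c_def split: if_splits)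
      consider "i \<in> L2" "j \<in> L2" | "i \<in> L1 - L2" "j \<in> L1 - L2" | "i \<in> {1..n} - L1" "j \<in> {1..n} - L1"
        using iff1 iff2 n by auto
      then show False
      proof cases
        case 1
        then have "b i = b j" using eq by (simp add: c_def)
        then show False using b 1 n(3) by (auto simp: bij_betw_def inj_on_def)
      next
        case 2
        then show False using eq L2(5) ij by (auto simp: c_def)
      next
        case 3
        moreover from this have "i \<notin> L2" "j \<notin> L2" using L2(1) by auto
        ultimately show False using eq L1(5) ij by (auto simp: c_def)
      qed
    qed
  qed
  then have "real (pattern_chromatic_number n \<sigma>) \<le> real q1 + real q2 + real (card L2)" by linarith
  also have "real q1 \<le> real n / real k1"
  proof -
    have "real (q1 * k1) \<le> real n" using L1(3) by (simp only: of_nat_le_iff card_atLeastAtMost diff_Suc_1)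
    then show ?thesis using k(1) by (simp add: field_simps)
  qed
  also have "real q2 \<le> real u1 / real k2"
  proof -
    have "real (q2 * k2) \<le> real u1" using L2(3) L1(2) by (simp only: of_nat_le_iff)
    then show ?thesis using k(2) by (simp add: field_simps)
  qed
  also have "real (card L2) \<le> real u2" using L2(2) by simp
  finally show ?thesis by simp
qed

lemma card_some_set_no_independent_le:
  assumes "k \<ge> 2" "real k ^ 4 * 2 ^ (k + 1) \<le> real u ^ 2"
  shows "real (card {\<sigma>\<in>Pow (index_pairs n). \<exists>U. U \<subseteq> {1..n} \<and> card U = u \<and> (\<forall>S. S \<subseteq> U \<and> card S = k \<longrightarrow> \<not> independent_in \<sigma> S)})
    \<le> 2 ^ n * 2 ^ card (index_pairs n) * exp (- (real u ^ 2 / (4 * real k ^ 4)))" (is "real (card ?B) \<le> _")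
proof -
  define Us where "Us = {U. U \<subseteq> {1..n} \<and> card U = u}"
  define B where "B = (\<lambda>U. {\<sigma>\<in>Pow (index_pairs n). \<forall>S. S \<subseteq> U \<and> card S = k \<longrightarrow> \<not> independent_in \<sigma> S})"
  have finU: "finite Us" unfolding Us_def by (rule finite_subset[of _ "Pow {1..n}"]) auto
  have cardU: "card Us \<le> 2 ^ n"
  proof -
    have "card Us \<le> card (Pow {1..n})" unfolding Us_def by (intro card_mono) auto
    then show ?thesis by (simp add: card_Pow)
  qed
  have "?B = (\<Union>U\<in>Us. B U)" by (auto simp: Us_def B_def)
  then have "real (card ?B) \<le> real (\<Sum>U\<in>Us. card (B U))" using card_UN_le[OF finU, of B] by (simp only: of_nat_le_iff)
  also have "\<dots> = (\<Sum>U\<in>Us. real (card (B U)))" by simp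
  also have "\<dots> \<le> (\<Sum>U\<in>Us. 2 ^ card (index_pairs n) * exp (- (real u ^ 2 / (4 * real k ^ 4))))"
  proof (rule sum_mono)
    fix U assume "U \<in> Us"
    then show "real (card (B U)) \<le> 2 ^ card (index_pairs n) * exp (- (real u ^ 2 / (4 * real k ^ 4)))"
      unfolding B_def using assms by (intro card_no_independent_set_le) (auto simp: Us_def)
  qed
  also have "\<dots> = real (card Us) * (2 ^ card (index_pairs n) * exp (- (real u ^ 2 / (4 * real k ^ 4))))" by simp
  also have "\<dots> \<le> 2 ^ n * (2 ^ card (index_pairs n) * exp (- (real u ^ 2 / (4 * real k ^ 4))))"
  proof (intro mult_right_mono)
    show "real (card Us) \<le> 2 ^ n" using cardU by (metis of_nat_le_iff of_nat_numeral of_nat_power)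
  qed auto
  finally show ?thesis by (simp add: mult_ac)
qed

lemma card_large_chromatic_number_le:
  assumes k: "k1 \<ge> 2" "k2 \<ge> 2" and m: "real k1 ^ 4 * 2 ^ (k1 + 1) \<le> real u1 ^ 2" "real k2 ^ 4 * 2 ^ (k2 + 1) \<le> real u2 ^ 2"
  shows "real (card {\<sigma>\<in>Pow (index_pairs n). real (pattern_chromatic_number n \<sigma>) > real n / real k1 + real u1 / real k2 + real u2})
    \<le> 2 ^ n * 2 ^ card (index_pairs n) * (exp (- (real u1 ^ 2 / (4 * real k1 ^ 4))) + exp (- (real u2 ^ 2 / (4 * real k2 ^ 4))))"
proof -
  define B where "B = (\<lambda>u k. {\<sigma>\<in>Pow (index_pairs n). \<exists>U. U \<subseteq> {1..n} \<and> card U = u \<and> (\<forall>S. S \<subseteq> U \<and> card S = k \<longrightarrow> \<not> independent_in \<sigma> S)})"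
  have u: "u1 \<ge> 1" "u2 \<ge> 1"
  proof -
    have "0 < real k1 ^ 4 * 2 ^ (k1 + 1)" "0 < real k2 ^ 4 * 2 ^ (k2 + 1)" using k by auto
    then have "real u1 ^ 2 > 0" "real u2 ^ 2 > 0" using m by linarith+
    then show "u1 \<ge> 1" "u2 \<ge> 1" by (auto simp: Suc_le_eq)
  qed
  have sub: "{\<sigma>\<in>Pow (index_pairs n). real (pattern_chromatic_number n \<sigma>) > real n / real k1 + real u1 / real k2 + real u2} \<subseteq> B u1 k1 \<union> B u2 k2"
  proof
    fix \<sigma> assume "\<sigma> \<in> {\<sigma>\<in>Pow (index_pairs n). real (pattern_chromatic_number n \<sigma>) > real n / real k1 + real u1 / real k2 + real u2}"
    then have \<sigma>: "\<sigma> \<subseteq> index_pairs n" "\<not> real (pattern_chromatic_number n \<sigma>) \<le> real n / real k1 + real u1 / real k2 + real u2" by auto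
    show "\<sigma> \<in> B u1 k1 \<union> B u2 k2"
    proof (rule ccontr)
      assume "\<sigma> \<notin> B u1 k1 \<union> B u2 k2"
      then have no: "\<sigma> \<notin> B u1 k1" "\<sigma> \<notin> B u2 k2" by auto
      have "real (pattern_chromatic_number n \<sigma>) \<le> real n / real k1 + real u1 / real k2 + real u2"
      proof (rule chromatic_number_two_phase[OF \<sigma>(1) _ _ u])
        fix U assume "U \<subseteq> {1..n}" "card U = u1"
        then show "\<exists>S. S \<subseteq> U \<and> card S = k1 \<and> independent_in \<sigma> S" using no(1) \<sigma>(1) unfolding B_def by blast
      next
        fix U assume "U \<subseteq> {1..n}" "card U = u2"
        then show "\<exists>S. S \<subseteq> U \<and> card S = k2 \<and> independent_in \<sigma> S" using no(2) \<sigma>(1) unfolding B_def by blast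
      qed (use k in auto)
      then show False using \<sigma>(2) by simp
    qed
  qed
  have "finite (B u k)" for u k unfolding B_def by simp
  then have "card {\<sigma>\<in>Pow (index_pairs n). real (pattern_chromatic_number n \<sigma>) > real n / real k1 + real u1 / real k2 + real u2} \<le> card (B u1 k1) + card (B u2 k2)"
    using card_mono[OF _ sub] card_Un_le[of "B u1 k1" "B u2 k2"] by (meson finite_UnI order_trans)
  then have "real (card {\<sigma>\<in>Pow (index_pairs n). real (pattern_chromatic_number n \<sigma>) > real n / real k1 + real u1 / real k2 + real u2}) \<le> real (card (B u1 k1)) + real (card (B u2 k2))"
    by linarith
  also have "\<dots> \<le> 2 ^ n * 2 ^ card (index_pairs n) * exp (- (real u1 ^ 2 / (4 * real k1 ^ 4))) +
      2 ^ n * 2 ^ card (index_pairs n) * exp (- (real u2 ^ 2 / (4 * real k2 ^ 4)))"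
    unfolding B_def using k m by (intro add_mono card_some_set_no_independent_le)
  finally show ?thesis by (simp add: algebra_simps)
qed

section \<open>Prescribed pairs that force few or many colours\<close>

definition class_pairs :: "nat \<Rightarrow> nat \<Rightarrow> (nat \<times> nat) set" where
  "class_pairs n k = {(i, j) \<in> index_pairs n. i mod k = j mod k}"

text \<open>Residues modulo \<open>k\<close> are a balanced colouring with an explicit description:
  a larger partner of \<open>i\<close> is \<open>i + t * k\<close> with
  \<open>1 \<le> t \<le> n div k\<close>. The count is too large by a factor of about 2 when
  \<open>k\<close> is small against \<open>n\<close>, which the dimension bound in (ii)
  tolerates.\<close>

lemma card_class_pairs_le: "card (class_pairs n k) \<le> n * (n div k)"
proof -
  have "class_pairs n k \<subseteq> (\<lambda>(i, t). (i, i + t * k)) ` ({1..n} \<times> {1..n div k})"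
  proof
    fix e assume "e \<in> class_pairs n k"
    then obtain i j where e: "e = (i, j)" "1 \<le> i" "i < j" "j \<le> n" "i mod k = j mod k"
      by (auto simp: class_pairs_def index_pairs_def)
    then have "k dvd j - i" using mod_eq_dvd_iff_nat[of i j k] by simp
    then obtain t where t: "j - i = t * k" by (metis dvd_def mult.commute)
    have "t \<noteq> 0" "k \<noteq> 0" using t e by (auto intro: ccontr)
    moreover have "t * k \<le> n" using t e by linarith
    then have "t \<le> n div k" using \<open>k \<noteq> 0\<close> by (simp add: less_eq_div_iff_mult_less_eq)
    moreover have "j = i + t * k" using t e by simp
    ultimately show "e \<in> (\<lambda>(i, t). (i, i + t * k)) ` ({1..n} \<times> {1..n div k})"
      using e by (intro image_eqI[of _ _ "(i, t)"]) auto
  qed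
  then have "card (class_pairs n k) \<le> card ({1..n} \<times> {1..n div k})"
    by (rule surj_card_le[rotated]) auto
  then show ?thesis by (simp add: card_cartesian_product)
qed

lemma chromatic_number_avoiding_classes:
  assumes "\<sigma> \<subseteq> index_pairs n" "\<sigma> \<inter> class_pairs n k = {}" "k \<ge> 1"
  shows "pattern_chromatic_number n \<sigma> \<le> k"
  using assms by (intro pattern_chromatic_number_le[of _ _ "\<lambda>i. i mod k"]) (auto simp: class_pairs_def)

lemma chromatic_number_clique:
  assumes "\<sigma> \<subseteq> index_pairs n" "index_pairs k \<subseteq> \<sigma>" "k \<le> n"
  shows "k \<le> pattern_chromatic_number n \<sigma>"
proof -
  obtain c where c: "c ` {1..n} \<subseteq> {..<pattern_chromatic_number n \<sigma>}" "\<And>i j. (i, j) \<in> \<sigma> \<Longrightarrow> c i \<noteq> c j"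
    using pattern_colouring_exists[OF assms(1) order_refl] by blast
  have "inj_on c {1..k}"
  proof (rule linorder_inj_onI)
    fix i j assume "i < j" "i \<in> {1..k}" "j \<in> {1..k}"
    then have "(i, j) \<in> index_pairs k" by (auto simp: index_pairs_def)
    then show "c i \<noteq> c j" using assms(2) c(2) by auto
  qed auto
  moreover have "c ` {1..k} \<subseteq> {..<pattern_chromatic_number n \<sigma>}" using c(1) assms(3) by fastforce
  ultimately have "card {1..k} \<le> card {..<pattern_chromatic_number n \<sigma>}" by (intro card_inj_on_le) auto
  then show ?thesis by simp
qed

text \<open>For uniform \<open>A\<close> the quantity \<open>2 * card A - card E\<close> is a sum of
  \<open>card E\<close> independent random signs; this is its variance.\<close>

lemma sum_Pow_centred_square:
  "finite E \<Longrightarrow> (\<Sum>A\<in>Pow E. (2 * real (card A) - real (card E))\<^sup>2) = real (card E) * 2 ^ card E"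
proof (induction E rule: finite_induct)
  case (insert e E)
  have "(\<Sum>A\<in>Pow E. (2 * real (card (insert e A)) - real (card (insert e E)))\<^sup>2) =
    (\<Sum>A\<in>Pow E. (2 * real (card A) - real (card E) + 1)\<^sup>2)"
  proof (intro sum.cong refl)
    fix A assume "A \<in> Pow E"
    then have "finite A" "e \<notin> A" using insert finite_subset by auto
    then show "(2 * real (card (insert e A)) - real (card (insert e E)))\<^sup>2 = (2 * real (card A) - real (card E) + 1)\<^sup>2"
      using insert by (simp add: algebra_simps)
  qed
  then have "(\<Sum>A\<in>Pow (insert e E). (2 * real (card A) - real (card (insert e E)))\<^sup>2) =
    (\<Sum>A\<in>Pow E. (2 * real (card A) - real (card E) - 1)\<^sup>2 + (2 * real (card A) - real (card E) + 1)\<^sup>2)"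
    using insert by (simp add: sum_Pow_insert sum.distrib algebra_simps)
  also have "\<dots> = (\<Sum>A\<in>Pow E. 2 * (2 * real (card A) - real (card E))\<^sup>2 + 2)"
    by (intro sum.cong refl) (simp add: power2_eq_square algebra_simps)
  also have "\<dots> = 2 * (real (card E) * 2 ^ card E) + 2 * 2 ^ card E"
    using insert by (simp add: sum.distrib sum_distrib_left[symmetric] card_Pow)
  finally show ?case using insert by (simp add: algebra_simps)
qed simp

text \<open>The right-hand side is the probability that a uniform subset of an
  \<open>N\<close>-element set has fewer than \<open>d\<close> elements; Chebyshev's inequality
  bounds the complementary probability, as \<open>d\<close> exceeds the mean
  \<open>N / 2\<close>.\<close>

lemma sum_choose_Chebyshev:
  assumes "2 * d > N"
  shows "1 - real N / (2 * real d - real N)\<^sup>2 \<le> real (\<Sum>k<d. N choose k) / 2 ^ N"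
proof -
  obtain d' where d': "d = Suc d'" using assms by (cases d) auto
  define small where "small = {A. A \<subseteq> {..<N} \<and> card A \<le> d'}"
  define large where "large = {A\<in>Pow {..<N}. d \<le> card A}"
  have fin: "finite small" "finite large" by (auto simp: small_def large_def)
  have card_small: "card small = (\<Sum>k<d. N choose k)"
    unfolding small_def using card_subsets_le[of "{..<N}" d'] d' by (simp add: lessThan_Suc_atMost)
  have "Pow {..<N} = small \<union> large" "small \<inter> large = {}" by (auto simp: small_def large_def d')
  then have "card (Pow {..<N}) = card small + card large" using fin by (simp add: card_Un_disjoint)
  then have "2 ^ N = card small + card large" by (simp add: card_Pow)
  then have tot: "2 ^ N = real (card small) + real (card large)" by (metis of_nat_add of_nat_numeral of_nat_power)
  have pos: "2 * real d - real N > 0" using assms by linarith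
  have "real (card large) * (2 * real d - real N)\<^sup>2 = (\<Sum>A\<in>large. (2 * real d - real N)\<^sup>2)" by simp
  also have "\<dots> \<le> (\<Sum>A\<in>large. (2 * real (card A) - real (card {..<N}))\<^sup>2)"
    using pos by (intro sum_mono power_mono) (auto simp: large_def)
  also have "\<dots> \<le> (\<Sum>A\<in>Pow {..<N}. (2 * real (card A) - real (card {..<N}))\<^sup>2)"
    by (intro sum_mono2) (auto simp: large_def)
  also have "\<dots> = real N * 2 ^ N" using sum_Pow_centred_square[of "{..<N}"] by simp
  finally have "real (card large) / 2 ^ N \<le> real N / (2 * real d - real N)\<^sup>2"
    using pos by (simp add: field_simps)
  moreover have "real (card small) = 2 ^ N - real (card large)" using tot by simp
  then have "real (card small) / 2 ^ N = 1 - real (card large) / 2 ^ N" by (simp add: diff_divide_distrib)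
  ultimately show ?thesis unfolding card_small by linarith
qed

subsection \<open>Asymptotics\<close>

lemma index_pairs_nonempty: "n \<ge> 2 \<Longrightarrow> index_pairs n \<noteq> {}"
proof -
  assume "n \<ge> 2"
  then have "(1, 2) \<in> index_pairs n" by (simp add: index_pairs_def)
  then show ?thesis by blast
qed

text \<open>Turns the loss \<open>(N + 1) ^ d\<close> over all directions into the convenient
  \<open>n ^ (2 * d)\<close>.\<close>

lemma card_index_pairs_Suc_le: "n \<ge> 1 \<Longrightarrow> real (card (index_pairs n) + 1) \<le> real n ^ 2"
proof -
  assume "n \<ge> 1"
  have "(n choose 2) + 1 \<le> n ^ 2"
  proof -
    have "n choose 2 \<le> n * (n - 1)" by (simp add: choose_two)
    moreover have "n * (n - 1) + 1 \<le> n ^ 2" using \<open>n \<ge> 1\<close> by (cases n) (auto simp: power2_eq_square)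
    ultimately show ?thesis by linarith
  qed
  then show ?thesis unfolding card_index_pairs by (metis of_nat_le_iff of_nat_power)
qed

section \<open>From Gaussian configurations to the random graphs\<close>

locale random_rotated_graphs =
  fixes d :: "nat \<Rightarrow> nat"
    and M :: "nat \<Rightarrow> 'a measure"
    and X :: "nat \<Rightarrow> nat \<times> nat \<Rightarrow> 'a \<Rightarrow> nat \<Rightarrow> real"
  assumes M_prob: "\<And>n. prob_space (M n)"
    and X_normal: "\<And>n e. e \<in> index_pairs n \<Longrightarrow> std_normal_vec (d n) (M n) (X n e)"
    and X_indep: "\<And>n. prob_space.indep_vars (M n) (\<lambda>_. vec_space (d n)) (X n) (index_pairs n)"
begin

definition pattern :: "nat \<Rightarrow> 'a \<Rightarrow> (nat \<Rightarrow> real) \<Rightarrow> (nat \<times> nat) set" where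
  "pattern n \<omega> s = {e \<in> index_pairs n. vec_inner (d n) (X n e \<omega>) s \<ge> 0}"

lemma exists_direction_transfer:
  fixes B :: "(nat \<times> nat) set set"
  assumes "n \<ge> 2"
  defines "A \<equiv> {\<omega> \<in> space (M n). \<exists>s\<in>unit_sphere (d n). pattern n \<omega> s \<in> B}"
  shows "A \<in> sets (M n)"
    and "measure (M n) A = measure (gauss_config (index_pairs n) (d n))
      {x \<in> space (gauss_config (index_pairs n) (d n)). \<exists>s\<in>unit_sphere (d n).
        {e \<in> index_pairs n. vec_inner (d n) (x e) s \<ge> 0} \<in> B}"
proof -
  define I where "I = index_pairs n"
  define G where "G = {x \<in> space (gauss_config I (d n)). \<exists>s\<in>unit_sphere (d n). {e \<in> I. vec_inner (d n) (x e) s \<ge> 0} \<in> B}"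
  have G: "G \<in> sets (gauss_config I (d n))"
    unfolding G_def by (rule sets_exists_direction) (simp add: I_def)
  have "(\<lambda>e\<in>I. X n e \<omega>) \<in> space (gauss_config I (d n))" if "\<omega> \<in> space (M n)" for \<omega>
  proof -
    have "X n e \<omega> \<in> space (vec_space (d n))" if "e \<in> I" for e
      using X_normal[of e n] that \<open>\<omega> \<in> space (M n)\<close> by (auto simp: std_normal_vec_def I_def intro: measurable_space)
    then show ?thesis by (auto simp: space_gauss_config space_PiM)
  qed
  moreover have "{e \<in> I. vec_inner (d n) ((\<lambda>e\<in>I. X n e \<omega>) e) s \<ge> 0} = pattern n \<omega> s" for \<omega> s
    by (auto simp: pattern_def I_def)
  ultimately have A: "A = {\<omega> \<in> space (M n). (\<lambda>e\<in>I. X n e \<omega>) \<in> G}"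
    unfolding A_def G_def by auto
  have "I \<noteq> {}" using index_pairs_nonempty[OF assms(1)] by (simp add: I_def)
  have nrm: "\<And>e. e \<in> I \<Longrightarrow> std_normal_vec (d n) (M n) (X n e)"
    and ind: "prob_space.indep_vars (M n) (\<lambda>_. vec_space (d n)) (X n) I"
    using X_normal X_indep by (auto simp: I_def)
  show "A \<in> sets (M n)"
    unfolding A by (rule measure_gauss_config_transfer(1)[OF M_prob \<open>I \<noteq> {}\<close> nrm ind G])
  show "measure (M n) A = measure (gauss_config (index_pairs n) (d n))
      {x \<in> space (gauss_config (index_pairs n) (d n)). \<exists>s\<in>unit_sphere (d n).
        {e \<in> index_pairs n. vec_inner (d n) (x e) s \<ge> 0} \<in> B}"
    using measure_gauss_config_transfer(2)[OF M_prob \<open>I \<noteq> {}\<close> nrm ind G] unfolding A by (simp add: I_def G_def)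
qed

text \<open>One deterministic choice of \<open>J\<close> and of a trace \<open>\<tau>\<close> per
  \<open>n\<close> suffices: some direction realizes this trace with probability at least
  \<open>b n\<close>, and the pairs outside \<open>J\<close> are unconstrained.\<close>

lemma whp_exists_direction:
  assumes "\<forall>\<^sub>F n in sequentially. \<exists>J \<tau>. J \<subseteq> index_pairs n \<and> J \<noteq> {} \<and> \<tau> \<subseteq> J \<and>
      (\<forall>\<sigma>\<subseteq>index_pairs n. \<sigma> \<inter> J = \<tau> \<longrightarrow> Q n \<sigma>) \<and> b n \<le> real (\<Sum>k<d n. card J choose k) / 2 ^ card J"
    and b: "b \<longlonglongrightarrow> 1"
  shows "whp M (\<lambda>n \<omega>. \<exists>s\<in>unit_sphere (d n). Q n (pattern n \<omega> s))"
  unfolding whp_def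
proof (rule tendsto_sandwich[OF _ _ b tendsto_const])
  have "\<forall>\<^sub>F n in sequentially. n \<ge> 2" by (rule eventually_ge_at_top)
  with assms(1) show "\<forall>\<^sub>F n in sequentially. b n \<le> \<P>(\<omega> in M n. \<exists>s\<in>unit_sphere (d n). Q n (pattern n \<omega> s))"
  proof eventually_elim
    case (elim n)
    from elim(1) obtain J \<tau> where J: "J \<subseteq> index_pairs n" "J \<noteq> {}" "\<tau> \<subseteq> J"
      "\<forall>\<sigma>\<subseteq>index_pairs n. \<sigma> \<inter> J = \<tau> \<longrightarrow> Q n \<sigma>"
      "b n \<le> real (\<Sum>k<d n. card J choose k) / 2 ^ card J"
      by (elim exE conjE) (rule that; assumption)
    have B: "\<sigma> \<in> {\<sigma>. Q n \<sigma>}" if "\<sigma> \<subseteq> index_pairs n" "\<sigma> \<inter> J = \<tau>" for \<sigma>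
      using J(4) that by simp
    note J(5)
    also note measure_exists_direction_ge[OF finite_index_pairs J(1-3) B, of "d n"]
    also note exists_direction_transfer(2)[OF elim(2), of "{\<sigma>. Q n \<sigma>}", symmetric]
    finally show ?case by simp
  qed
  show "\<forall>\<^sub>F n in sequentially. \<P>(\<omega> in M n. \<exists>s\<in>unit_sphere (d n). Q n (pattern n \<omega> s)) \<le> 1"
    using prob_space.prob_le_1[OF M_prob] by simp
qed

text \<open>Reduces the claim to counting: the proportion of bad patterns among all graphs must
  absorb the factor \<open>n ^ (2 * d)\<close>. The event is the complement of an existential event
  already known to be measurable.\<close>

lemma whp_all_directions:
  assumes "\<forall>\<^sub>F n in sequentially. real (card {\<sigma>\<in>Pow (index_pairs n). \<not> Q n \<sigma>}) * real n ^ (2 * d n) / 2 ^ card (index_pairs n) \<le> b n"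
    and b: "b \<longlonglongrightarrow> 0"
  shows "whp M (\<lambda>n \<omega>. \<forall>s\<in>unit_sphere (d n). Q n (pattern n \<omega> s))"
  unfolding whp_def
proof (rule tendsto_sandwich)
  show "(\<lambda>n. 1 - b n) \<longlonglongrightarrow> 1" using tendsto_diff[OF tendsto_const b, of 1] by simp
  have "\<forall>\<^sub>F n in sequentially. n \<ge> 2" by (rule eventually_ge_at_top)
  with assms(1) show "\<forall>\<^sub>F n in sequentially. 1 - b n \<le> \<P>(\<omega> in M n. \<forall>s\<in>unit_sphere (d n). Q n (pattern n \<omega> s))"
  proof eventually_elim
    case (elim n)
    interpret prob_space "M n" by (rule M_prob)
    define B where "B = {\<sigma>\<in>Pow (index_pairs n). \<not> Q n \<sigma>}"
    define A where "A = {\<omega> \<in> space (M n). \<exists>s\<in>unit_sphere (d n). pattern n \<omega> s \<in> B}"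
    have A: "A \<in> sets (M n)" unfolding A_def by (rule exists_direction_transfer(1)[OF elim(2)])
    have "pattern n \<omega> s \<in> B \<longleftrightarrow> \<not> Q n (pattern n \<omega> s)" for \<omega> s by (auto simp: B_def pattern_def)
    then have eq: "{\<omega> \<in> space (M n). \<forall>s\<in>unit_sphere (d n). Q n (pattern n \<omega> s)} = space (M n) - A"
      by (auto simp: A_def)
    have "measure (M n) A \<le> real (card B) * real (card (index_pairs n) + 1) ^ d n / 2 ^ card (index_pairs n)"
      unfolding A_def exists_direction_transfer(2)[OF elim(2)]
      by (rule measure_exists_direction_le) (auto simp: B_def)
    also have "\<dots> \<le> real (card B) * (real n ^ 2) ^ d n / 2 ^ card (index_pairs n)"
      using elim(2) by (intro divide_right_mono mult_left_mono power_mono card_index_pairs_Suc_le) auto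
    also have "\<dots> \<le> b n" using elim(1) by (simp add: B_def power_mult)
    finally show ?case unfolding eq using prob_compl[OF A] by simp
  qed
  show "\<forall>\<^sub>F n in sequentially. \<P>(\<omega> in M n. \<forall>s\<in>unit_sphere (d n). Q n (pattern n \<omega> s)) \<le> 1"
    using prob_space.prob_le_1[OF M_prob] by simp
qed (rule tendsto_const)

section \<open>The four regimes of the dimension\<close>

lemma chromatic_number_all_ge:
  assumes eps: "0 < \<epsilon>" "\<epsilon> < 1"
    and d: "(\<lambda>n. real (d n)) \<in> o(\<lambda>n. real n / ln (real n) ^ 3)"
  shows "whp M (\<lambda>n \<omega>. \<forall>s\<in>unit_sphere (d n).
    real (pattern_chromatic_number n (pattern n \<omega> s)) \<ge> (1 - \<epsilon>) * real n / (2 * log 2 (real n)))"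
proof (rule whp_all_directions)
  \<comment> \<open>For the threshold \<open>m n\<close> one has
    \<open>n / m n = 2 * log 2 n * (1 + c)\<close>, so \<open>c\<close> measures by how much the
    forced non-edges outweigh the number of colourings.\<close>
  define c where "c = \<epsilon> / (1 - \<epsilon>)"
  have c: "c > 0" "1 / (1 - \<epsilon>) = 1 + c" using eps by (auto simp: c_def field_simps)
  \<comment> \<open>In the exponent to base 2 the colourings contribute at most
    \<open>n * log 2 n\<close>, the forced non-edges \<open>- (1 + c) * n * log 2 n + n / 2\<close>,
    and the directions at most the last term.\<close>
  define b where "b = (\<lambda>n. 2 powr (- (c * real n * log 2 (real n)) + real n / 2 + 2 * (real n / ln (real n) ^ 3) * log 2 (real n)))"
  show "b \<longlonglongrightarrow> 0" unfolding b_def using c(1) by real_asymp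
  define m where "m = (\<lambda>n. (1 - \<epsilon>) * real n / (2 * log 2 (real n)))"
  have "\<forall>\<^sub>F n in sequentially. norm (real (d n)) \<le> 1 * norm (real n / ln (real n) ^ 3)"
    using landau_o.smallD[OF d, of 1] by simp
  moreover have "\<forall>\<^sub>F n in sequentially. n \<ge> (3::nat)" by (rule eventually_ge_at_top)
  moreover have "\<forall>\<^sub>F n in sequentially. m n \<ge> 1" unfolding m_def using eps by real_asymp
  ultimately show "\<forall>\<^sub>F n in sequentially. real (card {\<sigma> \<in> Pow (index_pairs n). \<not> real (pattern_chromatic_number n \<sigma>) \<ge> (1 - \<epsilon>) * real n / (2 * log 2 (real n))}) *
      real n ^ (2 * d n) / 2 ^ card (index_pairs n) \<le> b n"
  proof eventually_elim
    case (elim n)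
    have n: "real n > 0" "log 2 (real n) \<ge> 1" "ln (real n) > 0" using elim(2) by auto
    \<comment> \<open>The chromatic number is an integer, so being below \<open>m n\<close> implies
      being at most its floor.\<close>
    define k where "k = nat \<lfloor>m n\<rfloor>"
    have k: "k \<ge> 1" "real k \<le> m n" using elim(3) by (auto simp: k_def le_nat_floor of_nat_floor)
    have "m n \<le> real n"
    proof -
      have "1 \<le> 2 * log 2 (real n)" using n(2) by linarith
      then have "real n * 1 \<le> real n * (2 * log 2 (real n))" using n(1) by (intro mult_left_mono) auto
      moreover have "(1 - \<epsilon>) * real n \<le> 1 * real n" using eps by (intro mult_right_mono) auto
      ultimately have "(1 - \<epsilon>) * real n \<le> real n * (2 * log 2 (real n))" by linarith
      then show ?thesis using n unfolding m_def by (simp add: divide_le_eq)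
    qed
    have "{\<sigma> \<in> Pow (index_pairs n). \<not> real (pattern_chromatic_number n \<sigma>) \<ge> m n} \<subseteq> {\<sigma> \<in> Pow (index_pairs n). pattern_chromatic_number n \<sigma> \<le> k}"
      by (auto simp: k_def intro: le_nat_floor)
    then have "real (card {\<sigma> \<in> Pow (index_pairs n). \<not> real (pattern_chromatic_number n \<sigma>) \<ge> m n}) \<le>
        real (card {\<sigma> \<in> Pow (index_pairs n). pattern_chromatic_number n \<sigma> \<le> k})"
      by (simp only: of_nat_le_iff) (rule card_mono, auto)
    also have "\<dots> \<le> real k ^ n * 2 ^ card (index_pairs n) * 2 powr (- (real n * (real n / real k - 1) / 2))"
      by (rule card_small_chromatic_number_le[OF k(1)])
    also have "\<dots> \<le> real n ^ n * 2 ^ card (index_pairs n) * 2 powr (- (real n * (real n / m n - 1) / 2))"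
    proof (intro mult_mono mult_right_mono power_mono)
      show "real k \<le> real n" using k(2) \<open>m n \<le> real n\<close> by linarith
      have "real n / m n \<le> real n / real k" using k n by (intro divide_left_mono) auto
      then have "real n * (real n / m n - 1) / 2 \<le> real n * (real n / real k - 1) / 2"
        using n by (intro divide_right_mono mult_left_mono) auto
      then show "2 powr (- (real n * (real n / real k - 1) / 2)) \<le> 2 powr (- (real n * (real n / m n - 1) / 2))" by simp
    qed auto
    finally have card: "real (card {\<sigma> \<in> Pow (index_pairs n). \<not> real (pattern_chromatic_number n \<sigma>) \<ge> m n}) \<le>
      real n ^ n * 2 ^ card (index_pairs n) * 2 powr (- (real n * (real n / m n - 1) / 2))" .
    have "real n / m n = 2 * log 2 (real n) * (1 + c)"
      using n eps unfolding m_def c(2)[symmetric] by simp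
    then have expo: "real n * (real n / m n - 1) / 2 = real n * log 2 (real n) * (1 + c) - real n / 2"
      by (simp add: field_simps)
    have "real n ^ l = 2 powr (real l * log 2 (real n))" for l
      using n by (simp add: powr_def log_def exp_of_nat_mult)
    note pow = this
    have "real (card {\<sigma> \<in> Pow (index_pairs n). \<not> real (pattern_chromatic_number n \<sigma>) \<ge> m n}) * real n ^ (2 * d n) / 2 ^ card (index_pairs n)
      \<le> (real n ^ n * 2 ^ card (index_pairs n) * 2 powr (- (real n * (real n / m n - 1) / 2))) * real n ^ (2 * d n) / 2 ^ card (index_pairs n)"
      using card by (intro divide_right_mono mult_right_mono) auto
    also have "\<dots> = real n ^ n * 2 powr (- (real n * (real n / m n - 1) / 2)) * real n ^ (2 * d n)" by simp
    also have "\<dots> = 2 powr (- (c * real n * log 2 (real n)) + real n / 2 + 2 * real (d n) * log 2 (real n))"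
      unfolding expo pow powr_add[symmetric] by (simp add: algebra_simps)
    also have "\<dots> \<le> b n"
    proof -
      have "real (d n) \<le> real n / ln (real n) ^ 3" using elim(1) n by simp
      then have "2 * real (d n) * log 2 (real n) \<le> 2 * (real n / ln (real n) ^ 3) * log 2 (real n)"
        using n by (intro mult_right_mono mult_left_mono) auto
      then show ?thesis unfolding b_def by simp
    qed
    finally show ?case unfolding m_def .
  qed
qed

lemma chromatic_number_exists_le:
  assumes eps: "0 < \<epsilon>" "\<epsilon> < 1 / 2"
    and d: "\<And>n. n \<ge> 2 \<Longrightarrow> real (d n) \<ge> 2 * real n * log 2 (real n) / (1 - 2 * \<epsilon>)"
  shows "whp M (\<lambda>n \<omega>. \<exists>s\<in>unit_sphere (d n).
    real (pattern_chromatic_number n (pattern n \<omega> s)) \<le> (1 - \<epsilon>) * real n / (2 * log 2 (real n)))"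
proof (rule whp_exists_direction)
  define p where "p = 1 - \<epsilon>"
  define q where "q = 1 - 2 * \<epsilon>"
  have pq: "0 < q" "q < p" "p < 1" using eps by (auto simp: p_def q_def)
  \<comment> \<open>The count of class pairs asks for about \<open>2 * n * log 2 n / p\<close>
    dimensions, and \<open>d n\<close> is at least the same expression with \<open>q\<close>; the
    gap \<open>r\<close> absorbs the rounding of \<open>m n\<close> down to
    \<open>k\<close>.\<close>
  define r where "r = p - q"
  have "r > 0" using pq by (simp add: r_def)
  define m where "m = (\<lambda>n. p * real n / (2 * log 2 (real n)))"
  show "(\<lambda>_. 1) \<longlonglongrightarrow> (1::real)" by simp
  have "\<forall>\<^sub>F n in sequentially. n \<ge> (3::nat)" by (rule eventually_ge_at_top)
  moreover have "\<forall>\<^sub>F n in sequentially. m n > 1" unfolding m_def using pq by real_asymp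
  moreover have "\<forall>\<^sub>F n in sequentially. m n + 1 \<le> real n" unfolding m_def using pq by real_asymp
  moreover have "\<forall>\<^sub>F n in sequentially. 2 * log 2 (real n) < r * real n" using \<open>r > 0\<close> by real_asymp
  ultimately show "\<forall>\<^sub>F n in sequentially. \<exists>J \<tau>. J \<subseteq> index_pairs n \<and> J \<noteq> {} \<and> \<tau> \<subseteq> J \<and>
      (\<forall>\<sigma>\<subseteq>index_pairs n. \<sigma> \<inter> J = \<tau> \<longrightarrow> real (pattern_chromatic_number n \<sigma>) \<le> (1 - \<epsilon>) * real n / (2 * log 2 (real n))) \<and>
      1 \<le> real (\<Sum>k<d n. card J choose k) / 2 ^ card J"
  proof eventually_elim
    case (elim n)
    define k where "k = nat \<lfloor>m n\<rfloor>"
    have k: "k \<ge> 1" "real k \<le> m n" "m n - 1 < real k"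
      using elim(2) by (auto simp: k_def le_nat_floor of_nat_floor)
    define J where "J = class_pairs n k"
    have "real (card J) \<le> real n * real (n div k)"
      using card_class_pairs_le[of n k] unfolding J_def by (metis of_nat_le_iff of_nat_mult)
    also have "\<dots> \<le> real n * (real n / real k)" by (intro mult_left_mono of_nat_div_le_of_nat) auto
    also have "\<dots> \<le> real n * (real n / (m n - 1))"
      using k elim(2) by (intro mult_left_mono divide_left_mono) auto
    also have "\<dots> < 2 * real n * log 2 (real n) / q"
    proof -
      define L where "L = log 2 (real n)"
      have n: "real n > 0" "L > 0" using elim(1) by (auto simp: L_def)
      then have "2 * L * (m n - 1) = p * real n - 2 * L"
        by (simp add: m_def L_def[symmetric] right_diff_distrib)
      then have "q * real n < 2 * L * (m n - 1)" using elim(4) by (simp add: r_def L_def left_diff_distrib)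
      then have "real n * (q * real n) < real n * (2 * L * (m n - 1))"
        using n by (intro mult_strict_left_mono) auto
      then show ?thesis unfolding L_def[symmetric] using elim(2) pq by (simp add: divide_less_eq less_divide_eq mult_ac)
    qed
    also have "\<dots> \<le> real (d n)" using d[of n] elim(1) by (simp add: q_def)
    finally have less: "card J < d n" by simp
    then have "(\<Sum>k<d n. card J choose k) = (\<Sum>k\<le>card J. card J choose k)"
      by (intro sum.mono_neutral_right) (auto simp: binomial_eq_0)
    then have "(\<Sum>k<d n. card J choose k) = 2 ^ card J" by (simp only: choose_row_sum)
    then have one: "1 \<le> real (\<Sum>k<d n. card J choose k) / 2 ^ card J" by simp
    have "1 + k \<le> n" using k elim(3) by linarith
    then have "(1, 1 + k) \<in> J" using k by (auto simp: J_def class_pairs_def index_pairs_def mod_Suc)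
    moreover have "J \<subseteq> index_pairs n" by (auto simp: J_def class_pairs_def)
    moreover have "real (pattern_chromatic_number n \<sigma>) \<le> (1 - \<epsilon>) * real n / (2 * log 2 (real n))"
      if "\<sigma> \<subseteq> index_pairs n" "\<sigma> \<inter> J = {}" for \<sigma>
    proof -
      have "pattern_chromatic_number n \<sigma> \<le> k"
        using chromatic_number_avoiding_classes[OF that(1) that(2)[unfolded J_def] k(1)] .
      then show ?thesis using k(2) by (simp add: m_def p_def)
    qed
    ultimately show ?case using one by (intro exI[of _ J] exI[of _ "{}"]) auto
  qed
qed

lemma chromatic_number_all_le:
  assumes eps: "0 < \<epsilon>"
    and d: "(\<lambda>n. real (d n)) \<in> o(\<lambda>n. real n ^ 2 / ln (real n) ^ 6)"
  shows "whp M (\<lambda>n \<omega>. \<forall>s\<in>unit_sphere (d n).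
    real (pattern_chromatic_number n (pattern n \<omega> s)) \<le> (1 + \<epsilon>) * real n / (2 * log 2 (real n)))"
proof (rule whp_all_directions)
  define p where "p = 1 + \<epsilon>"
  \<comment> \<open>Any value strictly between 1 and \<open>p\<close> would do: \<open>q > 1\<close>
    keeps \<open>2 powr K n\<close>, a power of \<open>n\<close> with exponent
    \<open>2 / q < 2\<close>, well below \<open>v1 n ^ 2\<close>, and \<open>q < p\<close> leaves
    room for rounding and for the colours spent after the first phase.\<close>
  define q where "q = 1 + \<epsilon> / 2"
  have pq: "1 < q" "q < p" using eps by (auto simp: p_def q_def)
  define K where "K = (\<lambda>n. 2 * log 2 (real n) / q)"
  \<comment> \<open>Up to constants, Janson's exponents are
    \<open>n^2 / (ln n) powr (14 / 3)\<close> and \<open>n^2 / (ln n) powr (49 / 10)\<close>, as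
    \<open>2 / 3 + 4 = 14 / 3\<close> and \<open>21 / 10 + 28 / 10 = 49 / 10\<close>; both powers
    are below 5. The colours after the first phase number about
    \<open>n / (ln n) powr (31 / 30)\<close> and \<open>n / (ln n) powr (21 / 20)\<close>, both
    powers being above 1.\<close>
  define w where "w = (\<lambda>n. ln (real n) powr (7 / 10))"
  define v1 where "v1 = (\<lambda>n. real n / ln (real n) powr (1 / 3))"
  define v2 where "v2 = (\<lambda>n. real n / ln (real n) powr (21 / 20))"
  define a where "a = (\<lambda>n. 2 * (real n ^ 2 / ln (real n) ^ 6) * ln (real n) + real n * ln 2)"
  define b where "b = (\<lambda>n. exp (a n - v1 n ^ 2 / (4 * K n ^ 4)) + exp (a n - v2 n ^ 2 / (4 * (w n + 1) ^ 4)))"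
  have b1: "(\<lambda>n. exp (a n - v1 n ^ 2 / (4 * K n ^ 4))) \<longlonglongrightarrow> 0"
    unfolding a_def v1_def K_def using pq by real_asymp
  have b2: "(\<lambda>n. exp (a n - v2 n ^ 2 / (4 * (w n + 1) ^ 4))) \<longlonglongrightarrow> 0"
    unfolding a_def v2_def w_def by real_asymp
  show "b \<longlonglongrightarrow> 0" unfolding b_def using tendsto_add[OF b1 b2] by simp
  have "\<forall>\<^sub>F n in sequentially. norm (real (d n)) \<le> 1 * norm (real n ^ 2 / ln (real n) ^ 6)"
    using landau_o.smallD[OF d, of 1] by simp
  moreover have "\<forall>\<^sub>F n in sequentially. n \<ge> (3::nat)" by (rule eventually_ge_at_top)
  moreover have "\<forall>\<^sub>F n in sequentially. K n \<ge> 3" unfolding K_def using pq by real_asymp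
  moreover have "\<forall>\<^sub>F n in sequentially. w n > 1" unfolding w_def by real_asymp
  moreover have "\<forall>\<^sub>F n in sequentially. real n / (K n - 1) + (v1 n + 1) / w n + (v2 n + 1) \<le> p * real n / (2 * log 2 (real n))"
    unfolding K_def v1_def v2_def w_def using pq by real_asymp
  moreover have "\<forall>\<^sub>F n in sequentially. K n ^ 4 * (2 * 2 powr K n) \<le> v1 n ^ 2"
  proof -
    define r where "r = 2 / q"
    have r: "0 < r" "r < 2" using pq by (auto simp: r_def divide_less_eq)
    then have "\<forall>\<^sub>F n in sequentially. (r * log 2 (real n)) ^ 4 * (2 * real n powr r) \<le> (v1 n)\<^sup>2"
      unfolding v1_def by real_asymp
    then show ?thesis using eventually_gt_at_top[of 0]
    proof eventually_elim
      case (elim n)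
      have "2 powr K n = (2 powr log 2 (real n)) powr r" by (simp add: K_def r_def powr_powr mult.commute)
      then have "2 powr K n = real n powr r" using elim(2) by simp
      then show ?case using elim(1) by (simp add: K_def r_def)
    qed
  qed
  moreover have "\<forall>\<^sub>F n in sequentially. (w n + 1) ^ 4 * (2 * 2 powr (w n + 1)) \<le> v2 n ^ 2"
    unfolding w_def v2_def by real_asymp
  ultimately show "\<forall>\<^sub>F n in sequentially. real (card {\<sigma> \<in> Pow (index_pairs n). \<not> real (pattern_chromatic_number n \<sigma>) \<le> (1 + \<epsilon>) * real n / (2 * log 2 (real n))}) *
      real n ^ (2 * d n) / 2 ^ card (index_pairs n) \<le> b n"
  proof eventually_elim
    case (elim n)
    have n: "real n > 0" "ln (real n) > 0" using elim(2) by auto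
    have v: "v1 n > 0" "v2 n > 0" using n by (auto simp: v1_def v2_def)
    \<comment> \<open>\<open>k1\<close> is rounded down so that the size condition for Janson
      survives, the other three up; \<open>k2\<close> is bounded by \<open>w n + 1\<close> in that
      condition and from below by \<open>w n\<close> in the colour count.\<close>
    define k1 where "k1 = nat \<lfloor>K n\<rfloor>"
    define k2 where "k2 = nat \<lceil>w n\<rceil>"
    define u1 where "u1 = nat \<lceil>v1 n\<rceil>"
    define u2 where "u2 = nat \<lceil>v2 n\<rceil>"
    have k1: "real k1 \<le> K n" "K n - 1 < real k1" using elim(3) by (simp_all add: k1_def, (linarith+)?)
    have k2: "w n \<le> real k2" "real k2 \<le> w n + 1" using elim(4) by (simp_all add: k2_def, (linarith+)?)
    have u1: "v1 n \<le> real u1" "real u1 \<le> v1 n + 1" using v by (simp_all add: u1_def, (linarith+)?)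
    have u2: "v2 n \<le> real u2" "real u2 \<le> v2 n + 1" using v by (simp_all add: u2_def, (linarith+)?)
    have ge2: "k1 \<ge> 2" "k2 \<ge> 2" using k1 k2 elim(3,4) by linarith+
    have pw: "(2::real) ^ (k + 1) \<le> 2 * 2 powr z" if "real k \<le> z" for k z
      using that by (simp add: powr_realpow[symmetric])
    have "real k1 ^ 4 * 2 ^ (k1 + 1) \<le> K n ^ 4 * (2 * 2 powr K n)"
      using k1 elim(3) by (intro mult_mono power_mono pw) auto
    also have "\<dots> \<le> v1 n ^ 2" by (rule elim(6))
    also have "\<dots> \<le> real u1 ^ 2" using u1 v by (intro power_mono) auto
    finally have m1: "real k1 ^ 4 * 2 ^ (k1 + 1) \<le> real u1 ^ 2" .
    have "real k2 ^ 4 * 2 ^ (k2 + 1) \<le> (w n + 1) ^ 4 * (2 * 2 powr (w n + 1))"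
      using k2 elim(4) by (intro mult_mono power_mono pw) auto
    also have "\<dots> \<le> v2 n ^ 2" by (rule elim(7))
    also have "\<dots> \<le> real u2 ^ 2" using u2 v by (intro power_mono) auto
    finally have m2: "real k2 ^ 4 * 2 ^ (k2 + 1) \<le> real u2 ^ 2" .
    have colours: "real n / real k1 + real u1 / real k2 + real u2 \<le> (1 + \<epsilon>) * real n / (2 * log 2 (real n))"
    proof -
      have "real n / real k1 \<le> real n / (K n - 1)" using k1 elim(3) by (intro divide_left_mono) auto
      moreover have "real u1 / real k2 \<le> (v1 n + 1) / w n" using u1 k2 v elim(4) by (intro frac_le) auto
      ultimately show ?thesis using elim(5) u2(2) unfolding p_def by linarith
    qed
    have "real (card {\<sigma> \<in> Pow (index_pairs n). \<not> real (pattern_chromatic_number n \<sigma>) \<le> (1 + \<epsilon>) * real n / (2 * log 2 (real n))})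
      \<le> real (card {\<sigma> \<in> Pow (index_pairs n). real (pattern_chromatic_number n \<sigma>) > real n / real k1 + real u1 / real k2 + real u2})"
      unfolding of_nat_le_iff using colours by (intro card_mono) auto
    also have "\<dots> \<le> 2 ^ n * 2 ^ card (index_pairs n) *
        (exp (- (real u1 ^ 2 / (4 * real k1 ^ 4))) + exp (- (real u2 ^ 2 / (4 * real k2 ^ 4))))"
      by (rule card_large_chromatic_number_le[OF ge2 m1 m2])
    also have "\<dots> \<le> 2 ^ n * 2 ^ card (index_pairs n) *
        (exp (- (v1 n ^ 2 / (4 * K n ^ 4))) + exp (- (v2 n ^ 2 / (4 * (w n + 1) ^ 4))))"
    proof (intro mult_left_mono add_mono)
      have "v1 n ^ 2 / (4 * K n ^ 4) \<le> real u1 ^ 2 / (4 * real k1 ^ 4)"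
        using u1 v k1 ge2 by (intro frac_le mult_left_mono power_mono) auto
      then show "exp (- (real u1 ^ 2 / (4 * real k1 ^ 4))) \<le> exp (- (v1 n ^ 2 / (4 * K n ^ 4)))" by simp
      have "v2 n ^ 2 / (4 * (w n + 1) ^ 4) \<le> real u2 ^ 2 / (4 * real k2 ^ 4)"
        using u2 v k2 ge2 by (intro frac_le mult_left_mono power_mono) auto
      then show "exp (- (real u2 ^ 2 / (4 * real k2 ^ 4))) \<le> exp (- (v2 n ^ 2 / (4 * (w n + 1) ^ 4)))" by simp
    qed auto
    finally have card: "real (card {\<sigma> \<in> Pow (index_pairs n). \<not> real (pattern_chromatic_number n \<sigma>) \<le> (1 + \<epsilon>) * real n / (2 * log 2 (real n))}) \<le>
      2 ^ n * 2 ^ card (index_pairs n) * (exp (- (v1 n ^ 2 / (4 * K n ^ 4))) + exp (- (v2 n ^ 2 / (4 * (w n + 1) ^ 4))))" .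
    have "real n ^ (2 * d n) * 2 ^ n = exp (2 * real (d n) * ln (real n) + real n * ln 2)"
    proof -
      have "real n ^ (2 * d n) = exp (real (2 * d n) * ln (real n))" using n by (simp only: exp_of_nat_mult exp_ln)
      moreover have "(2::real) ^ n = exp (real n * ln 2)" by (simp add: exp_of_nat_mult)
      ultimately show ?thesis by (simp add: exp_add)
    qed
    also have "\<dots> \<le> exp (a n)"
    proof -
      have "real (d n) \<le> real n ^ 2 / ln (real n) ^ 6" using elim(1) n by simp
      then have "2 * real (d n) * ln (real n) \<le> 2 * (real n ^ 2 / ln (real n) ^ 6) * ln (real n)"
        using n by (intro mult_right_mono mult_left_mono) auto
      then show ?thesis unfolding a_def by simp
    qed
    finally have expa: "real n ^ (2 * d n) * 2 ^ n \<le> exp (a n)" .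
    have "real (card {\<sigma> \<in> Pow (index_pairs n). \<not> real (pattern_chromatic_number n \<sigma>) \<le> (1 + \<epsilon>) * real n / (2 * log 2 (real n))}) * real n ^ (2 * d n) / 2 ^ card (index_pairs n)
      \<le> (2 ^ n * 2 ^ card (index_pairs n) * (exp (- (v1 n ^ 2 / (4 * K n ^ 4))) + exp (- (v2 n ^ 2 / (4 * (w n + 1) ^ 4))))) * real n ^ (2 * d n) / 2 ^ card (index_pairs n)"
      using card by (intro divide_right_mono mult_right_mono) auto
    also have "\<dots> = (real n ^ (2 * d n) * 2 ^ n) * (exp (- (v1 n ^ 2 / (4 * K n ^ 4))) + exp (- (v2 n ^ 2 / (4 * (w n + 1) ^ 4))))" by simp
    also have "\<dots> \<le> exp (a n) * (exp (- (v1 n ^ 2 / (4 * K n ^ 4))) + exp (- (v2 n ^ 2 / (4 * (w n + 1) ^ 4))))"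
      using expa by (intro mult_right_mono) (auto intro: add_nonneg_nonneg)
    also have "\<dots> = b n" by (simp add: b_def distrib_left mult_exp_exp)
    finally show ?case .
  qed
qed

lemma chromatic_number_exists_ge:
  assumes eps: "0 < \<epsilon>" "\<epsilon> < 1"
    and d: "\<And>n. n \<ge> 2 \<Longrightarrow> real (d n) \<ge> 1 / 2 * ((1 + \<epsilon>) * real n / (2 * log 2 (real n))) ^ 2"
  shows "whp M (\<lambda>n \<omega>. \<exists>s\<in>unit_sphere (d n).
    real (pattern_chromatic_number n (pattern n \<omega> s)) \<ge> (1 + \<epsilon>) * real n / (2 * log 2 (real n)))"
proof (rule whp_exists_direction)
  define p where "p = 1 + \<epsilon>"
  have p: "0 < p" using eps by (auto simp: p_def)
  define m where "m = (\<lambda>n. p * real n / (2 * log 2 (real n)))"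
  \<comment> \<open>For \<open>m = m n\<close>, the clique has at most \<open>(m^2 + m) / 2\<close>
    pairs, and twice the dimension exceeds their number by at least \<open>(m^2 - m) / 2\<close>, so
    Chebyshev's error is of order \<open>1 / m^2\<close>.\<close>
  define b where "b = (\<lambda>n. 1 - ((m n * m n + m n) / 2) / ((m n * m n - m n) / 2)\<^sup>2)"
  show "b \<longlonglongrightarrow> 1" unfolding b_def m_def using p by real_asymp
  have "\<forall>\<^sub>F n in sequentially. n \<ge> (2::nat)" by (rule eventually_ge_at_top)
  moreover have "\<forall>\<^sub>F n in sequentially. m n > 1" unfolding m_def using p by real_asymp
  moreover have "\<forall>\<^sub>F n in sequentially. m n + 1 \<le> real n" unfolding m_def using p by real_asymp
  ultimately show "\<forall>\<^sub>F n in sequentially. \<exists>J \<tau>. J \<subseteq> index_pairs n \<and> J \<noteq> {} \<and> \<tau> \<subseteq> J \<and>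
      (\<forall>\<sigma>\<subseteq>index_pairs n. \<sigma> \<inter> J = \<tau> \<longrightarrow> real (pattern_chromatic_number n \<sigma>) \<ge> (1 + \<epsilon>) * real n / (2 * log 2 (real n))) \<and>
      b n \<le> real (\<Sum>k<d n. card J choose k) / 2 ^ card J"
  proof eventually_elim
    case (elim n)
    \<comment> \<open>Rounding up lets the clique reach the claimed bound; it is this rounding that
      can push the number of pairs past \<open>d n\<close>.\<close>
    define k where "k = nat \<lceil>m n\<rceil>"
    have k: "k \<ge> 2" "m n \<le> real k" "real k < m n + 1"
      using elim(2) by (simp_all add: k_def, (linarith+)?)
    have "k \<le> n" using k elim(3) by linarith
    define N where "N = card (index_pairs k)"
    have "even (k * (k - 1))" by (cases k) auto
    then have "2 * N = k * (k - 1)" by (simp add: N_def card_index_pairs choose_two)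
    then have "2 * real N = real (k * (k - 1))" by (metis of_nat_mult of_nat_numeral)
    then have N2: "2 * real N = real k * (real k - 1)" using k(1) by simp
    also have "\<dots> \<le> (m n + 1) * m n" using k by (intro mult_mono) auto
    finally have N: "real N \<le> (m n * m n + m n) / 2" by (simp add: algebra_simps)
    have dn: "2 * real (d n) \<ge> m n * m n"
      using d[OF elim(1)] by (simp add: m_def p_def power2_eq_square)
    have pos: "m n * m n - m n > 0" using elim(2) by simp
    then have gap: "(m n * m n - m n) / 2 \<le> 2 * real (d n) - real N" using N dn by (simp add: field_simps)
    then have "real N < real (2 * d n)" using pos by simp
    then have "2 * d n > N" by (simp only: of_nat_less_iff)
    from sum_choose_Chebyshev[OF this]
    have "1 - real N / (2 * real (d n) - real N)\<^sup>2 \<le> real (\<Sum>k<d n. N choose k) / 2 ^ N" .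
    moreover have "real N / (2 * real (d n) - real N)\<^sup>2 \<le> ((m n * m n + m n) / 2) / ((m n * m n - m n) / 2)\<^sup>2"
      using N gap pos elim(2) by (intro frac_le power_mono) auto
    ultimately have bn: "b n \<le> real (\<Sum>k<d n. N choose k) / 2 ^ N" unfolding b_def by linarith
    have "real (pattern_chromatic_number n \<sigma>) \<ge> (1 + \<epsilon>) * real n / (2 * log 2 (real n))"
      if "\<sigma> \<subseteq> index_pairs n" "\<sigma> \<inter> index_pairs k = index_pairs k" for \<sigma>
    proof -
      have "k \<le> pattern_chromatic_number n \<sigma>" using that \<open>k \<le> n\<close> by (intro chromatic_number_clique) auto
      then show ?thesis using k(2) by (simp add: m_def p_def)
    qed
    moreover have "index_pairs k \<noteq> {}" using index_pairs_nonempty[OF k(1)] .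
    moreover have "index_pairs k \<subseteq> index_pairs n" using \<open>k \<le> n\<close> by (auto simp: index_pairs_def)
    ultimately show ?case using bn unfolding N_def by (intro exI[of _ "index_pairs k"]) auto
  qed
qed

end

theorem theorem3p1:
  fixes \<epsilon> :: real
    and d :: "nat \<Rightarrow> nat"
    and M :: "nat \<Rightarrow> 'a measure"
    and X :: "nat \<Rightarrow> nat \<times> nat \<Rightarrow> 'a \<Rightarrow> nat \<Rightarrow> real"
  assumes eps: "0 < \<epsilon>" "\<epsilon> < 1 / 2"
    and d_pos: "\<And>n. d n \<ge> 1"
    and M_prob: "\<And>n. prob_space (M n)"
    and X_normal: "\<And>n e. e \<in> index_pairs n \<Longrightarrow> std_normal_vec (d n) (M n) (X n e)"
    and X_indep: "\<And>n. prob_space.indep_vars (M n) (\<lambda>_. vec_space (d n)) (X n) (index_pairs n)"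
  shows
    "((\<lambda>n. real (d n)) \<in> o(\<lambda>n. real n / ln (real n) ^ 3) \<longrightarrow>
        whp M (\<lambda>n \<omega>. \<forall>s\<in>unit_sphere (d n).
          real (\<chi>\<Gamma> n (d n) (\<lambda>e. X n e \<omega>) s) \<ge> (1 - \<epsilon>) * real n / (2 * log 2 (real n)))) \<and>
     ((\<forall>n\<ge>2. real (d n) \<ge> 2 * real n * log 2 (real n) / (1 - 2 * \<epsilon>)) \<longrightarrow>
        whp M (\<lambda>n \<omega>. \<exists>s\<in>unit_sphere (d n).
          real (\<chi>\<Gamma> n (d n) (\<lambda>e. X n e \<omega>) s) \<le> (1 - \<epsilon>) * real n / (2 * log 2 (real n)))) \<and>
     ((\<lambda>n. real (d n)) \<in> o(\<lambda>n. real n ^ 2 / ln (real n) ^ 6) \<longrightarrow>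
        whp M (\<lambda>n \<omega>. \<forall>s\<in>unit_sphere (d n).
          real (\<chi>\<Gamma> n (d n) (\<lambda>e. X n e \<omega>) s) \<le> (1 + \<epsilon>) * real n / (2 * log 2 (real n)))) \<and>
     ((\<forall>n\<ge>2. real (d n) \<ge> 1 / 2 * ((1 + \<epsilon>) * real n / (2 * log 2 (real n))) ^ 2) \<longrightarrow>
        whp M (\<lambda>n \<omega>. \<exists>s\<in>unit_sphere (d n).
          real (\<chi>\<Gamma> n (d n) (\<lambda>e. X n e \<omega>) s) \<ge> (1 + \<epsilon>) * real n / (2 * log 2 (real n))))"
proof -
  interpret random_rotated_graphs d M X
    by (rule random_rotated_graphs.intro) (fact M_prob X_normal X_indep)+
  have \<chi>: "\<chi>\<Gamma> n (d n) (\<lambda>e. X n e \<omega>) s = pattern_chromatic_number n (pattern n \<omega> s)" for n \<omega> s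
    by (simp add: \<chi>\<Gamma>_pattern pattern_def)
  have "\<epsilon> < 1" using eps by simp
  show ?thesis
    unfolding \<chi>
    using chromatic_number_all_ge[OF eps(1) \<open>\<epsilon> < 1\<close>] chromatic_number_exists_le[OF eps]
      chromatic_number_all_le[OF eps(1)] chromatic_number_exists_ge[OF eps(1) \<open>\<epsilon> < 1\<close>]
    by blast
qed

end
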